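(* Let $k\ge2$ be fixed. Assume that there exists $\delta_0\in(0,1)$ such that $\delta_0<p_i/p_j<\delta_0^{-1}$ for $1\le i,j\le k$, and that $p\to\infty$ and $p/n\to0$ as $n\to\infty$. For the likelihood ratio statistic $\Lambda_n$ of test (VII) described in the context, with $f$ and $\rho$ given there, under $H_0$ there exists a small constant $\delta\in(0,1)$ such that for any $\alpha\in(0,1)$, as $n\to\infty$: (i) $$\Pr\{-2\log\Lambda_n>\chi^2_f(\alpha)\}-\alpha=\bar\Phi\Bigl\{\frac{\chi^2_f(\alpha)+2\mu_n}{2n\sigma_n}\Bigr\}-\alpha+O\Bigl\{\Bigl(\frac pn\Bigr)^{\frac{1-\delta}{2}}+f^{-\frac{1-\delta}{6}}\Bigr\};$$ (ii) $$\Pr\{-2\rho\log\Lambda_n>\chi^2_f(\alpha)\}-\alpha=\bar\Phi\Bigl\{\frac{\chi^2_f(\alpha)+2\rho\mu_n}{2\rho n\sigma_n}\Bigr\}-\alpha+O\Bigl\{\Bigl(\frac pn\Bigr)^{\frac{1-\delta}{2}}+f^{-\frac{1-\delta}{6}}\Bigr\};$$ where, with $L_{x,q}=\log(1-q/x)$ for $x>q$, $$\mu_n=\frac n2\Bigl[-\Bigl(n-p-\frac32\Bigr)L_{n-1,p}+\sum_{j=1}^k\Bigl(n-p_j-\frac32\Bigr)L_{n-1,p_j}\Bigr],\qquad\sigma_n^2=\frac12\Bigl(-L_{n-1,p}+\sum_{j=1}^kL_{n-1,p_j}\Bigr).$$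
   Context: $x_1,\dots,x_n\in\mathbb R^p$ are i.i.d. $\mathcal N_p(\mu,\Sigma)$. Partition $x_i=(\xi_{i1}^T,\dots,\xi_{ik}^T)^T$ and $\Sigma=(\Sigma_{jl})_{1\le j,l\le k}$, where $\xi_{ij}$ is $p_j\times1$, $\Sigma_{jl}$ is $p_j\times p_l$, and $\sum_{j=1}^kp_j=p$; the $p_j$ may depend on $n$. Put $\bar x=n^{-1}\sum_ix_i$, $\bar\xi_j=n^{-1}\sum_i\xi_{ij}$, $A=\sum_{i=1}^n(x_i-\bar x)(x_i-\bar x)^T$, $A_{jj}=\sum_{i=1}^n(\xi_{ij}-\bar\xi_j)(\xi_{ij}-\bar\xi_j)^T$; $|\cdot|$ is the determinant. Test (VII): $H_0:\Sigma_{jl}=0$ for all $1\le j<l\le k$; $\Lambda_n=|A|^{n/2}\prod_{j=1}^k|A_{jj}|^{-n/2}$; $f=(p^2-\sum_{i=1}^kp_i^2)/2$; $\rho=1-\frac{3}{2n}-\{3n(p^2-\sum_{i=1}^kp_i^2)\}^{-1}(p^3-\sum_{i=1}^kp_i^3)$. $\chi^2_f(\alpha)$ is the upper $\alpha$-quantile of the chi-squared distribution with $f$ degrees of freedom; $\bar\Phi=1-\Phi$ with $\Phi$ the standard normal cumulative distribution function; $\sigma_n>0$. *)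

theory Defs
  imports
    "HOL-Probability.Probability"
    "HOL-Library.Landau_Symbols"
    "Jordan_Normal_Form.Determinant"
    "Jordan_Normal_Form.Gauss_Jordan_Elimination"
begin

text \<open>
  The dimension varies with the sample size, so a random vector in \<open>\<real>\<^sup>p\<close> is a random element of the
  product space \<open>\<Pi>\<^sub>M a\<in>{..<p}. lborel\<close>, with outcomes of type \<^typ>\<open>nat \<Rightarrow> real\<close> read at the
  coordinates \<open>a < p\<close>. Parameters and determinants use vectors and matrices with carriers.
  Several names below also occur in HOL-Analysis and are therefore qualified.
\<close>

definition pos_def_mat :: "nat \<Rightarrow> real mat \<Rightarrow> bool" where
  "pos_def_mat p S \<longleftrightarrow> S \<in> carrier_mat p p \<and> transpose_mat S = S \<and>
     (\<forall>v\<in>carrier_vec p. v \<noteq> 0\<^sub>v p \<longrightarrow> scalar_prod v (S *\<^sub>v v) > 0)"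

abbreviation vec_space :: "nat \<Rightarrow> (nat \<Rightarrow> real) measure" where
  "vec_space p \<equiv> (\<Pi>\<^sub>M a\<in>{..<p}. lborel)"

text \<open>\<open>the (mat_inverse S)\<close> is the inverse of \<open>S\<close>; it exists for positive definite \<open>S\<close>.\<close>

definition mvn_density :: "nat \<Rightarrow> real Matrix.vec \<Rightarrow> real mat \<Rightarrow> (nat \<Rightarrow> real) \<Rightarrow> real" where
  "mvn_density p m S x =
     (let y = Matrix.vec p x - m
      in exp (- (scalar_prod y (the (mat_inverse S) *\<^sub>v y)) / 2)
           / sqrt ((2 * pi) ^ p * Determinant.det S))"

text \<open>\<open>X 0, \<dots>, X (n - 1)\<close> are i.i.d. (nondegenerate) \<open>N\<^sub>p(m, S)\<close>.\<close>

definition normal_sample ::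
  "'a measure \<Rightarrow> nat \<Rightarrow> nat \<Rightarrow> real Matrix.vec \<Rightarrow> real mat \<Rightarrow> (nat \<Rightarrow> 'a \<Rightarrow> nat \<Rightarrow> real) \<Rightarrow> bool"
where
  "normal_sample M n p m S X \<longleftrightarrow>
     prob_space M \<and> m \<in> carrier_vec p \<and> pos_def_mat p S \<and>
     prob_space.indep_vars M (\<lambda>_. vec_space p) X {..<n} \<and>
     (\<forall>i<n. distributed M (vec_space p) (X i) (\<lambda>x. ennreal (mvn_density p m S x)))"

text \<open>
  A partition into \<open>k\<close> blocks is given by the block sizes \<open>d 0, \<dots>, d (k - 1)\<close>; block \<open>j\<close> consists
  of the coordinates from \<open>offset d j\<close> to \<open>offset d j + d j - 1\<close>.
\<close>

definition offset :: "(nat \<Rightarrow> nat) \<Rightarrow> nat \<Rightarrow> nat" where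
  "offset d j = (\<Sum>l<j. d l)"

definition total_dim :: "nat \<Rightarrow> (nat \<Rightarrow> nat) \<Rightarrow> nat" where
  "total_dim k d = (\<Sum>j<k. d j)"

definition block :: "(nat \<Rightarrow> nat) \<Rightarrow> real mat \<Rightarrow> nat \<Rightarrow> nat \<Rightarrow> real mat" where
  "block d S j l = Matrix.mat (d j) (d l) (\<lambda>(a, b). S $$ (offset d j + a, offset d l + b))"

definition block_independence :: "nat \<Rightarrow> (nat \<Rightarrow> nat) \<Rightarrow> real mat \<Rightarrow> bool" where
  "block_independence k d S \<longleftrightarrow> (\<forall>j l. j < l \<and> l < k \<longrightarrow> block d S j l = 0\<^sub>m (d j) (d l))"

text \<open>In the following, \<open>x i a\<close> is the coordinate \<open>a\<close> of the observation \<open>i\<close>.\<close>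

definition sample_mean :: "nat \<Rightarrow> (nat \<Rightarrow> nat \<Rightarrow> real) \<Rightarrow> nat \<Rightarrow> real" where
  "sample_mean n x a = (\<Sum>i<n. x i a) / real n"

definition scatter_mat :: "nat \<Rightarrow> nat \<Rightarrow> (nat \<Rightarrow> nat \<Rightarrow> real) \<Rightarrow> real mat" where
  "scatter_mat n p x = Matrix.mat p p
     (\<lambda>(a, b). \<Sum>i<n. (x i a - sample_mean n x a) * (x i b - sample_mean n x b))"

definition sub_obs :: "(nat \<Rightarrow> nat) \<Rightarrow> nat \<Rightarrow> (nat \<Rightarrow> nat \<Rightarrow> real) \<Rightarrow> nat \<Rightarrow> nat \<Rightarrow> real" where
  "sub_obs d j x i a = x i (offset d j + a)"

definition LRT :: "nat \<Rightarrow> nat \<Rightarrow> (nat \<Rightarrow> nat) \<Rightarrow> (nat \<Rightarrow> nat \<Rightarrow> real) \<Rightarrow> real" where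
  "LRT n k d x =
     Determinant.det (scatter_mat n (total_dim k d) x) powr (real n / 2) *
     (\<Prod>j<k. Determinant.det (scatter_mat n (d j) (sub_obs d j x)) powr (- real n / 2))"

definition lrt_df :: "nat \<Rightarrow> (nat \<Rightarrow> nat) \<Rightarrow> real" where
  "lrt_df k d = (real (total_dim k d) ^ 2 - (\<Sum>i<k. real (d i) ^ 2)) / 2"

definition bartlett :: "nat \<Rightarrow> nat \<Rightarrow> (nat \<Rightarrow> nat) \<Rightarrow> real" where
  "bartlett n k d =
     1 - 3 / (2 * real n)
       - (real (total_dim k d) ^ 3 - (\<Sum>i<k. real (d i) ^ 3))
         / (3 * real n * (real (total_dim k d) ^ 2 - (\<Sum>i<k. real (d i) ^ 2)))"

definition chi_square :: "real \<Rightarrow> real measure" where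
  "chi_square f = density lborel (\<lambda>x. ennreal
     (if x > 0 then x powr (f / 2 - 1) * exp (- x / 2) / (2 powr (f / 2) * Gamma (f / 2)) else 0))"

text \<open>Upper quantile: the point with probability \<open>\<alpha>\<close> to its right.\<close>

definition chi_square_upper_quantile :: "real \<Rightarrow> real \<Rightarrow> real" where
  "chi_square_upper_quantile f \<alpha> = Inf {x. measure (chi_square f) {x<..} \<le> \<alpha>}"

definition normal_tail :: "real \<Rightarrow> real" where
  "normal_tail x = 1 - cdf std_normal_distribution x"

definition L :: "real \<Rightarrow> real \<Rightarrow> real" where
  "L x q = ln (1 - q / x)"

definition lrt_mu :: "nat \<Rightarrow> nat \<Rightarrow> (nat \<Rightarrow> nat) \<Rightarrow> real" where
  "lrt_mu n k d = (let p = real (total_dim k d) in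
     real n / 2 *
       (- (real n - p - 3 / 2) * L (real n - 1) p
        + (\<Sum>j<k. (real n - real (d j) - 3 / 2) * L (real n - 1) (real (d j)))))"

definition lrt_sigma :: "nat \<Rightarrow> nat \<Rightarrow> (nat \<Rightarrow> nat) \<Rightarrow> real" where
  "lrt_sigma n k d = sqrt (1 / 2 *
     (- L (real n - 1) (real (total_dim k d)) + (\<Sum>j<k. L (real n - 1) (real (d j)))))"

end

theory Submission
  imports Defs "HOL-Real_Asymp.Real_Asymp"
begin

text \<open>
  Under the null hypothesis the sample can be whitened blockwise, so that its data columns become
  independent standard Gaussian vectors in \<open>\<real>\<^sup>n\<close> and the determinant ratio is unchanged. Rotating
  the vector of ones and the first columns into triangular position peels off one column at a time
  and shows that the ratio is distributed as a product of independent factors \<open>A / (A + B)\<close>, where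
  \<open>A\<close> and \<open>B\<close> are independent \<open>\<chi>\<^sup>2\<close> variables with \<open>n - 1 - a\<close> and \<open>o\<^sub>a\<close> degrees of freedom
  for column \<open>a\<close> of the block starting at column \<open>o\<^sub>a\<close>. So \<open>-2 ln \<Lambda>\<^sub>n\<close> has the law of \<open>n\<close> times a sum
  of \<open>p\<close> independent terms \<open>ln (1 + B / A)\<close>. Lindeberg's replacement argument with a smoothed
  indicator bounds its uniform distance to the normal law by a power of the fourth-moment ratio,
  which is \<open>O(1/p)\<close>; the sums of the means and variances differ from \<open>-2 \<mu>\<^sub>n / n\<close> and
  \<open>4 \<sigma>\<^sub>n\<^sup>2\<close> by \<open>O(p/n)\<close> times the standard deviation and the variance, respectively. The resulting rate \<open>O(p\<^sup>-\<^sup>1\<^sup>/\<^sup>8 + p/n)\<close>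
  is uniform in the threshold, so no property of the \<open>\<chi>\<^sup>2\<close> quantile is needed, (ii) is (i) at the
  threshold \<open>\<chi>\<^sup>2\<^sub>f(\<alpha>) / \<rho>\<close>, and \<open>\<delta> = 3/4\<close> works.
\<close>

section \<open>Lindeberg replacement\<close>

text \<open>The exponent 1/8 is the outcome of a balance. Since \<open>2 * \<bar>x\<bar> ^ 3\<close>
  is at most \<open>\<kappa> * x\<^sup>2 + x ^ 4 / \<kappa>\<close>, a fourth-moment ratio
  \<open>l\<close> controls the third moments at order \<open>sqrt l\<close>; a ramp of width
  \<open>\<eta>\<close> turns this into an error of order
  \<open>\<eta> + sqrt l / \<eta> ^ 3\<close>, and \<open>\<eta> = l powr (1 / 8)\<close> makes both
  parts equal. As f is at most p^2, p^(-1/8) lies below f^(-1/24), which is the exponent belonging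
  to \<delta> = 3/4. The scale that governs everything is the standard deviation of the sum of
  logarithms, which is only of order p/n: column a contributes a variance of about 2 o_a / n^2, the
  o_a add up to f, and comparable blocks keep f of order p^2. The centring therefore has to be right
  up to (p/n)^2. Replacing ln (1 + v) by v would cost about p (p/n)^2, so the logarithms are kept
  and summed almost exactly. The rotation used for a column depends on all earlier columns, so the
  independent factors do not exist pointwise. They appear only in law, by integrating out the last
  column for fixed earlier ones, against arbitrary nonnegative test functions.\<close>

abbreviation std_normal :: "real measure" where "std_normal \<equiv> std_normal_distribution"

lemma prob_space_std_normal: "prob_space std_normal"
  by (rule prob_space_normal_density) simp

lemma std_normal_moments:
  shows integrable_std_normal_power: "integrable std_normal (\<lambda>z. z ^ k)"
    and integrable_std_normal_abs_power: "integrable std_normal (\<lambda>z. \<bar>z\<bar> ^ k)"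
    and integral_std_normal_1: "(\<integral>z. z \<partial>std_normal) = 0"
    and integral_std_normal_2: "(\<integral>z. z\<^sup>2 \<partial>std_normal) = 1"
    and integral_std_normal_abs_3: "(\<integral>z. \<bar>z\<bar> ^ 3 \<partial>std_normal) \<le> 2"
proof -
  show i: "integrable std_normal (\<lambda>z. z ^ k)" for k
    using integrable_std_normal_moment[of k] by (subst integrable_density) auto
  show ia: "integrable std_normal (\<lambda>z. \<bar>z\<bar> ^ k)" for k
    using integrable_std_normal_moment_abs[of k] by (subst integrable_density) auto
  show "(\<integral>z. z \<partial>std_normal) = 0"
    using integral_std_normal_moment_odd[of 0] by (subst integral_density) auto
  show 2: "(\<integral>z. z\<^sup>2 \<partial>std_normal) = 1"
    using integral_std_normal_moment_even[of 1] by (subst integral_density) auto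
  have 4: "(\<integral>z. z ^ 4 \<partial>std_normal) = 3"
    using integral_std_normal_moment_even[of 2] by (subst integral_density) (auto simp: fact_numeral)
  \<comment> \<open>The bound 2 is \<open>(1 + 3) / 2\<close>, from the second and fourth moments 1
    and 3 and \<open>2 * \<bar>z\<bar> ^ 3 \<le> z\<^sup>2 + z ^ 4\<close>.\<close>
  have "(\<integral>z. \<bar>z\<bar> ^ 3 \<partial>std_normal) \<le> (\<integral>z. (z\<^sup>2 + z ^ 4) / 2 \<partial>std_normal)"
  proof (rule integral_mono)
    fix z :: real
    have "0 \<le> z\<^sup>2 * (1 - \<bar>z\<bar>)\<^sup>2" by simp
    also have "\<dots> = z\<^sup>2 + z ^ 4 - 2 * \<bar>z\<bar> ^ 3"
      by (cases "z \<ge> 0") (simp_all add: algebra_simps power2_eq_square power3_eq_cube power4_eq_xxxx)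
    finally show "\<bar>z\<bar> ^ 3 \<le> (z\<^sup>2 + z ^ 4) / 2" by simp
  qed (use i[of 2] i[of 4] ia[of 3] in auto)
  also have "\<dots> = 2" using i[of 2] i[of 4] 2 4 by simp
  finally show "(\<integral>z. \<bar>z\<bar> ^ 3 \<partial>std_normal) \<le> 2" .
qed

text \<open>\<open>a\<close> and \<open>b\<close> play the roles of \<open>g'\<close> and \<open>g'' / 2\<close>; asking only for the Taylor bound avoids
  differentiating under the integral.\<close>
definition taylor3 :: "real \<Rightarrow> (real \<Rightarrow> real) \<Rightarrow> (real \<Rightarrow> real) \<Rightarrow> (real \<Rightarrow> real) \<Rightarrow> bool" where
  "taylor3 K g a b \<longleftrightarrow> g \<in> borel_measurable borel \<and> a \<in> borel_measurable borel \<and> b \<in> borel_measurable borel \<and>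
    (\<exists>C. \<forall>x. \<bar>g x\<bar> \<le> C \<and> \<bar>a x\<bar> \<le> C \<and> \<bar>b x\<bar> \<le> C) \<and>
    (\<forall>c x. \<bar>g (c + x) - g c - a c * x - b c * x\<^sup>2\<bar> \<le> K * \<bar>x\<bar> ^ 3)"

lemma taylor3_bounded: "taylor3 K g a b \<Longrightarrow> \<exists>C. \<forall>x. \<bar>g x\<bar> \<le> C"
  and taylor3_measurable: "taylor3 K g a b \<Longrightarrow> g \<in> borel_measurable borel"
  unfolding taylor3_def by blast+

lemma (in prob_space) integrable_bounded_comp:
  fixes g :: "real \<Rightarrow> real"
  assumes "g \<in> borel_measurable borel" "Y \<in> borel_measurable M" "\<And>x. \<bar>g x\<bar> \<le> C"
  shows "integrable M (\<lambda>\<omega>. g (Y \<omega>))"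
  by (rule integrable_const_bound[where B=C]) (use assms in auto)

lemma (in prob_space) abs_expectation_le:
  fixes f h :: "'a \<Rightarrow> real"
  assumes "integrable M f" "integrable M h" "\<And>\<omega>. \<bar>f \<omega>\<bar> \<le> h \<omega>"
  shows "\<bar>expectation f\<bar> \<le> expectation h"
  using integral_abs_bound[of M f] integral_mono[OF integrable_abs[OF assms(1)] assms(2,3)] by linarith

text \<open>The linear Taylor term dies with the mean, so the law of \<open>X\<close> enters only
  through its variance, up to the third moment. Two centred variables of equal variance are
  therefore interchangeable at any base point \<open>c\<close>.\<close>

lemma (in prob_space) taylor3_expectation:
  assumes g: "taylor3 K g a b" and X[measurable]: "X \<in> borel_measurable M"
    and int: "integrable M X" "integrable M (\<lambda>\<omega>. (X \<omega>)\<^sup>2)" "integrable M (\<lambda>\<omega>. \<bar>X \<omega>\<bar> ^ 3)"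
    and mean: "expectation X = 0"
  shows "\<bar>expectation (\<lambda>\<omega>. g (c + X \<omega>)) - g c - b c * expectation (\<lambda>\<omega>. (X \<omega>)\<^sup>2)\<bar>
    \<le> K * expectation (\<lambda>\<omega>. \<bar>X \<omega>\<bar> ^ 3)"
proof -
  obtain C where C: "\<And>x. \<bar>g x\<bar> \<le> C" and [measurable]: "g \<in> borel_measurable borel"
    using g unfolding taylor3_def by auto
  have ig: "integrable M (\<lambda>\<omega>. g (c + X \<omega>))"
    by (rule integrable_bounded_comp[OF _ _ C]) auto
  have "expectation (\<lambda>\<omega>. g (c + X \<omega>)) - g c - b c * expectation (\<lambda>\<omega>. (X \<omega>)\<^sup>2) =
      expectation (\<lambda>\<omega>. g (c + X \<omega>) - g c - a c * X \<omega> - b c * (X \<omega>)\<^sup>2)"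
    using int ig by (simp add: mean prob_space)
  also have "\<bar>\<dots>\<bar> \<le> expectation (\<lambda>\<omega>. K * \<bar>X \<omega>\<bar> ^ 3)"
  proof (rule abs_expectation_le)
    show "integrable M (\<lambda>\<omega>. g (c + X \<omega>) - g c - a c * X \<omega> - b c * (X \<omega>)\<^sup>2)"
      by (intro Bochner_Integration.integrable_diff integrable_mult_right ig int integrable_const)
    show "\<bar>g (c + X \<omega>) - g c - a c * X \<omega> - b c * (X \<omega>)\<^sup>2\<bar> \<le> K * \<bar>X \<omega>\<bar> ^ 3" for \<omega>
      using g unfolding taylor3_def by blast
  qed (intro integrable_mult_right int)
  also have "\<dots> = K * expectation (\<lambda>\<omega>. \<bar>X \<omega>\<bar> ^ 3)" by simp
  finally show ?thesis .
qed

text \<open>The Taylor inequality holds pointwise and survives averaging over translations, with the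
  same \<open>K\<close>. Hence a test function stays in the class once a replaced Gaussian summand
  has been absorbed into it.\<close>

lemma (in prob_space) taylor3_mix:
  assumes g: "taylor3 K g a b" and Y[measurable]: "Y \<in> borel_measurable M"
  shows "taylor3 K (\<lambda>c. expectation (\<lambda>\<omega>. g (c + Y \<omega>))) (\<lambda>c. expectation (\<lambda>\<omega>. a (c + Y \<omega>)))
    (\<lambda>c. expectation (\<lambda>\<omega>. b (c + Y \<omega>)))"
proof -
  obtain C where C: "\<And>x. \<bar>g x\<bar> \<le> C" "\<And>x. \<bar>a x\<bar> \<le> C" "\<And>x. \<bar>b x\<bar> \<le> C"
    and m[measurable]: "g \<in> borel_measurable borel" "a \<in> borel_measurable borel" "b \<in> borel_measurable borel"
    and T: "\<And>c x. \<bar>g (c + x) - g c - a c * x - b c * x\<^sup>2\<bar> \<le> K * \<bar>x\<bar> ^ 3"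
    using g unfolding taylor3_def by auto
  have int: "integrable M (\<lambda>\<omega>. g (c + Y \<omega>))" "integrable M (\<lambda>\<omega>. a (c + Y \<omega>))"
    "integrable M (\<lambda>\<omega>. b (c + Y \<omega>))" for c
    by (rule integrable_bounded_comp[OF _ _ C(1)] integrable_bounded_comp[OF _ _ C(2)]
        integrable_bounded_comp[OF _ _ C(3)]; measurable)+
  have bd: "\<bar>expectation (\<lambda>\<omega>. h (c + Y \<omega>))\<bar> \<le> C"
    if "\<And>x. \<bar>h x\<bar> \<le> C" "h \<in> borel_measurable borel" for h c
  proof -
    have "\<bar>expectation (\<lambda>\<omega>. h (c + Y \<omega>))\<bar> \<le> expectation (\<lambda>\<omega>. C)"
      using that by (intro abs_expectation_le integrable_bounded_comp[OF that(2) _ that(1)]) auto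
    then show ?thesis by (simp add: prob_space)
  qed
  have T': "\<bar>expectation (\<lambda>\<omega>. g (c + x + Y \<omega>)) - expectation (\<lambda>\<omega>. g (c + Y \<omega>)) -
      expectation (\<lambda>\<omega>. a (c + Y \<omega>)) * x - expectation (\<lambda>\<omega>. b (c + Y \<omega>)) * x\<^sup>2\<bar> \<le> K * \<bar>x\<bar> ^ 3" for c x
  proof -
    have "expectation (\<lambda>\<omega>. g (c + x + Y \<omega>)) - expectation (\<lambda>\<omega>. g (c + Y \<omega>)) -
      expectation (\<lambda>\<omega>. a (c + Y \<omega>)) * x - expectation (\<lambda>\<omega>. b (c + Y \<omega>)) * x\<^sup>2 =
      expectation (\<lambda>\<omega>. g (c + x + Y \<omega>) - g (c + Y \<omega>) - a (c + Y \<omega>) * x - b (c + Y \<omega>) * x\<^sup>2)"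
      using int[of c] int[of "c + x"] by simp
    also have "\<bar>\<dots>\<bar> \<le> expectation (\<lambda>\<omega>. K * \<bar>x\<bar> ^ 3)"
    proof (rule abs_expectation_le)
      show "integrable M (\<lambda>\<omega>. g (c + x + Y \<omega>) - g (c + Y \<omega>) - a (c + Y \<omega>) * x - b (c + Y \<omega>) * x\<^sup>2)"
        by (intro Bochner_Integration.integrable_diff integrable_mult_left int)
      show "\<bar>g (c + x + Y \<omega>) - g (c + Y \<omega>) - a (c + Y \<omega>) * x - b (c + Y \<omega>) * x\<^sup>2\<bar> \<le> K * \<bar>x\<bar> ^ 3" for \<omega>
        using T[of "c + Y \<omega>" x] by (simp only: add.assoc add.commute[of x])
    qed simp
    finally show ?thesis by (simp add: prob_space)
  qed
  have meas: "(\<lambda>c. expectation (\<lambda>\<omega>. h (c + Y \<omega>))) \<in> borel_measurable borel"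
    if [measurable]: "h \<in> borel_measurable borel" for h :: "real \<Rightarrow> real"
    by measurable
  show ?thesis
    unfolding taylor3_def
    by (intro conjI exI[of _ C] allI bd[OF C(1) m(1)] bd[OF C(2) m(2)] bd[OF C(3) m(3)] meas m T')
qed

text \<open>Independent centred normals add up to a normal whose variances add. A zero scale is
  treated separately, as it has no density; it does occur, for the empty sum and for the columns of
  the first block, whose logarithmic term is 0.\<close>

lemma integral_std_normal_convolve:
  fixes g :: "real \<Rightarrow> real"
  assumes [measurable]: "g \<in> borel_measurable borel" and C: "\<And>x. \<bar>g x\<bar> \<le> C" and st: "0 \<le> s" "0 \<le> t"
  shows "(\<integral>z. (\<integral>w. g (s * z + t * w) \<partial>std_normal) \<partial>std_normal) = (\<integral>z. g (sqrt (s\<^sup>2 + t\<^sup>2) * z) \<partial>std_normal)"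
proof -
  interpret N: prob_space std_normal by (rule prob_space_std_normal)
  show ?thesis
  proof (cases "s = 0 \<or> t = 0")
    case True
    then show ?thesis using st N.prob_space by auto
  next
    case False
    then have pos: "0 < s" "0 < t" using st by auto
    interpret P: pair_prob_space std_normal std_normal ..
    let ?P = "std_normal \<Otimes>\<^sub>M std_normal"
    have fst: "distr ?P borel fst = std_normal"
      using N.distr_pair_fst[of std_normal] by (simp cong: distr_cong)
    have snd: "distr ?P borel snd = std_normal"
    proof -
      have "distr ?P borel snd = distr (distr ?P ?P (\<lambda>(x, y). (y, x))) borel snd"
        by (simp add: P.distr_pair_swap[symmetric])
      also have "\<dots> = distr ?P borel fst"
        by (subst distr_distr) (auto simp: comp_def case_prod_beta)
      finally show ?thesis by (simp add: fst)
    qed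
    have d: "distributed ?P lborel fst std_normal_density" "distributed ?P lborel snd std_normal_density"
      using fst snd by (auto simp: distributed_def cong: distr_cong)
    have dX: "distributed ?P lborel (\<lambda>x. s * fst x) (normal_density 0 s)"
      using P.normal_density_affine[OF d(1), of s 0] pos by simp
    have dY: "distributed ?P lborel (\<lambda>x. t * snd x) (normal_density 0 t)"
      using P.normal_density_affine[OF d(2), of t 0] pos by simp
    have "P.indep_var borel fst borel snd"
    proof (subst P.indep_var_distribution_eq, intro conjI)
      have "distr ?P (borel \<Otimes>\<^sub>M borel) (\<lambda>x. (fst x, snd x)) = distr ?P ?P (\<lambda>x. x)"
        by (rule distr_cong) (auto intro!: sets_pair_measure_cong)
      then show "distr ?P borel fst \<Otimes>\<^sub>M distr ?P borel snd = distr ?P (borel \<Otimes>\<^sub>M borel) (\<lambda>x. (fst x, snd x))"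
        by (simp add: fst snd)
    qed auto
    from P.indep_var_compose[OF this, of "\<lambda>x. s * x" borel "\<lambda>x. t * x" borel]
    have "P.indep_var borel (\<lambda>x. s * fst x) borel (\<lambda>x. t * snd x)" by (simp add: comp_def)
    from P.add_indep_normal[OF this pos dX dY]
    have sum: "distributed ?P lborel (\<lambda>x. s * fst x + t * snd x) (normal_density 0 (sqrt (s\<^sup>2 + t\<^sup>2)))"
      by simp
    have scaled: "distributed std_normal lborel (\<lambda>z. sqrt (s\<^sup>2 + t\<^sup>2) * z) (normal_density 0 (sqrt (s\<^sup>2 + t\<^sup>2)))"
    proof -
      have "distr std_normal lborel (\<lambda>x. x) = distr std_normal std_normal (\<lambda>x. x)"
        by (rule distr_cong) auto
      then have "distributed std_normal lborel (\<lambda>x. x) std_normal_density" by (simp add: distributed_def)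
      from N.normal_density_affine[OF this, of "sqrt (s\<^sup>2 + t\<^sup>2)" 0] pos
      show ?thesis by (simp add: sum_power2_eq_zero_iff)
    qed
    have "(\<integral>z. (\<integral>w. g (s * z + t * w) \<partial>std_normal) \<partial>std_normal) = (\<integral>x. g (s * fst x + t * snd x) \<partial>?P)"
      using P.integral_fst'[of "\<lambda>x. g (s * fst x + t * snd x)"]
        P.integrable_bounded_comp[of g "\<lambda>x. s * fst x + t * snd x" C] C by simp
    also have "\<dots> = (\<integral>x. normal_density 0 (sqrt (s\<^sup>2 + t\<^sup>2)) x * g x \<partial>lborel)"
      by (rule distributed_integral[OF sum, symmetric]) auto
    also have "\<dots> = (\<integral>z. g (sqrt (s\<^sup>2 + t\<^sup>2) * z) \<partial>std_normal)"
      by (rule distributed_integral[OF scaled]) auto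
    finally show ?thesis .
  qed
qed

text \<open>Induction on the number of summands for all test functions at once: the last summand is
  exchanged for a Gaussian of the same variance, which is then absorbed into the test function. The
  term \<open>2 * sqrt (v a) ^ 3\<close> is the third absolute moment of that Gaussian.\<close>

theorem (in prob_space) lindeberg:
  fixes X :: "nat \<Rightarrow> 'a \<Rightarrow> real" and v :: "nat \<Rightarrow> real" and m :: nat
  assumes "indep_vars (\<lambda>_. borel) X {..<m}"
    and "\<And>a. a < m \<Longrightarrow> integrable M (X a)" "\<And>a. a < m \<Longrightarrow> expectation (X a) = 0"
    and "\<And>a. a < m \<Longrightarrow> integrable M (\<lambda>\<omega>. (X a \<omega>)\<^sup>2)"
    and "\<And>a. a < m \<Longrightarrow> integrable M (\<lambda>\<omega>. \<bar>X a \<omega>\<bar> ^ 3)"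
    and "\<And>a. a < m \<Longrightarrow> expectation (\<lambda>\<omega>. (X a \<omega>)\<^sup>2) = v a"
    and "taylor3 K g da db" and "K \<ge> 0"
  shows "\<bar>expectation (\<lambda>\<omega>. g (\<Sum>a<m. X a \<omega>)) - (\<integral>z. g (sqrt (\<Sum>a<m. v a) * z) \<partial>std_normal)\<bar>
    \<le> K * (\<Sum>a<m. expectation (\<lambda>\<omega>. \<bar>X a \<omega>\<bar> ^ 3) + 2 * sqrt (v a) ^ 3)"
  using assms
proof (induction m arbitrary: g da db)
  case 0
  interpret N: prob_space std_normal by (rule prob_space_std_normal)
  show ?case using prob_space N.prob_space by simp
next
  case (Suc m)
  interpret N: prob_space std_normal by (rule prob_space_std_normal)
  note g = Suc.prems(7)
  have Xm: "X a \<in> borel_measurable M" if "a \<in> {..<Suc m}" for a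
    using Suc.prems(1) that by (auto simp: indep_vars_def2)
  have vpos: "0 \<le> v a" if "a < Suc m" for a
    unfolding Suc.prems(6)[OF that, symmetric] by (rule Bochner_Integration.integral_nonneg) simp
  define S where "S \<omega> = (\<Sum>a<m. X a \<omega>)" for \<omega>
  have [measurable]: "S \<in> borel_measurable M" "X m \<in> borel_measurable M"
    unfolding S_def using Xm by (auto intro!: borel_measurable_sum)
  define \<sigma> where "\<sigma> = sqrt (v m)"
  have \<sigma>2: "\<sigma>\<^sup>2 = v m" using vpos by (simp add: \<sigma>_def)
  define g1 where "g1 c = expectation (\<lambda>\<omega>. g (c + X m \<omega>))" for c
  define g2 where "g2 c = (\<integral>w. g (c + \<sigma> * w) \<partial>std_normal)" for c
  define da2 where "da2 c = (\<integral>w. da (c + \<sigma> * w) \<partial>std_normal)" for c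
  define db2 where "db2 c = (\<integral>w. db (c + \<sigma> * w) \<partial>std_normal)" for c
  obtain C where C: "\<And>x. \<bar>g x\<bar> \<le> C" using taylor3_bounded[OF g] by blast
  have gm[measurable]: "g \<in> borel_measurable borel" using g by (rule taylor3_measurable)
  have t2: "taylor3 K g2 da2 db2"
    unfolding g2_def da2_def db2_def by (rule N.taylor3_mix[OF g, of "\<lambda>w. \<sigma> * w"]) measurable
  have t1: "taylor3 K g1 (\<lambda>c. expectation (\<lambda>\<omega>. da (c + X m \<omega>))) (\<lambda>c. expectation (\<lambda>\<omega>. db (c + X m \<omega>)))"
    unfolding g1_def by (rule taylor3_mix[OF g]) measurable
  obtain C1 where C1: "\<And>x. \<bar>g1 x\<bar> \<le> C1" using taylor3_bounded[OF t1] by blast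
  obtain C2 where C2: "\<And>x. \<bar>g2 x\<bar> \<le> C2" using taylor3_bounded[OF t2] by blast
  have [measurable]: "g1 \<in> borel_measurable borel" "g2 \<in> borel_measurable borel"
    using t1 t2 by (blast dest: taylor3_measurable)+
  let ?\<tau> = "expectation (\<lambda>\<omega>. \<bar>X m \<omega>\<bar> ^ 3)"
  \<comment> \<open>Uniform in the base point \<open>c\<close>, so it can be integrated over the law
    of the remaining sum.\<close>
  have close: "\<bar>g1 c - g2 c\<bar> \<le> K * (?\<tau> + 2 * \<sigma> ^ 3)" for c
  proof -
    have "\<bar>g1 c - g c - db c * v m\<bar> \<le> K * ?\<tau>"
      using taylor3_expectation[OF g, of "X m" c] Suc.prems by (simp add: g1_def)
    moreover have "\<bar>g2 c - g c - db c * v m\<bar> \<le> K * (2 * \<sigma> ^ 3)"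
    proof -
      have "\<sigma> \<ge> 0" by (simp add: \<sigma>_def vpos)
      then have abs3: "\<bar>\<sigma> * w\<bar> ^ 3 = \<sigma> ^ 3 * \<bar>w\<bar> ^ 3" for w by (simp add: abs_mult power_mult_distrib)
      have i1: "integrable std_normal (\<lambda>w. \<sigma> * w)"
        using integrable_mult_right[OF integrable_std_normal_power[of 1]] by simp
      have i2: "integrable std_normal (\<lambda>w. (\<sigma> * w)\<^sup>2)"
        unfolding power_mult_distrib by (intro integrable_mult_right integrable_std_normal_power)
      have i3: "integrable std_normal (\<lambda>w. \<bar>\<sigma> * w\<bar> ^ 3)"
        unfolding abs3 by (intro integrable_mult_right integrable_std_normal_abs_power)
      have e0: "N.expectation (\<lambda>w. \<sigma> * w) = 0" by (simp add: integral_std_normal_1)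
      have "\<bar>g2 c - g c - db c * N.expectation (\<lambda>w. (\<sigma> * w)\<^sup>2)\<bar> \<le> K * N.expectation (\<lambda>w. \<bar>\<sigma> * w\<bar> ^ 3)"
        unfolding g2_def by (rule N.taylor3_expectation[OF g _ i1 i2 i3 e0]) measurable
      also have "\<dots> \<le> K * (2 * \<sigma> ^ 3)"
      proof (intro mult_left_mono Suc.prems(8))
        have "N.expectation (\<lambda>w. \<bar>\<sigma> * w\<bar> ^ 3) = \<sigma> ^ 3 * N.expectation (\<lambda>w. \<bar>w\<bar> ^ 3)"
          unfolding abs3 by simp
        also have "\<dots> \<le> \<sigma> ^ 3 * 2"
          using \<open>\<sigma> \<ge> 0\<close> by (intro mult_left_mono integral_std_normal_abs_3) simp
        finally show "N.expectation (\<lambda>w. \<bar>\<sigma> * w\<bar> ^ 3) \<le> 2 * \<sigma> ^ 3" by simp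
      qed
      finally show ?thesis by (simp add: power_mult_distrib integral_std_normal_2 \<sigma>2)
    qed
    ultimately show ?thesis unfolding distrib_left by linarith
  qed
  have "indep_var borel (X m) borel S"
    using indep_vars_sum[of "{..<m}" m X] Suc.prems(1) unfolding S_def[abs_def] lessThan_Suc by simp
  then have eqd: "distr M borel (X m) \<Otimes>\<^sub>M distr M borel S = distr M (borel \<Otimes>\<^sub>M borel) (\<lambda>\<omega>. (X m \<omega>, S \<omega>))"
    by (simp add: indep_var_distribution_eq)
  \<comment> \<open>The only use of independence: by Fubini the last summand is averaged for a fixed
    value of the others.\<close>
  have "expectation (\<lambda>\<omega>. g (S \<omega> + X m \<omega>)) = expectation (\<lambda>\<omega>. g1 (S \<omega>))"
  proof -
    let ?D = "distr M borel (X m)" and ?E = "distr M borel S"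
    interpret D: prob_space ?D by (rule prob_space_distr) measurable
    interpret E: prob_space ?E by (rule prob_space_distr) measurable
    interpret DE: pair_prob_space ?D ?E ..
    have "expectation (\<lambda>\<omega>. g (S \<omega> + X m \<omega>)) = (\<integral>z. g (snd z + fst z) \<partial>(?D \<Otimes>\<^sub>M ?E))"
      unfolding eqd by (subst integral_distr) auto
    also have "\<dots> = (\<integral>s. (\<integral>x. g (s + x) \<partial>?D) \<partial>?E)"
    proof -
      have "integrable (?D \<Otimes>\<^sub>M ?E) (\<lambda>(x, s). g (s + x))"
        unfolding case_prod_unfold by (rule DE.integrable_bounded_comp[OF gm _ C]) measurable
      from DE.integral_snd[OF this] show ?thesis by (simp add: case_prod_unfold)
    qed
    also have "\<dots> = (\<integral>s. g1 s \<partial>?E)"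
      unfolding g1_def by (subst integral_distr) auto
    also have "\<dots> = expectation (\<lambda>\<omega>. g1 (S \<omega>))" by (subst integral_distr) auto
    finally show ?thesis .
  qed
  moreover have "\<bar>expectation (\<lambda>\<omega>. g1 (S \<omega>)) - expectation (\<lambda>\<omega>. g2 (S \<omega>))\<bar> \<le> K * (?\<tau> + 2 * \<sigma> ^ 3)"
  proof -
    have i: "integrable M (\<lambda>\<omega>. g1 (S \<omega>))" "integrable M (\<lambda>\<omega>. g2 (S \<omega>))"
      by (rule integrable_bounded_comp[OF _ _ C1] integrable_bounded_comp[OF _ _ C2]; measurable)+
    then have "expectation (\<lambda>\<omega>. g1 (S \<omega>)) - expectation (\<lambda>\<omega>. g2 (S \<omega>)) = expectation (\<lambda>\<omega>. g1 (S \<omega>) - g2 (S \<omega>))"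
      by simp
    also have "\<bar>\<dots>\<bar> \<le> expectation (\<lambda>\<omega>. K * (?\<tau> + 2 * \<sigma> ^ 3))"
      by (intro abs_expectation_le Bochner_Integration.integrable_diff i close integrable_const)
    finally show ?thesis by (simp add: prob_space)
  qed
  moreover have "\<bar>expectation (\<lambda>\<omega>. g2 (S \<omega>)) - (\<integral>z. g2 (sqrt (\<Sum>a<m. v a) * z) \<partial>std_normal)\<bar>
    \<le> K * (\<Sum>a<m. expectation (\<lambda>\<omega>. \<bar>X a \<omega>\<bar> ^ 3) + 2 * sqrt (v a) ^ 3)"
    unfolding S_def
    by (rule Suc.IH[OF indep_vars_subset[OF Suc.prems(1)] _ _ _ _ _ t2]) (use Suc.prems in auto)
  moreover have "(\<integral>z. g2 (sqrt (\<Sum>a<m. v a) * z) \<partial>std_normal) = (\<integral>z. g (sqrt (\<Sum>a<Suc m. v a) * z) \<partial>std_normal)"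
  proof -
    have V: "0 \<le> sum v {..<m}" using vpos by (intro sum_nonneg) simp
    show ?thesis
      unfolding g2_def
      by (subst integral_std_normal_convolve[OF gm C]) (simp_all add: \<sigma>_def vpos V)
  qed
  moreover have "expectation (\<lambda>\<omega>. g (\<Sum>a<Suc m. X a \<omega>)) = expectation (\<lambda>\<omega>. g (S \<omega> + X m \<omega>))"
    by (simp add: S_def)
  moreover have "K * (\<Sum>a<Suc m. expectation (\<lambda>\<omega>. \<bar>X a \<omega>\<bar> ^ 3) + 2 * sqrt (v a) ^ 3) =
      K * (\<Sum>a<m. expectation (\<lambda>\<omega>. \<bar>X a \<omega>\<bar> ^ 3) + 2 * sqrt (v a) ^ 3) + K * (?\<tau> + 2 * \<sigma> ^ 3)"
    by (simp add: \<sigma>_def distrib_left)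
  ultimately show ?case by linarith
qed

section \<open>A cubic spline as smoothed indicator\<close>

text \<open>\<open>pos2\<close> and \<open>pos1\<close> are \<open>pos3'\<close> and \<open>pos3'' / 2\<close>.\<close>
definition pos3 :: "real \<Rightarrow> real" where "pos3 u = max 0 u ^ 3"
definition pos2 :: "real \<Rightarrow> real" where "pos2 u = 3 * (max 0 u)\<^sup>2"
definition pos1 :: "real \<Rightarrow> real" where "pos1 u = 3 * max 0 u"

text \<open>The constant is 1 because the third derivative of \<open>pos3\<close> is 0 or 6, and 6 /
  3! = 1. The cases deal with a segment that crosses the kink at 0.\<close>

lemma pos3_taylor: "\<bar>pos3 (c + x) - pos3 c - pos2 c * x - pos1 c * x\<^sup>2\<bar> \<le> \<bar>x\<bar> ^ 3"
proof -
  consider "0 \<le> c" "0 \<le> c + x" | "0 \<le> c" "c + x < 0" | "c < 0" "0 \<le> c + x" | "c < 0" "c + x < 0"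
    by linarith
  then show ?thesis
  proof cases
    case 1
    have "(c + x) ^ 3 - c ^ 3 - 3 * c\<^sup>2 * x - 3 * c * x\<^sup>2 = x ^ 3"
      by (simp add: algebra_simps power2_eq_square power3_eq_cube)
    then show ?thesis using 1 by (simp add: pos3_def pos2_def pos1_def max_def power_abs)
  next
    case 2
    then have y: "0 \<le> - (c + x)" "- (c + x) \<le> - x" by auto
    have "- (c ^ 3) - 3 * c\<^sup>2 * x - 3 * c * x\<^sup>2 = (- (c + x)) ^ 3 + x ^ 3"
      by (simp add: algebra_simps power2_eq_square power3_eq_cube)
    moreover have "(- (c + x)) ^ 3 \<le> (- x) ^ 3" using y by (intro power_mono)
    moreover have "0 \<le> (- (c + x)) ^ 3" using y by simp
    moreover have "\<bar>x\<bar> ^ 3 = (- x) ^ 3" using y by (simp add: abs_if)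
    moreover have "(- x) ^ 3 = - (x ^ 3)" by (simp add: power3_eq_cube)
    ultimately show ?thesis using 2 by (simp add: pos3_def pos2_def pos1_def max_def)
  next
    case 3
    then have "(c + x) ^ 3 \<le> x ^ 3" "0 \<le> (c + x) ^ 3" by (auto intro!: power_mono)
    moreover have "\<bar>x\<bar> = x" using 3 by simp
    ultimately show ?thesis using 3 by (simp add: pos3_def pos2_def pos1_def max_def)
  next
    case 4
    then show ?thesis by (simp add: pos3_def pos2_def pos1_def max_def)
  qed
qed

text \<open>The cubic B-spline distribution function: \<open>C\<^sup>2\<close> with Lipschitz second derivative,
  \<open>0\<close> left of \<open>0\<close> and \<open>1\<close> right of \<open>3\<close>.\<close>
definition third_diff :: "(real \<Rightarrow> real) \<Rightarrow> real \<Rightarrow> real" where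
  "third_diff h u = (h u - 3 * h (u - 1) + 3 * h (u - 2) - h (u - 3)) / 6"

lemma third_diff_measurable [measurable]:
  assumes [measurable]: "h \<in> borel_measurable borel"
  shows "third_diff h \<in> borel_measurable borel"
  unfolding third_diff_def by measurable

lemma pos_measurable [measurable]:
  "pos3 \<in> borel_measurable borel" "pos2 \<in> borel_measurable borel" "pos1 \<in> borel_measurable borel"
  unfolding pos3_def pos2_def pos1_def by measurable

lemma spline_le_0: "u \<le> 0 \<Longrightarrow> third_diff pos3 u = 0"
  and spline_ge_3: "3 \<le> u \<Longrightarrow> third_diff pos3 u = 1"
  by (simp_all add: third_diff_def pos3_def max_def) (simp add: algebra_simps power3_eq_cube)

lemma spline_bounds: "0 \<le> third_diff pos3 u" "third_diff pos3 u \<le> 1"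
proof -
  have "0 \<le> third_diff pos3 u \<and> third_diff pos3 u \<le> 1"
  proof -
    consider "u \<le> 0" | "0 < u" "u \<le> 1" | "1 < u" "u \<le> 2" | "2 < u" "u \<le> 3" | "3 < u" by linarith
    then show ?thesis
    proof cases
      case 2
      then have "u ^ 3 \<le> 1" "0 \<le> u ^ 3" by (auto intro: power_le_one)
      then show ?thesis using 2 by (simp add: third_diff_def pos3_def max_def)
    next
      case 3
      \<comment> \<open>On the middle piece six times the spline is
        \<open>1 + 3 * v + v\<^sup>2 * (3 - 2 * v)\<close>, and the last term lies between 0 and
        1.\<close>
      define v where "v = u - 1"
      have v: "0 \<le> v" "v \<le> 1" using 3 by (auto simp: v_def)
      have eq: "u ^ 3 - 3 * (u - 1) ^ 3 = 1 + 3 * v + v\<^sup>2 * (3 - 2 * v)"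
        by (simp add: v_def algebra_simps power2_eq_square power3_eq_cube)
      have "0 \<le> v\<^sup>2 * (3 - 2 * v)" using v by simp
      moreover have "0 \<le> (1 - v)\<^sup>2 * (1 + 2 * v)" using v by simp
      moreover have "(1 - v)\<^sup>2 * (1 + 2 * v) = 1 - v\<^sup>2 * (3 - 2 * v)"
        by (simp add: algebra_simps power2_eq_square)
      ultimately show ?thesis using 3 v eq by (simp add: third_diff_def pos3_def max_def)
    next
      case 4
      define w where "w = 3 - u"
      have w: "0 \<le> w" "w \<le> 1" using 4 by (auto simp: w_def)
      then have "w ^ 3 \<le> 1" "0 \<le> w ^ 3" by (auto intro: power_le_one)
      moreover have "u ^ 3 - 3 * (u - 1) ^ 3 + 3 * (u - 2) ^ 3 = 6 - w ^ 3"
        by (simp add: w_def algebra_simps power3_eq_cube)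
      ultimately show ?thesis using 4 by (simp add: third_diff_def pos3_def max_def)
    qed (use spline_le_0[of u] spline_ge_3[of u] in auto)
  qed
  then show "0 \<le> third_diff pos3 u" "third_diff pos3 u \<le> 1" by auto
qed

text \<open>To the right of 3 no truncation is active, and the third difference of a polynomial of
  degree at most two vanishes; to the left the truncated powers are bounded themselves.\<close>

lemma spline_derivatives_bounded: "\<exists>C. \<forall>u. \<bar>third_diff pos2 u\<bar> \<le> C \<and> \<bar>third_diff pos1 u\<bar> \<le> C"
proof (intro exI allI)
  fix u :: real
  have p: "0 \<le> pos2 v" "pos2 v \<le> 27" "0 \<le> pos1 v" "pos1 v \<le> 9" if "v \<le> 3" for v
  proof -
    have "0 \<le> max 0 v" "max 0 v \<le> 3" using that by auto
    then show "0 \<le> pos2 v" "pos2 v \<le> 27" "0 \<le> pos1 v" "pos1 v \<le> 9"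
      using power_mono[of "max 0 v" 3 2] by (auto simp: pos2_def pos1_def)
  qed
  show "\<bar>third_diff pos2 u\<bar> \<le> 27 \<and> \<bar>third_diff pos1 u\<bar> \<le> 27"
  proof (cases "u \<le> 3")
    case True
    then show ?thesis
      using p[of u] p[of "u - 1"] p[of "u - 2"] p[of "u - 3"] by (auto simp: third_diff_def abs_le_iff)
  next
    case False
    have "third_diff pos2 u = 0" "third_diff pos1 u = 0"
      using False by (simp_all add: third_diff_def pos2_def pos1_def max_def power2_eq_square algebra_simps)
    then show ?thesis by simp
  qed
qed

text \<open>The factor 4/3 is \<open>(1 + 3 + 3 + 1) / 6\<close>, the total weight of the third
  difference; rescaling the argument by \<eta> produces the third power of \<eta>.\<close>

lemma taylor3_spline:
  assumes "\<eta> > 0"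
  shows "taylor3 (4 / 3 / \<eta> ^ 3) (\<lambda>x. third_diff pos3 ((x - t) / \<eta>))
    (\<lambda>x. third_diff pos2 ((x - t) / \<eta>) / \<eta>) (\<lambda>x. third_diff pos1 ((x - t) / \<eta>) / \<eta>\<^sup>2)"
proof -
  have T: "\<bar>third_diff pos3 (c + x) - third_diff pos3 c - third_diff pos2 c * x - third_diff pos1 c * x\<^sup>2\<bar>
      \<le> 4 / 3 * \<bar>x\<bar> ^ 3" for c x
  proof -
    define R where "R c = pos3 (c + x) - pos3 c - pos2 c * x - pos1 c * x\<^sup>2" for c
    have "third_diff pos3 (c + x) - third_diff pos3 c - third_diff pos2 c * x - third_diff pos1 c * x\<^sup>2 = third_diff R c"
      by (simp add: third_diff_def R_def field_simps)
    moreover have "\<bar>R c\<bar> \<le> \<bar>x\<bar> ^ 3" for c unfolding R_def by (rule pos3_taylor)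
    from this[of c] this[of "c - 1"] this[of "c - 2"] this[of "c - 3"]
    have "\<bar>third_diff R c\<bar> \<le> 4 / 3 * \<bar>x\<bar> ^ 3" by (simp add: third_diff_def abs_le_iff)
    ultimately show ?thesis by simp
  qed
  obtain C where C: "\<And>u. \<bar>third_diff pos2 u\<bar> \<le> C \<and> \<bar>third_diff pos1 u\<bar> \<le> C"
    using spline_derivatives_bounded by blast
  let ?C = "max 1 (max (C / \<eta>) (C / \<eta>\<^sup>2))"
  have "\<bar>third_diff pos3 u\<bar> \<le> ?C" for u using spline_bounds[of u] by simp
  moreover have "\<bar>third_diff pos2 u / \<eta>\<bar> \<le> ?C" for u
    using C[of u] assms by (simp add: le_max_iff_disj divide_right_mono)
  moreover have "\<bar>third_diff pos1 u / \<eta>\<^sup>2\<bar> \<le> ?C" for u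
    using C[of u] assms by (simp add: le_max_iff_disj divide_right_mono)
  moreover have "\<bar>third_diff pos3 ((c + x - t) / \<eta>) - third_diff pos3 ((c - t) / \<eta>) -
      third_diff pos2 ((c - t) / \<eta>) / \<eta> * x - third_diff pos1 ((c - t) / \<eta>) / \<eta>\<^sup>2 * x\<^sup>2\<bar>
      \<le> 4 / 3 / \<eta> ^ 3 * \<bar>x\<bar> ^ 3" for c x
    using T[of "(c - t) / \<eta>" "x / \<eta>"] assms
    by (simp add: add_divide_distrib diff_divide_distrib power_divide add_diff_eq diff_add_eq)
  ultimately show ?thesis
    unfolding taylor3_def by (intro conjI exI[of _ ?C] allI) measurable
qed

section \<open>Regularity of the normal tail and passage from test functions to
  probabilities\<close>

lemma normal_tail_eq: "normal_tail t = measure std_normal {t<..}"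
proof -
  interpret N: prob_space std_normal by (rule prob_space_std_normal)
  have "measure std_normal {t<..} = 1 - measure std_normal {..t}"
    using N.prob_compl[of "{..t}"] by (simp add: Compl_eq_Diff_UNIV[symmetric])
  then show ?thesis by (simp add: normal_tail_def cdf_def)
qed

lemma normal_tail_mono: "s \<le> t \<Longrightarrow> normal_tail t \<le> normal_tail s"
proof -
  interpret N: prob_space std_normal by (rule prob_space_std_normal)
  assume "s \<le> t"
  then show ?thesis unfolding normal_tail_eq by (intro N.finite_measure_mono) auto
qed

text \<open>The density bound is asked for only between \<open>s\<close> and \<open>t\<close>: with
  \<open>b = 1\<close> this gives a Lipschitz estimate, with a bound decaying in the tails the
  estimate \<open>normal_tail_scale\<close> for multiplicative perturbations.\<close>

lemma normal_tail_diff_le: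
  assumes "s \<le> t" and b: "\<And>x. s \<le> x \<Longrightarrow> x \<le> t \<Longrightarrow> std_normal_density x \<le> b"
  shows "normal_tail s - normal_tail t \<le> b * (t - s)"
proof -
  interpret N: prob_space std_normal by (rule prob_space_std_normal)
  have "0 \<le> b" using b[of s] assms(1) std_normal_density_def by (metis normal_density_nonneg order_trans order_refl)
  have "normal_tail s - normal_tail t = measure std_normal {s<..t}"
  proof -
    have "{s<..} = {s<..t} \<union> {t<..}" using assms(1) by auto
    moreover have "measure std_normal ({s<..t} \<union> {t<..}) = measure std_normal {s<..t} + measure std_normal {t<..}"
      by (rule N.finite_measure_Union) auto
    ultimately have "measure std_normal {s<..} = measure std_normal {s<..t} + measure std_normal {t<..}"
      by simp
    then show ?thesis by (simp add: normal_tail_eq)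
  qed
  also have "\<dots> \<le> b * (t - s)"
  proof -
    have "emeasure std_normal {s<..t} = (\<integral>\<^sup>+x. ennreal (std_normal_density x) * indicator {s<..t} x \<partial>lborel)"
      by (subst emeasure_density) auto
    also have "\<dots> \<le> (\<integral>\<^sup>+x. ennreal b * indicator {s<..t} x \<partial>lborel)"
      using b by (intro nn_integral_mono) (auto simp: indicator_def intro!: ennreal_leI)
    also have "\<dots> = ennreal (b * (t - s))"
      using assms(1) \<open>0 \<le> b\<close> by (simp add: nn_integral_cmult_indicator ennreal_mult)
    finally show ?thesis
      using assms(1) \<open>0 \<le> b\<close> by (simp add: N.emeasure_eq_measure)
  qed
  finally show ?thesis .
qed

lemma std_normal_density_le_1: "std_normal_density x \<le> 1"
proof -
  have "1 \<le> sqrt (2 * pi)" using pi_gt3 by (intro real_le_rsqrt) simp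
  moreover have "exp (- x\<^sup>2 / 2) \<le> 1" by simp
  ultimately have "exp (- x\<^sup>2 / 2) \<le> sqrt (2 * pi)" by linarith
  then show ?thesis by (simp add: std_normal_density_def divide_le_eq)
qed

lemma normal_tail_lipschitz: "\<bar>normal_tail s - normal_tail t\<bar> \<le> \<bar>s - t\<bar>"
proof -
  have "\<bar>normal_tail s - normal_tail t\<bar> \<le> \<bar>s - t\<bar>" if "s \<le> t" for s t
    using normal_tail_diff_le[of s t 1] that std_normal_density_le_1 normal_tail_mono[OF that] by simp
  from this[of s t] this[of t s] show ?thesis by (cases "s \<le> t") (auto simp: abs_minus_commute)
qed

text \<open>A ramp from 0 at \<open>t\<close> to 1 at \<open>t + 3 * \<eta>\<close> lies below the
  indicator of a value above \<open>t\<close>, and the ramp started at \<open>t - 3 * \<eta>\<close>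
  lies above it. Shifting the threshold costs \<open>3 * \<eta>\<close>, testing the ramp costs its
  Taylor constant \<open>4 / 3 / \<eta> ^ 3\<close> times \<epsilon>.\<close>

lemma (in prob_space) smoothing:
  assumes S[measurable]: "S \<in> borel_measurable M" and "\<eta> > 0"
    and test: "\<And>K g a b. K \<ge> 0 \<Longrightarrow> taylor3 K g a b \<Longrightarrow>
      \<bar>expectation (\<lambda>\<omega>. g (S \<omega>)) - (\<integral>z. g z \<partial>std_normal)\<bar> \<le> K * \<epsilon>"
  shows "\<bar>prob {\<omega> \<in> space M. S \<omega> > t} - normal_tail t\<bar> \<le> 3 * \<eta> + 4 / 3 * \<epsilon> / \<eta> ^ 3"
proof -
  interpret N: prob_space std_normal by (rule prob_space_std_normal)
  define g where "g t x = third_diff pos3 ((x - t) / \<eta>)" for t x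
  have gm[measurable]: "g t \<in> borel_measurable borel" for t unfolding g_def by measurable
  have gb: "0 \<le> g t x" "g t x \<le> 1" for t x unfolding g_def by (rule spline_bounds)+
  have g0: "g t x = 0" if "x \<le> t" for t x
    unfolding g_def using that \<open>\<eta> > 0\<close> by (intro spline_le_0) (simp add: divide_le_0_iff)
  have g1: "g t x = 1" if "t + 3 * \<eta> \<le> x" for t x
    unfolding g_def using that \<open>\<eta> > 0\<close> by (intro spline_ge_3) (simp add: le_divide_eq)
  have close: "\<bar>expectation (\<lambda>\<omega>. g t (S \<omega>)) - (\<integral>z. g t z \<partial>std_normal)\<bar> \<le> 4 / 3 * \<epsilon> / \<eta> ^ 3" for t
    using test[OF _ taylor3_spline[OF \<open>\<eta> > 0\<close>, of t]] \<open>\<eta> > 0\<close> unfolding g_def[symmetric] by simp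
  \<comment> \<open>Stated for an arbitrary probability space because it is applied twice: to
    \<open>S\<close>, and to the identity under the normal law.\<close>
  have sandwich: "(\<integral>z. g t z \<partial>distr Q borel Y) \<le> measure Q {\<omega> \<in> space Q. Y \<omega> > t}"
    "measure Q {\<omega> \<in> space Q. Y \<omega> > t} \<le> (\<integral>z. g (t - 3 * \<eta>) z \<partial>distr Q borel Y)"
    if "prob_space Q" and [measurable]: "Y \<in> borel_measurable Q" for Q :: "'q measure" and Y t
  proof -
    interpret Q: prob_space Q by fact
    have i: "integrable Q (\<lambda>\<omega>. g t (Y \<omega>))" for t
      by (rule Q.integrable_const_bound[where B=1]) (use gb in auto)
    have e: "measure Q {\<omega> \<in> space Q. Y \<omega> > t} = (\<integral>\<omega>. indicator {\<omega> \<in> space Q. Y \<omega> > t} \<omega> \<partial>Q)"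
      by simp
    have ii: "integrable Q (indicator {\<omega> \<in> space Q. Y \<omega> > t} :: 'q \<Rightarrow> real)"
      by (rule integrable_real_indicator) (auto simp: Q.emeasure_eq_measure)
    have d: "(\<integral>z. g t z \<partial>distr Q borel Y) = (\<integral>\<omega>. g t (Y \<omega>) \<partial>Q)" for t
      by (rule integral_distr) auto
    show "(\<integral>z. g t z \<partial>distr Q borel Y) \<le> measure Q {\<omega> \<in> space Q. Y \<omega> > t}"
      unfolding e d
      by (rule integral_mono[OF i ii]) (use gb g0 in \<open>auto simp: indicator_def not_less\<close>)
    show "measure Q {\<omega> \<in> space Q. Y \<omega> > t} \<le> (\<integral>z. g (t - 3 * \<eta>) z \<partial>distr Q borel Y)"
      unfolding e d
      by (rule integral_mono[OF ii i]) (use gb g1 in \<open>auto simp: indicator_def not_less\<close>)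
  qed
  have dS: "(\<integral>z. g t z \<partial>distr M borel S) = expectation (\<lambda>\<omega>. g t (S \<omega>))" for t
    by (rule integral_distr) auto
  have dN: "(\<integral>z. g t z \<partial>distr std_normal borel (\<lambda>x. x)) = (\<integral>z. g t z \<partial>std_normal)" for t
    by (rule integral_distr) auto
  have mN: "measure std_normal {\<omega> \<in> space std_normal. \<omega> > t} = normal_tail t" for t
    unfolding normal_tail_eq by (rule arg_cong[where f="measure std_normal"]) auto
  note sM = sandwich[OF prob_space_axioms S, unfolded dS]
    and sN = sandwich[OF prob_space_std_normal, of "\<lambda>x. x", unfolded dN mN]
  have "prob {\<omega> \<in> space M. S \<omega> > t} \<le> normal_tail (t - 3 * \<eta>) + 4 / 3 * \<epsilon> / \<eta> ^ 3"
    using sM(2)[of t] close[of "t - 3 * \<eta>"] sN(1)[of "t - 3 * \<eta>"] by simp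
  moreover have "normal_tail (t + 3 * \<eta>) - 4 / 3 * \<epsilon> / \<eta> ^ 3 \<le> prob {\<omega> \<in> space M. S \<omega> > t}"
    using sM(1)[of t] close[of t] sN(2)[of "t + 3 * \<eta>"] by simp
  ultimately show ?thesis
    using normal_tail_lipschitz[of t "t - 3 * \<eta>"] normal_tail_lipschitz[of t "t + 3 * \<eta>"] \<open>\<eta> > 0\<close> by simp
qed

section \<open>Rotation invariance of the Gaussian measure\<close>

definition ip :: "nat \<Rightarrow> (nat \<Rightarrow> real) \<Rightarrow> (nat \<Rightarrow> real) \<Rightarrow> real" where
  "ip N x y = (\<Sum>i<N. x i * y i)"

abbreviation gauss :: "nat \<Rightarrow> (nat \<Rightarrow> real) measure" where
  "gauss N \<equiv> (\<Pi>\<^sub>M i\<in>{..<N}. std_normal_distribution)"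

definition vadd :: "nat \<Rightarrow> (nat \<Rightarrow> real) \<Rightarrow> (nat \<Rightarrow> real) \<Rightarrow> nat \<Rightarrow> real" where
  "vadd N x y = (\<lambda>i\<in>{..<N}. x i + y i)"

definition vneg :: "nat \<Rightarrow> (nat \<Rightarrow> real) \<Rightarrow> nat \<Rightarrow> real" where
  "vneg N x = (\<lambda>i\<in>{..<N}. - x i)"

definition gauss_density :: "nat \<Rightarrow> (nat \<Rightarrow> real) \<Rightarrow> real" where
  "gauss_density N x = (\<Prod>i<N. std_normal_density (x i))"

interpretation lborel_product: product_sigma_finite "\<lambda>_::'i. lborel :: real measure"
  by standard

interpretation normal_product: product_sigma_finite "\<lambda>_::'i. std_normal_distribution"
  by standard (intro sigma_finite_measure.sigma_finite_countable prob_space_imp_sigma_finite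
    prob_space_normal_density, simp)

lemma prob_space_gauss: "prob_space (gauss N)"
  by (rule prob_space_PiM) (simp add: prob_space_normal_density)

lemma sets_gauss [measurable_cong]: "sets (gauss N) = sets (vec_space N)"
  by (rule sets_PiM_cong) auto

lemma space_vec_space: "space (vec_space N) = extensional {..<N}"
  by (auto simp: space_PiM PiE_def)

lemma space_gauss: "space (gauss N) = extensional {..<N}"
  by (auto simp: space_PiM PiE_def)

text \<open>An index beyond \<open>N\<close> is harmless: there every point of the space takes the
  value \<open>undefined\<close>, so the map is constant. This keeps side conditions out of all
  later measurability proofs.\<close>

lemma measurable_component_vec [measurable]: "(\<lambda>x. x i) \<in> borel_measurable (vec_space N)"
proof (cases "i < N")
  case True
  then have "i \<in> {..<N}" by simp
  then show ?thesis by measurable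
next
  case False
  have "(\<lambda>x. undefined) \<in> borel_measurable (vec_space N)" by simp
  moreover have "x i = undefined" if "x \<in> space (vec_space N)" for x
    using that False by (auto simp: space_vec_space extensional_def)
  ultimately show ?thesis by (subst measurable_cong)
qed

lemma measurable_component_gauss [measurable]: "(\<lambda>x. x i) \<in> borel_measurable (gauss N)"
  using measurable_component_vec by (simp add: measurable_cong_sets[OF sets_gauss refl])

lemma ip_measurable [measurable]:
  assumes [measurable]: "\<And>i. (\<lambda>z. f z i) \<in> borel_measurable M" "\<And>i. (\<lambda>z. g z i) \<in> borel_measurable M"
  shows "(\<lambda>z. ip N (f z) (g z)) \<in> borel_measurable M"
  unfolding ip_def by measurable

text \<open>Preimages of boxes are boxes, so invariance of each factor lifts to the product by
  uniqueness of the product measure.\<close>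

lemma nn_integral_vec_translate:
  assumes f[measurable]: "f \<in> borel_measurable (vec_space N)"
  shows "(\<integral>\<^sup>+x. f (vadd N x t) \<partial>vec_space N) = (\<integral>\<^sup>+x. f x \<partial>vec_space N)"
proof -
  have m[measurable]: "(\<lambda>x. vadd N x t) \<in> measurable (vec_space N) (vec_space N)"
    unfolding vadd_def by measurable
  have "distr (vec_space N) (vec_space N) (\<lambda>x. vadd N x t) = vec_space N"
  proof (rule lborel_product.PiM_eqI)
    fix A :: "nat \<Rightarrow> real set" assume A: "\<And>i. i \<in> {..<N} \<Longrightarrow> A i \<in> sets lborel"
    have *: "(\<lambda>x. vadd N x t) -` Pi\<^sub>E {..<N} A \<inter> space (vec_space N)
        = Pi\<^sub>E {..<N} (\<lambda>i. (\<lambda>x. x + t i) -` A i)"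
      by (auto simp: vadd_def space_vec_space PiE_def extensional_def Pi_def)
    have **: "(\<lambda>x. x + t i) -` A i \<in> sets borel" if "i < N" for i
      using A[of i] that measurable_sets[of "\<lambda>x. x + t i" borel borel "A i"] by simp
    have "emeasure (distr (vec_space N) (vec_space N) (\<lambda>x. vadd N x t)) (Pi\<^sub>E {..<N} A)
      = emeasure (vec_space N) (Pi\<^sub>E {..<N} (\<lambda>i. (\<lambda>x. x + t i) -` A i))"
      using A by (subst emeasure_distr) (auto intro!: sets_PiM_I_finite simp: *)
    also have "\<dots> = (\<Prod>i<N. emeasure lborel ((\<lambda>x. x + t i) -` A i))"
      using ** by (intro lborel_product.emeasure_PiM) auto
    also have "\<dots> = (\<Prod>i<N. emeasure lborel (A i))"
    proof (rule prod.cong)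
      fix i assume "i \<in> {..<N}"
      then have "emeasure lborel (A i) = emeasure (distr lborel borel ((+) (t i))) (A i)"
        by (simp add: lborel_distr_plus)
      also have "\<dots> = emeasure lborel ((+) (t i) -` A i)"
        using A[of i] \<open>i \<in> {..<N}\<close> by (subst emeasure_distr) auto
      also have "(+) (t i) = (\<lambda>x. x + t i)" by (auto simp: add.commute)
      finally show "emeasure lborel ((\<lambda>x. x + t i) -` A i) = emeasure lborel (A i)" by simp
    qed simp
    finally show "emeasure (distr (vec_space N) (vec_space N) (\<lambda>x. vadd N x t)) (Pi\<^sub>E {..<N} A)
      = (\<Prod>i<N. emeasure lborel (A i))" .
  qed auto
  then have "(\<integral>\<^sup>+x. f x \<partial>vec_space N) = (\<integral>\<^sup>+x. f x \<partial>distr (vec_space N) (vec_space N) (\<lambda>x. vadd N x t))"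
    by simp
  also have "\<dots> = (\<integral>\<^sup>+x. f (vadd N x t) \<partial>vec_space N)"
    by (subst nn_integral_distr) auto
  finally show ?thesis by simp
qed

lemma gauss_density_measurable [measurable]: "gauss_density N \<in> borel_measurable (vec_space N)"
  unfolding gauss_density_def by measurable

lemma gauss_density_nonneg: "0 \<le> gauss_density N x"
  unfolding gauss_density_def by (intro prod_nonneg) auto

lemma gauss_density_vneg: "gauss_density N (vneg N x) = gauss_density N x"
  unfolding gauss_density_def vneg_def by (intro prod.cong) (auto simp: std_normal_density_def)

text \<open>In this form the density depends on \<open>x\<close> only through its norm, which is
  what makes it invariant under isometries.\<close>

lemma gauss_density_ip: "gauss_density N x = exp (- ip N x x / 2) / sqrt (2 * pi) ^ N"
proof -
  have "exp (- ip N x x / 2) = exp (\<Sum>i<N. - (x i)\<^sup>2 / 2)"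
    by (simp add: ip_def sum_divide_distrib sum_negf power2_eq_square)
  then show ?thesis
    by (simp add: gauss_density_def std_normal_density_def prod_dividef exp_sum)
qed

lemma gauss_eq_density:
  "gauss N = density (vec_space N) (\<lambda>x. ennreal (gauss_density N x))"
proof (rule sym, rule normal_product.PiM_eqI)
  fix A :: "nat \<Rightarrow> real set" assume A: "\<And>i. i \<in> {..<N} \<Longrightarrow> A i \<in> sets std_normal_distribution"
  have "indicator (Pi\<^sub>E {..<N} A) x = (\<Prod>i<N. indicator (A i) (x i) :: ennreal)"
    if "x \<in> space (vec_space N)" for x
    using that by (auto simp: indicator_def space_vec_space PiE_def Pi_def)
  then have "emeasure (density (vec_space N) (\<lambda>x. ennreal (gauss_density N x))) (Pi\<^sub>E {..<N} A)
     = (\<integral>\<^sup>+x. (\<Prod>i<N. ennreal (std_normal_density (x i)) * indicator (A i) (x i)) \<partial>vec_space N)"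
    using A by (subst emeasure_density) (auto intro!: nn_integral_cong sets_PiM_I_finite
      simp: gauss_density_def prod_ennreal prod.distrib)
  also have "\<dots> = (\<Prod>i<N. \<integral>\<^sup>+x. ennreal (std_normal_density x) * indicator (A i) x \<partial>lborel)"
    using A by (intro lborel_product.product_nn_integral_prod) auto
  also have "\<dots> = (\<Prod>i<N. emeasure std_normal_distribution (A i))"
    using A by (intro prod.cong) (auto simp: emeasure_density)
  finally show "emeasure (density (vec_space N) (\<lambda>x. ennreal (gauss_density N x))) (Pi\<^sub>E {..<N} A)
    = (\<Prod>i<N. emeasure std_normal_distribution (A i))" .
qed (auto intro!: sets_PiM_cong)

lemma nn_integral_gauss:
  assumes [measurable]: "f \<in> borel_measurable (vec_space N)"
  shows "(\<integral>\<^sup>+x. f x \<partial>gauss N) = (\<integral>\<^sup>+x. ennreal (gauss_density N x) * f x \<partial>vec_space N)"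
  by (subst gauss_eq_density, subst nn_integral_density) auto

lemma nn_integral_gauss_density: "(\<integral>\<^sup>+x. ennreal (gauss_density N x) \<partial>vec_space N) = 1"
proof -
  interpret prob_space "gauss N" by (rule prob_space_gauss)
  show ?thesis using nn_integral_gauss[of "\<lambda>_. 1" N] emeasure_space_1 by simp
qed

text \<open>Uniqueness of Haar measure: both sides of
  \<open>\<integral>f(Tx) dx \<integral>g(y) dy = \<integral>f(y) dy \<integral>g(-Tx) dx\<close> equal \<open>\<integral>\<integral>f(Tx + y) g(y) dx dy\<close> up to translations.\<close>
lemma nn_integral_linear_change:
  assumes [measurable]: "T \<in> measurable (vec_space N) (vec_space N)"
    and inv: "\<And>y. y \<in> extensional {..<N} \<Longrightarrow> T' y \<in> extensional {..<N} \<and> T (T' y) = y"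
    and add: "\<And>x y. x \<in> extensional {..<N} \<Longrightarrow> y \<in> extensional {..<N} \<Longrightarrow>
       T (vadd N x y) = vadd N (T x) (T y)"
    and f[measurable]: "f \<in> borel_measurable (vec_space N)"
  shows "(\<integral>\<^sup>+x. f (T x) \<partial>vec_space N) =
    (\<integral>\<^sup>+x. ennreal (gauss_density N (T x)) \<partial>vec_space N) * (\<integral>\<^sup>+x. f x \<partial>vec_space N)"
proof -
  let ?V = "vec_space N"
  let ?g = "\<lambda>x. ennreal (gauss_density N x)"
  interpret V: sigma_finite_measure ?V by (rule lborel_product.sigma_finite) simp
  interpret VV: pair_sigma_finite ?V ?V ..
  have [measurable]: "(\<lambda>z. vadd N (a z) (b z)) \<in> measurable K ?V"
    if [measurable]: "a \<in> measurable K ?V" "b \<in> measurable K ?V" for a b and K :: "'b measure"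
    unfolding vadd_def by measurable
  have [measurable]: "(\<lambda>z. vneg N (a z)) \<in> measurable K ?V"
    if [measurable]: "a \<in> measurable K ?V" for a and K :: "'b measure"
    unfolding vneg_def by measurable
  have TE: "T x \<in> extensional {..<N}" if "x \<in> extensional {..<N}" for x
    using measurable_space[OF assms(1)] that by (auto simp: space_vec_space)
  \<comment> \<open>The second function is the Gaussian density: it has integral 1, so it may be
    multiplied in, and it is even, which removes the sign in front of \<open>T x\<close> at the
    end.\<close>
  have "(\<integral>\<^sup>+x. f (T x) \<partial>?V) = (\<integral>\<^sup>+y. (\<integral>\<^sup>+x. f (T x) \<partial>?V) * ?g y \<partial>?V)"
    by (subst nn_integral_cmult) (auto simp: nn_integral_gauss_density)
  also have "\<dots> = (\<integral>\<^sup>+y. (\<integral>\<^sup>+x. f (vadd N (T x) y) * ?g y \<partial>?V) \<partial>?V)"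
  proof (rule nn_integral_cong)
    fix y assume "y \<in> space ?V"
    then have y: "y \<in> extensional {..<N}" by (simp add: space_vec_space)
    then have [measurable]: "y \<in> space ?V" by (simp add: space_vec_space)
    \<comment> \<open>Translating the variable by \<open>T' y\<close>, a preimage of
      \<open>y\<close>, moves the argument of \<open>f\<close> by exactly \<open>y\<close>.\<close>
    have "(\<integral>\<^sup>+x. f (T x) \<partial>?V) = (\<integral>\<^sup>+x. f (T (vadd N x (T' y))) \<partial>?V)"
      by (rule nn_integral_vec_translate[symmetric]) measurable
    also have "\<dots> = (\<integral>\<^sup>+x. f (vadd N (T x) y) \<partial>?V)"
      using inv[OF y] by (intro nn_integral_cong) (simp add: space_vec_space add)
    finally show "(\<integral>\<^sup>+x. f (T x) \<partial>?V) * ?g y = (\<integral>\<^sup>+x. f (vadd N (T x) y) * ?g y \<partial>?V)"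
      by (subst nn_integral_multc) auto
  qed
  also have "\<dots> = (\<integral>\<^sup>+x. (\<integral>\<^sup>+y. f (vadd N (T x) y) * ?g y \<partial>?V) \<partial>?V)"
    by (rule VV.Fubini') measurable
  also have "\<dots> = (\<integral>\<^sup>+x. (\<integral>\<^sup>+y. f y * ?g (vadd N y (vneg N (T x))) \<partial>?V) \<partial>?V)"
  proof (rule nn_integral_cong)
    fix x assume "x \<in> space ?V"
    then have [measurable]: "x \<in> space ?V" and "T x \<in> space ?V"
      using TE by (auto simp: space_vec_space)
    then have [measurable]: "T x \<in> space ?V" by auto
    have eq: "vadd N (T x) (vadd N y (vneg N (T x))) = y" if "y \<in> extensional {..<N}" for y
      using that by (auto simp: vadd_def vneg_def extensional_def)
    have "(\<integral>\<^sup>+y. f (vadd N (T x) y) * ?g y \<partial>?V) =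
       (\<integral>\<^sup>+y. f (vadd N (T x) (vadd N y (vneg N (T x)))) * ?g (vadd N y (vneg N (T x))) \<partial>?V)"
      by (rule nn_integral_vec_translate[symmetric]) measurable
    also have "\<dots> = (\<integral>\<^sup>+y. f y * ?g (vadd N y (vneg N (T x))) \<partial>?V)"
      by (intro nn_integral_cong) (simp add: space_vec_space eq)
    finally show "(\<integral>\<^sup>+y. f (vadd N (T x) y) * ?g y \<partial>?V) =
       (\<integral>\<^sup>+y. f y * ?g (vadd N y (vneg N (T x))) \<partial>?V)" .
  qed
  also have "\<dots> = (\<integral>\<^sup>+y. (\<integral>\<^sup>+x. f y * ?g (vadd N y (vneg N (T x))) \<partial>?V) \<partial>?V)"
    by (rule VV.Fubini') measurable
  also have "\<dots> = (\<integral>\<^sup>+y. f y * (\<integral>\<^sup>+x. ?g (T x) \<partial>?V) \<partial>?V)"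
  proof (rule nn_integral_cong)
    fix y assume "y \<in> space ?V"
    then have y: "y \<in> extensional {..<N}" and [measurable]: "y \<in> space ?V"
      by (auto simp: space_vec_space)
    have eq: "vadd N y (vneg N (T (vadd N x (T' y)))) = vneg N (T x)" if "x \<in> extensional {..<N}" for x
    proof -
      have "T (vadd N x (T' y)) = vadd N (T x) y" using that inv[OF y] by (simp add: add)
      then show ?thesis by (auto simp: vadd_def vneg_def)
    qed
    have "(\<integral>\<^sup>+x. ?g (vadd N y (vneg N (T x))) \<partial>?V) =
        (\<integral>\<^sup>+x. ?g (vadd N y (vneg N (T (vadd N x (T' y))))) \<partial>?V)"
      by (rule nn_integral_vec_translate[symmetric]) measurable
    also have "\<dots> = (\<integral>\<^sup>+x. ?g (T x) \<partial>?V)"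
      by (intro nn_integral_cong) (simp add: space_vec_space eq gauss_density_vneg)
    finally show "(\<integral>\<^sup>+x. f y * ?g (vadd N y (vneg N (T x))) \<partial>?V) = f y * (\<integral>\<^sup>+x. ?g (T x) \<partial>?V)"
      by (subst nn_integral_cmult) auto
  qed
  also have "\<dots> = (\<integral>\<^sup>+x. ?g (T x) \<partial>?V) * (\<integral>\<^sup>+x. f x \<partial>?V)"
    by (subst nn_integral_multc) (auto simp: mult.commute)
  finally show ?thesis .
qed

section \<open>Isometries and Householder reflections\<close>

lemma ip_commute: "ip N x y = ip N y x"
  by (simp add: ip_def mult.commute)

lemma ip_diff_scale: "ip N z (\<lambda>i. x i - c * u i) = ip N z x - c * ip N z u"
  by (simp add: ip_def algebra_simps sum_subtractf sum_distrib_left)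

lemma ip_restrict [simp]: "ip N (restrict x {..<N}) y = ip N x y" "ip N x (restrict y {..<N}) = ip N x y"
  by (auto simp: ip_def)

lemma ip_vadd: "ip N z (vadd N x y) = ip N z x + ip N z y"
  by (simp add: ip_def vadd_def algebra_simps sum.distrib)

lemma ip_self_eq_0: "ip N u u = 0 \<Longrightarrow> i < N \<Longrightarrow> u i = 0"
  unfolding ip_def by (subst (asm) sum_nonneg_eq_0_iff) auto

text \<open>For an isometry the unspecified Jacobian factor of
  \<open>nn_integral_linear_change\<close> is the total mass of the Gaussian density, hence 1; no
  determinant of \<open>T\<close> has to be defined.\<close>

lemma nn_integral_gauss_isometry:
  assumes [measurable]: "T \<in> measurable (vec_space N) (vec_space N)"
    and inv: "\<And>y. y \<in> extensional {..<N} \<Longrightarrow> T' y \<in> extensional {..<N} \<and> T (T' y) = y"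
    and add: "\<And>x y. x \<in> extensional {..<N} \<Longrightarrow> y \<in> extensional {..<N} \<Longrightarrow>
       T (vadd N x y) = vadd N (T x) (T y)"
    and iso: "\<And>x. ip N (T x) (T x) = ip N x x"
    and f[measurable]: "f \<in> borel_measurable (vec_space N)"
  shows "(\<integral>\<^sup>+x. f (T x) \<partial>gauss N) = (\<integral>\<^sup>+x. f x \<partial>gauss N)"
proof -
  have g: "gauss_density N x = gauss_density N (T x)" for x
    by (simp add: gauss_density_ip iso)
  have "(\<integral>\<^sup>+x. f (T x) \<partial>gauss N) =
      (\<integral>\<^sup>+x. ennreal (gauss_density N (T x)) * f (T x) \<partial>vec_space N)"
    by (subst nn_integral_gauss, measurable) (simp flip: g)
  also have "\<dots> = (\<integral>\<^sup>+x. ennreal (gauss_density N (T x)) \<partial>vec_space N) *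
       (\<integral>\<^sup>+x. ennreal (gauss_density N x) * f x \<partial>vec_space N)"
    by (rule nn_integral_linear_change[OF assms(1) inv add]) measurable
  also have "\<dots> = (\<integral>\<^sup>+x. f x \<partial>gauss N)"
    by (simp flip: g add: nn_integral_gauss_density nn_integral_gauss)
  finally show ?thesis .
qed

text \<open>The Householder reflection in the hyperplane orthogonal to \<open>u\<close>. If
  \<open>u\<close> has norm 0, division by zero gives 0 and the map only restricts to the
  coordinates below \<open>N\<close>, so it is an isometry in every case.\<close>

definition refl_vec :: "nat \<Rightarrow> (nat \<Rightarrow> real) \<Rightarrow> (nat \<Rightarrow> real) \<Rightarrow> nat \<Rightarrow> real" where
  "refl_vec N u x = (\<lambda>i\<in>{..<N}. x i - 2 * ip N u x / ip N u u * u i)"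

lemma ip_refl_vec: "ip N (refl_vec N u x) (refl_vec N u y) = ip N x y"
proof -
  define c where "c = (\<lambda>x. 2 * ip N u x / ip N u u)"
  have rv: "refl_vec N u x = (\<lambda>i\<in>{..<N}. x i - c x * u i)" for x
    by (simp only: refl_vec_def c_def)
  have r: "ip N z (refl_vec N u x) = ip N z x - c x * ip N z u" for z x
    unfolding rv ip_restrict ip_diff_scale ..
  show ?thesis
    unfolding r ip_commute[of N "refl_vec N u x" y] ip_commute[of N "refl_vec N u x" u]
    by (cases "ip N u u = 0") (auto simp: c_def field_simps ip_commute[of N x u] ip_commute[of N y u] ip_commute[of N y x])
qed

lemma refl_vec_refl_vec:
  assumes "x \<in> extensional {..<N}"
  shows "refl_vec N u (refl_vec N u x) = x"
proof -
  define c where "c = (\<lambda>x. 2 * ip N u x / ip N u u)"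
  have rv: "refl_vec N u x = (\<lambda>i\<in>{..<N}. x i - c x * u i)" for x
    by (simp only: refl_vec_def c_def)
  have r: "ip N z (refl_vec N u x) = ip N z x - c x * ip N z u" for z x
    unfolding rv ip_restrict ip_diff_scale ..
  have "c (refl_vec N u x) = - c x"
    by (cases "ip N u u = 0") (auto simp: c_def r field_simps)
  then show ?thesis
    using assms unfolding rv by (auto simp: extensional_def)
qed

lemma refl_vec_vadd: "refl_vec N u (vadd N x y) = vadd N (refl_vec N u x) (refl_vec N u y)"
proof -
  define c where "c = (\<lambda>x. 2 * ip N u x / ip N u u)"
  have rv: "refl_vec N u x = (\<lambda>i\<in>{..<N}. x i - c x * u i)" for x
    by (simp only: refl_vec_def c_def)
  have "c (vadd N x y) = c x + c y"
    by (simp add: c_def ip_vadd add_divide_distrib)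
  then show ?thesis
    by (auto simp: rv vadd_def algebra_simps)
qed

lemma refl_vec_measurable: "refl_vec N u \<in> measurable (vec_space N) (vec_space N)"
  unfolding refl_vec_def by measurable

lemma nn_integral_gauss_refl_vec:
  assumes "f \<in> borel_measurable (vec_space N)"
  shows "(\<integral>\<^sup>+x. f (refl_vec N u x) \<partial>gauss N) = (\<integral>\<^sup>+x. f x \<partial>gauss N)"
  by (rule nn_integral_gauss_isometry[OF refl_vec_measurable, where T'="refl_vec N u"])
    (auto simp: refl_vec_refl_vec refl_vec_vadd ip_refl_vec assms, auto simp: refl_vec_def)

text \<open>Householder's QR factorisation: any \<open>m \<le> N\<close> vectors can be rotated into upper triangular
  position. No linear independence is assumed.\<close>
lemma exists_triangularising_isometry:
  assumes "m \<le> N"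
  shows "\<exists>T. T \<in> measurable (vec_space N) (vec_space N) \<and>
    (\<forall>f\<in>borel_measurable (vec_space N). (\<integral>\<^sup>+x. f (T x) \<partial>gauss N) = (\<integral>\<^sup>+x. f x \<partial>gauss N)) \<and>
    (\<forall>x y. ip N (T x) (T y) = ip N x y) \<and>
    (\<forall>b<m. \<forall>c<N. b < c \<longrightarrow> T (y b) c = 0)"
  using assms
proof (induction m)
  case 0
  define T :: "(nat \<Rightarrow> real) \<Rightarrow> nat \<Rightarrow> real" where "T = (\<lambda>x. restrict x {..<N})"
  have "T x = x" if "x \<in> space (gauss N)" for x
    using that by (simp add: T_def space_gauss extensional_restrict)
  then have "(\<integral>\<^sup>+x. f (T x) \<partial>gauss N) = (\<integral>\<^sup>+x. f x \<partial>gauss N)" for f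
    by (intro nn_integral_cong) simp
  moreover have "T \<in> measurable (vec_space N) (vec_space N)" unfolding T_def by measurable
  moreover have "ip N (T x) (T y) = ip N x y" for x y by (simp only: T_def ip_restrict)
  ultimately show ?case by auto
next
  case (Suc m)
  then obtain T where T[measurable]: "T \<in> measurable (vec_space N) (vec_space N)"
    and inv: "\<And>f. f \<in> borel_measurable (vec_space N) \<Longrightarrow>
        (\<integral>\<^sup>+x. f (T x) \<partial>gauss N) = (\<integral>\<^sup>+x. f x \<partial>gauss N)"
    and iso: "\<And>x y. ip N (T x) (T y) = ip N x y"
    and tri: "\<And>b c. b < m \<Longrightarrow> c < N \<Longrightarrow> b < c \<Longrightarrow> T (y b) c = 0"
    by auto
  define z where "z = T (y m)"
  define r where "r = sqrt (\<Sum>c\<in>{m..<N}. (z c)\<^sup>2)"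
  \<comment> \<open>Up to coordinate \<open>m - 1\<close> the vector \<open>u\<close> is 0, so it is
    orthogonal to the vectors already in position, which vanish from coordinate \<open>m\<close> on
    and are left fixed. From \<open>m\<close> on it is the difference of the tail of
    \<open>z\<close> and its target, \<open>r\<close> times the axis \<open>m\<close>.\<close>
  define u where "u c = (if c < m then 0 else if c = m then z c - r else z c)" for c
  define H where "H = refl_vec N u"
  have "m < N" using Suc by simp
  have r2: "r\<^sup>2 = (\<Sum>c\<in>{m..<N}. (z c)\<^sup>2)" unfolding r_def by (simp add: sum_nonneg)
  have split: "{..<N} = {..<m} \<union> {m..<N}" "{m..<N} = insert m {Suc m..<N}"
    using \<open>m < N\<close> by auto
  have ipu: "ip N u x = u m * x m + (\<Sum>c\<in>{Suc m..<N}. u c * x c)" for x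
    unfolding ip_def split(1) by (subst sum.union_disjoint) (auto simp: split(2), auto simp: u_def)
  have r2': "r\<^sup>2 = (z m)\<^sup>2 + (\<Sum>c\<in>{Suc m..<N}. (z c)\<^sup>2)"
    unfolding r2 split(2) by simp
  have uu: "ip N u u = 2 * r\<^sup>2 - 2 * r * z m"
    unfolding ipu r2' by (simp add: u_def power2_eq_square algebra_simps)
       (use r2' in \<open>simp add: power2_eq_square algebra_simps\<close>)
  have uz: "ip N u z = r\<^sup>2 - r * z m"
    unfolding ipu r2' by (simp add: u_def power2_eq_square algebra_simps)
  have "H z c = 0" if "m < c" "c < N" for c
  \<comment> \<open>If \<open>u\<close> vanishes, \<open>z\<close> is already in position. Otherwise
    \<open>ip N u u = 2 * ip N u z\<close>, and the reflection subtracts exactly \<open>u\<close>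
    from \<open>z\<close>.\<close>
  proof (cases "ip N u u = 0")
    case True
    then have "u c = 0" using ip_self_eq_0 that by blast
    then show ?thesis using that True by (simp add: H_def refl_vec_def u_def)
  next
    case False
    then have "2 * ip N u z / ip N u u = 1" unfolding uz using uu by (simp add: field_simps)
    then show ?thesis using that by (simp add: H_def refl_vec_def u_def)
  qed
  moreover have "H (T (y b)) c = 0" if "b < m" "c < N" "b < c" for b c
  proof -
    have "T (y b) m = 0" using tri[of b m] that \<open>m < N\<close> by simp
    moreover have "T (y b) c' = 0" if "c' \<in> {Suc m..<N}" for c'
      using tri[of b c'] that \<open>b < m\<close> by simp
    ultimately have "ip N u (T (y b)) = 0" unfolding ipu by simp
    then show ?thesis using tri[OF that] that by (simp add: H_def refl_vec_def)
  qed
  ultimately have "\<forall>b<Suc m. \<forall>c<N. b < c \<longrightarrow> (H \<circ> T) (y b) c = 0"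
    by (auto simp: less_Suc_eq z_def)
  moreover have [measurable]: "H \<in> measurable (vec_space N) (vec_space N)"
    unfolding H_def by (rule refl_vec_measurable)
  moreover have "(\<integral>\<^sup>+x. f ((H \<circ> T) x) \<partial>gauss N) = (\<integral>\<^sup>+x. f x \<partial>gauss N)"
    if [measurable]: "f \<in> borel_measurable (vec_space N)" for f
    using inv[of "\<lambda>x. f (H x)"] nn_integral_gauss_refl_vec[of f N u] by (simp add: H_def[symmetric])
  moreover have "ip N ((H \<circ> T) x) ((H \<circ> T) y) = ip N x y" for x y
    by (simp add: H_def ip_refl_vec iso)
  moreover have "H \<circ> T \<in> measurable (vec_space N) (vec_space N)" by measurable
  ultimately show ?case by blast
qed

section \<open>The determinant ratio as a product of independent factors\<close>

text \<open>The first \<open>m\<close> vectors fill only \<open>m\<close> coordinates of the range,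
  so their Gram matrix is \<open>R * transpose_mat R\<close> with \<open>R\<close> square. For the
  new vector all coordinates beyond may be collapsed into one entry \<open>sqrt \<rho>\<close>,
  since only its own norm sees them; the enlarged factor is block triangular.\<close>

lemma det_gram_step:
  fixes t :: "nat \<Rightarrow> nat \<Rightarrow> real"
  assumes supp: "\<And>b c. b < m \<Longrightarrow> s + m \<le> c \<Longrightarrow> c < N \<Longrightarrow> t b c = 0" and le: "s + m \<le> N"
  defines "G \<equiv> \<lambda>m. Matrix.mat m m (\<lambda>(a, b). \<Sum>c\<in>{s..<N}. t a c * t b c)"
  shows "Determinant.det (G (Suc m)) = Determinant.det (G m) * (\<Sum>c\<in>{s+m..<N}. (t m c)\<^sup>2)"
proof -
  define \<rho> where "\<rho> = (\<Sum>c\<in>{s+m..<N}. (t m c)\<^sup>2)"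
  define R where "R = Matrix.mat m m (\<lambda>(b, c). t b (s + c))"
  define R' where "R' = four_block_mat R (0\<^sub>m m 1) (Matrix.mat 1 m (\<lambda>(_, c). t m (s + c)))
    (Matrix.mat 1 1 (\<lambda>_. sqrt \<rho>))"
  have \<rho>: "0 \<le> \<rho>" unfolding \<rho>_def by (simp add: sum_nonneg)
  have R[simp]: "R \<in> carrier_mat m m" unfolding R_def by simp
  have R'[simp]: "R' \<in> carrier_mat (Suc m) (Suc m)"
    using four_block_carrier_mat[of R m m "Matrix.mat 1 1 (\<lambda>_. sqrt \<rho>)" 1 1] by (simp add: R'_def)
  have R'_ix: "R' $$ (b, c) = (if c < m then t b (s + c) else if b < m then 0 else sqrt \<rho>)"
    if "b < Suc m" "c < Suc m" for b c
    using that by (auto simp: R'_def R_def four_block_mat_def Let_def less_Suc_eq)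
  have split: "(\<Sum>c\<in>{s..<N}. f c) = (\<Sum>c<m. f (s + c)) + (\<Sum>c\<in>{s+m..<N}. f c)" for f :: "nat \<Rightarrow> real"
  proof -
    have "(\<Sum>c\<in>{s..<N}. f c) = (\<Sum>c\<in>{s..<s+m}. f c) + (\<Sum>c\<in>{s+m..<N}. f c)"
      using le by (simp add: sum.atLeastLessThan_concat)
    also have "(\<Sum>c\<in>{s..<s+m}. f c) = (\<Sum>c<m. f (s + c))"
      using sum.shift_bounds_nat_ivl[of f 0 s m] by (simp add: add.commute lessThan_atLeast0)
    finally show ?thesis .
  qed
  have tail: "(\<Sum>c\<in>{s+m..<N}. t a c * t b c) = (if a < m \<or> b < m then 0 else \<rho>)"
    if "a < Suc m" "b < Suc m" for a b
    using that by (auto simp: supp \<rho>_def power2_eq_square less_Suc_eq)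
  have "G m = R * transpose_mat R"
    by (rule eq_matI) (auto simp: G_def R_def scalar_prod_def split tail lessThan_atLeast0)
  moreover have "G (Suc m) = R' * transpose_mat R'"
  proof (rule eq_matI)
    fix a b assume "a < dim_row (R' * transpose_mat R')" "b < dim_col (R' * transpose_mat R')"
    then have ab: "a < Suc m" "b < Suc m" using R' by auto
    have "(R' * transpose_mat R') $$ (a, b) = (\<Sum>c<Suc m. R' $$ (a, c) * R' $$ (b, c))"
      using ab carrier_matD[OF R']
      by (simp add: scalar_prod_def lessThan_atLeast0 del: sum.op_ivl_Suc)
    also have "\<dots> = (\<Sum>c<m. t a (s + c) * t b (s + c)) + (if a < m \<or> b < m then 0 else \<rho>)"
      using ab \<rho> by (simp add: R'_ix)
    also have "\<dots> = G (Suc m) $$ (a, b)"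
      using ab by (simp add: G_def split tail)
    finally show "G (Suc m) $$ (a, b) = (R' * transpose_mat R') $$ (a, b)" ..
  qed (use carrier_matD[OF R'] in \<open>simp_all add: G_def\<close>)
  moreover have "Determinant.det R' = Determinant.det R * sqrt \<rho>"
    unfolding R'_def by (subst det_four_block_mat_upper_right_zero[where m=1]) (auto simp: det_single)
  ultimately show ?thesis
    using \<rho> by (simp add: det_mult[of _ m] det_mult[of _ "Suc m"] det_transpose[of _ m]
       det_transpose[of _ "Suc m"] \<rho>_def[symmetric])
qed

lemma borel_measurable_det:
  assumes [measurable]: "\<And>a b. (\<lambda>z. F z a b) \<in> borel_measurable M"
  shows "(\<lambda>z. Determinant.det (Matrix.mat m m (\<lambda>(a, b). F z a b)) :: real) \<in> borel_measurable M"
proof -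
  have "Determinant.det (Matrix.mat m m (\<lambda>(a, b). F z a b)) =
    (\<Sum>p\<in>{p. p permutes {0..<m}}. signof p * (\<Prod>i = 0..<m. F z i (p i)))" for z
    by (subst det_def'[of _ m]) (auto intro!: sum.cong prod.cong simp: permutes_in_image)
  then show ?thesis by simp
qed

text \<open>The data are indexed column first: \<open>y a\<close> is the vector in R^n of all values
  of coordinate \<open>a\<close>. Isometries of R^n then act on whole columns, which the order of
  indices in \<open>scatter_mat\<close> does not allow.\<close>

definition scatter_det :: "nat \<Rightarrow> nat \<Rightarrow> nat \<Rightarrow> (nat \<Rightarrow> nat \<Rightarrow> real) \<Rightarrow> real" where
  "scatter_det n s r y = Determinant.det (scatter_mat n r (\<lambda>i a. y (s + a) i))"

lemma scatter_entry:
  assumes "n > 0"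
  shows "(\<Sum>i<n. (x i a - sample_mean n x a) * (x i b - sample_mean n x b)) =
    ip n (\<lambda>i. x i a) (\<lambda>i. x i b) - ip n (\<lambda>i. x i a) (\<lambda>_. 1) * ip n (\<lambda>i. x i b) (\<lambda>_. 1) / real n"
proof -
  define A B where "A = (\<Sum>i<n. x i a)" and "B = (\<Sum>i<n. x i b)"
  have "(\<Sum>i<n. (x i a - sample_mean n x a) * (x i b - sample_mean n x b)) =
     (\<Sum>i<n. x i a * x i b - A / n * x i b - B / n * x i a + A / n * (B / n))"
    by (simp add: sample_mean_def A_def B_def algebra_simps)
  also have "\<dots> = (\<Sum>i<n. x i a * x i b) - A / n * B - B / n * A + real n * (A / n * (B / n))"
    unfolding A_def B_def by (simp add: sum.distrib sum_subtractf sum_distrib_left)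
  also have "\<dots> = (\<Sum>i<n. x i a * x i b) - A * B / n"
    using assms by (simp add: field_simps)
  finally show ?thesis by (simp add: ip_def A_def B_def)
qed

text \<open>Rotating the vector of ones to the first axis turns centring into dropping a coordinate.\<close>
lemma scatter_det_isometry:
  assumes iso: "\<And>x y. ip n (T x) (T y) = ip n x y" and "n > 0"
    and one: "\<And>c. 0 < c \<Longrightarrow> c < n \<Longrightarrow> T (\<lambda>_. 1) c = 0"
  shows "scatter_det n s r y = Determinant.det (Matrix.mat r r
    (\<lambda>(a, b). \<Sum>c\<in>{1..<n}. T (y (s + a)) c * T (y (s + b)) c))"
proof -
  have n: "{..<n} = insert 0 {1..<n}" using \<open>n > 0\<close> by auto
  have ip0: "ip n u (T (\<lambda>_. 1)) = u 0 * T (\<lambda>_. 1) 0" for u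
    unfolding ip_def n using one by simp
  have "real n = ip n (\<lambda>_. 1) (\<lambda>_. 1)" by (simp add: ip_def)
  also have "\<dots> = ip n (T (\<lambda>_. 1)) (T (\<lambda>_. 1))" by (simp only: iso)
  also have "\<dots> = (T (\<lambda>_. 1) 0)\<^sup>2" by (simp only: ip0 power2_eq_square)
  finally have T0: "(T (\<lambda>_. 1) 0)\<^sup>2 = real n" ..
  have "ip n x y - ip n x (\<lambda>_. 1) * ip n y (\<lambda>_. 1) / real n = (\<Sum>c\<in>{1..<n}. T x c * T y c)" for x y
  proof -
    have "ip n z (\<lambda>_. 1) = T z 0 * T (\<lambda>_. 1) 0" for z
      using iso[of z "\<lambda>_. 1"] by (simp only: ip0)
    then have "ip n x (\<lambda>_. 1) * ip n y (\<lambda>_. 1) = T x 0 * T y 0 * real n"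
      by (simp add: T0[symmetric] power2_eq_square)
    then have "ip n x y - ip n x (\<lambda>_. 1) * ip n y (\<lambda>_. 1) / real n = ip n (T x) (T y) - T x 0 * T y 0"
      using \<open>n > 0\<close> by (simp add: iso)
    then show ?thesis by (simp add: ip_def n)
  qed
  then show ?thesis
    unfolding scatter_det_def scatter_mat_def
    by (intro arg_cong[where f=Determinant.det] eq_matI)
      (auto simp: scatter_entry[OF \<open>n > 0\<close>, where x="\<lambda>i a. y (s + a) i"])
qed

lemma scatter_det_0 [simp]: "scatter_det n s 0 y = 1"
  by (simp add: scatter_det_def scatter_mat_def)

lemma scatter_det_cong:
  "(\<And>a. s \<le> a \<Longrightarrow> a < s + r \<Longrightarrow> y a = z a) \<Longrightarrow> scatter_det n s r y = scatter_det n s r z"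
  unfolding scatter_det_def scatter_mat_def
  by (intro arg_cong[where f=Determinant.det] eq_matI) (auto simp: sample_mean_def)

text \<open>\<open>det_gram_step\<close> with offset 1: coordinate 0 is used up by the vector of
  ones, coordinates 1 to \<open>r\<close> by the earlier columns, and the new factor is what the new
  column has beyond them.\<close>

lemma scatter_det_Suc:
  assumes iso: "\<And>x y. ip n (T x) (T y) = ip n x y"
    and one: "\<And>c. 0 < c \<Longrightarrow> c < n \<Longrightarrow> T (\<lambda>_. 1) c = 0"
    and supp: "\<And>b c. b < r \<Longrightarrow> 1 + r \<le> c \<Longrightarrow> c < n \<Longrightarrow> T (y (s + b)) c = 0"
    and "r < n"
  shows "scatter_det n s (Suc r) y = scatter_det n s r y * (\<Sum>c\<in>{1+r..<n}. (T (y (s + r)) c)\<^sup>2)"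
  using det_gram_step[of r 1 n "\<lambda>b. T (y (s + b))"] assms
  by (simp add: scatter_det_isometry[OF iso _ one])

section \<open>Blocks of coordinates and the effect of one further column\<close>

definition block_index :: "(nat \<Rightarrow> nat) \<Rightarrow> nat \<Rightarrow> nat" where
  "block_index d a = (LEAST j. a < offset d (Suc j))"

definition block_start :: "(nat \<Rightarrow> nat) \<Rightarrow> nat \<Rightarrow> nat" where
  "block_start d a = offset d (block_index d a)"

lemma offset_0 [simp]: "offset d 0 = 0"
  and offset_Suc: "offset d (Suc j) = offset d j + d j"
  by (simp_all add: offset_def)

lemma offset_mono: "i \<le> j \<Longrightarrow> offset d i \<le> offset d j"
  unfolding offset_def by (rule sum_mono2) auto

lemma total_dim_offset: "total_dim k d = offset d k"
  by (simp add: total_dim_def offset_def)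

lemma block_index:
  assumes "a < offset d k"
  shows "block_index d a < k" "offset d (block_index d a) \<le> a"
    "a < offset d (block_index d a) + d (block_index d a)"
proof -
  let ?P = "\<lambda>j. a < offset d (Suc j)"
  have "k \<noteq> 0" using assms by (cases k) auto
  then have P: "?P (k - 1)" using assms by simp
  show "block_index d a < k"
    unfolding block_index_def using Least_le[of ?P, OF P] \<open>k \<noteq> 0\<close> by simp
  show "a < offset d (block_index d a) + d (block_index d a)"
    using LeastI[of ?P, OF P] by (simp add: block_index_def offset_Suc)
  show "offset d (block_index d a) \<le> a"
  proof (cases "block_index d a")
    case (Suc i)
    then have "\<not> ?P i" using not_less_Least[of i ?P] by (simp add: block_index_def)
    then show ?thesis using Suc by simp
  qed simp
qed

lemma block_index_eqI:
  assumes "offset d j \<le> a" "a < offset d j + d j"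
  shows "block_index d a = j"
  unfolding block_index_def
proof (rule Least_equality)
  show "a < offset d (Suc j)" using assms by (simp add: offset_Suc)
  fix i assume "a < offset d (Suc i)"
  then show "j \<le> i" using offset_mono[of "Suc i" j d] assms by (cases "j \<le> i") auto
qed

lemma block_start_le: "a < offset d k \<Longrightarrow> block_start d a \<le> a"
  by (simp add: block_start_def block_index)

text \<open>The determinant ratio for the first \<open>a\<close> columns, the blocks being truncated accordingly.\<close>
definition det_ratio :: "nat \<Rightarrow> nat \<Rightarrow> (nat \<Rightarrow> nat) \<Rightarrow> nat \<Rightarrow> (nat \<Rightarrow> nat \<Rightarrow> real) \<Rightarrow> real" where
  "det_ratio n k d a y = scatter_det n 0 a y /
     (\<Prod>j<k. scatter_det n (offset d j) (min (d j) (a - offset d j)) y)"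

text \<open>The squared residual of column \<open>a\<close> after the ones and all earlier columns,
  over that after the ones and the earlier columns of its own block; in rotated coordinates both
  residuals are tails of the vector.\<close>

definition resid_ratio :: "nat \<Rightarrow> (nat \<Rightarrow> nat) \<Rightarrow> nat \<Rightarrow> (nat \<Rightarrow> real) \<Rightarrow> real" where
  "resid_ratio n d a x =
     (\<Sum>c\<in>{1+a..<n}. (x c)\<^sup>2) / (\<Sum>c\<in>{1+(a - block_start d a)..<n}. (x c)\<^sup>2)"

text \<open>One rotation serves both determinants if the vectors are put into triangular position in
  the order ones, own block, other columns. \<open>T\<close> is chosen before \<open>x\<close>: it
  depends on the earlier columns only, so \<open>T x\<close> is again standard Gaussian when they
  are held fixed.\<close>

lemma det_ratio_Suc:
  assumes a: "a < offset d k" "a < n"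
  shows "\<exists>T. T \<in> measurable (vec_space n) (vec_space n) \<and>
    (\<forall>f\<in>borel_measurable (vec_space n). (\<integral>\<^sup>+x. f (T x) \<partial>gauss n) = (\<integral>\<^sup>+x. f x \<partial>gauss n)) \<and>
    (\<forall>x. det_ratio n k d (Suc a) (y(a := x)) = det_ratio n k d a y * resid_ratio n d a (T x))"
proof -
  define j where "j = block_index d a"
  define s where "s = block_start d a"
  define r where "r = a - s"
  \<comment> \<open>Positions 1 to \<open>r\<close> hold the columns of the own block, from
    \<open>s\<close> on; the later positions hold the columns 0 to \<open>s - 1\<close> of the
    preceding blocks.\<close>
  define v where "v b = (if b = 0 then (\<lambda>_. 1) else if b < 1 + r then y (s + (b - 1)) else y (b - 1 - r))" for b
  have sj: "s = offset d j" by (simp add: s_def block_start_def j_def)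
  have j: "j < k" "offset d j \<le> a" "a < offset d j + d j"
    using block_index[OF a(1)] by (simp_all add: j_def)
  have ar: "a = s + r" using j by (simp add: r_def sj)
  obtain T where T: "T \<in> measurable (vec_space n) (vec_space n)"
    "\<And>f. f \<in> borel_measurable (vec_space n) \<Longrightarrow> (\<integral>\<^sup>+x. f (T x) \<partial>gauss n) = (\<integral>\<^sup>+x. f x \<partial>gauss n)"
    and iso: "\<And>x y. ip n (T x) (T y) = ip n x y"
    and tri: "\<And>b c. b < Suc a \<Longrightarrow> c < n \<Longrightarrow> b < c \<Longrightarrow> T (v b) c = 0"
    using exists_triangularising_isometry[of "Suc a" n v] a by auto
  have one: "T (\<lambda>_. 1) c = 0" if "0 < c" "c < n" for c
    using tri[of 0 c] that by (simp add: v_def)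
  have in_block: "T (y (s + b)) c = 0" if "b < r" "1 + r \<le> c" "c < n" for b c
    using tri[of "1 + b" c] that ar by (simp add: v_def)
  have before: "T (y b) c = 0" if "b < a" "1 + a \<le> c" "c < n" for b c
  proof (cases "b < s")
    case True
    then show ?thesis using tri[of "1 + r + b" c] that ar by (simp add: v_def)
  next
    case False
    then show ?thesis using in_block[of "b - s" c] that ar by simp
  qed
  have "det_ratio n k d (Suc a) (y(a := x)) = det_ratio n k d a y * resid_ratio n d a (T x)" for x
  proof -
    let ?y = "y(a := x)"
    let ?A = "\<Sum>c\<in>{1+a..<n}. (T x c)\<^sup>2" and ?B = "\<Sum>c\<in>{1+r..<n}. (T x c)\<^sup>2"
    have full: "scatter_det n 0 (Suc a) ?y = scatter_det n 0 a y * ?A"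
      using scatter_det_Suc[of n T a ?y 0, OF iso one] before a scatter_det_cong[of 0 a ?y y n] by simp
    have blk: "scatter_det n s (Suc r) ?y = scatter_det n s r y * ?B"
      using scatter_det_Suc[of n T r ?y s, OF iso one] in_block a scatter_det_cong[of s r ?y y n] ar by simp
    let ?F = "\<lambda>a y l. scatter_det n (offset d l) (min (d l) (a - offset d l)) y"
    \<comment> \<open>A block before \<open>j\<close> is already complete, and one after
      \<open>j\<close> is still empty because the natural subtraction gives 0; neither notices
      column \<open>a\<close>.\<close>
    have other: "?F (Suc a) ?y l = ?F a y l" if "l \<noteq> j" for l
    proof (cases "l < j")
      case True
      then have "offset d l + d l \<le> a"
        using offset_mono[of "Suc l" j d] j by (simp add: offset_Suc)
      then show ?thesis by (auto intro!: scatter_det_cong simp: min_def)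
    next
      case False
      then have "Suc a \<le> offset d l"
        using offset_mono[of "Suc j" l d] j that by (simp add: offset_Suc)
      then show ?thesis by simp
    qed
    have same: "?F (Suc a) ?y j = ?F a y j * ?B"
    proof -
      have "min (d j) (Suc a - offset d j) = Suc r" "min (d j) (a - offset d j) = r"
        using j by (auto simp: r_def sj)
      then show ?thesis using blk by (simp add: sj)
    qed
    have "(\<Prod>l<k. ?F (Suc a) ?y l) = (\<Prod>l<k. ?F a y l) * ?B"
      using j(1) same other by (simp add: prod.remove[of "{..<k}" j])
    then show ?thesis
      by (simp add: det_ratio_def full resid_ratio_def s_def[symmetric] r_def[symmetric])
  qed
  with T show ?thesis by blast
qed

section \<open>Equality in law of the determinant ratio and a product of factors\<close>

abbreviation gauss_columns :: "nat \<Rightarrow> nat \<Rightarrow> (nat \<Rightarrow> nat \<Rightarrow> real) measure" where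
  "gauss_columns n p \<equiv> (\<Pi>\<^sub>M a\<in>{..<p}. gauss n)"

lemma product_sigma_finite_gauss: "product_sigma_finite (\<lambda>_. gauss n)"
  by (intro product_sigma_finite.intro prob_space_imp_sigma_finite prob_space_gauss)

lemma prob_space_gauss_columns: "prob_space (gauss_columns n p)"
  by (rule prob_space_PiM) (rule prob_space_gauss)

lemma measurable_component_columns [measurable]: "(\<lambda>y. y a i) \<in> borel_measurable (gauss_columns n p)"
proof (cases "a < p")
  case True
  then have "a \<in> {..<p}" by simp
  then have "(\<lambda>y. y a) \<in> measurable (gauss_columns n p) (gauss n)" by measurable
  then show ?thesis using measurable_compose[OF _ measurable_component_gauss] by fast
next
  case False
  have "y a i = undefined i" if "y \<in> space (gauss_columns n p)" for y
    using that False by (auto simp: space_PiM PiE_def extensional_def)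
  then show ?thesis by (subst measurable_cong[where g="\<lambda>_. undefined i"]) auto
qed

lemma scatter_det_measurable:
  assumes [measurable]: "\<And>a i. (\<lambda>z. y z a i) \<in> borel_measurable M"
  shows "(\<lambda>z. scatter_det n s r (y z)) \<in> borel_measurable M"
  unfolding scatter_det_def scatter_mat_def sample_mean_def
  by (rule borel_measurable_det) measurable

lemma det_ratio_measurable:
  assumes [measurable]: "\<And>a i. (\<lambda>z. y z a i) \<in> borel_measurable M"
  shows "(\<lambda>z. det_ratio n k d r (y z)) \<in> borel_measurable M"
  unfolding det_ratio_def by (intro borel_measurable_divide borel_measurable_prod scatter_det_measurable assms)

lemma resid_ratio_measurable:
  assumes [measurable]: "\<And>i. (\<lambda>z. x z i) \<in> borel_measurable M"
  shows "(\<lambda>z. resid_ratio n d a (x z)) \<in> borel_measurable M"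
  unfolding resid_ratio_def by measurable

text \<open>The last column is integrated first, for fixed earlier ones; invariance removes the
  rotation that depends on them. After exchanging the integrals, the induction hypothesis applies
  for each fixed last column, with its factor as part of the test function; hence \<open>h\<close>
  is arbitrary.\<close>

lemma nn_integral_det_ratio:
  assumes "a \<le> offset d k" "a \<le> n" and h[measurable]: "h \<in> borel_measurable borel"
  shows "(\<integral>\<^sup>+y. h (det_ratio n k d a y) \<partial>gauss_columns n a) =
    (\<integral>\<^sup>+y. h (\<Prod>b<a. resid_ratio n d b (y b)) \<partial>gauss_columns n a)"
  using assms
proof (induction a arbitrary: h)
  case 0
  have "det_ratio n k d 0 y = 1" for y by (simp add: det_ratio_def)
  then show ?case by simp
next
  case (Suc a)
  note [measurable] = Suc.prems(3) det_ratio_measurable resid_ratio_measurable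
  interpret product_sigma_finite "\<lambda>_::nat. gauss n" by (rule product_sigma_finite_gauss)
  have I: "{..<Suc a} = insert a {..<a}" by auto
  let ?R = "\<lambda>y. \<Prod>b<a. resid_ratio n d b (y b)"
  interpret G: prob_space "gauss n" by (rule prob_space_gauss)
  interpret C: prob_space "gauss_columns n a" by (rule prob_space_gauss_columns)
  interpret GC: pair_sigma_finite "gauss n" "gauss_columns n a" ..
  have step: "(\<integral>\<^sup>+x. h (det_ratio n k d (Suc a) (y(a := x))) \<partial>gauss n) =
     (\<integral>\<^sup>+x. h (det_ratio n k d a y * resid_ratio n d a x) \<partial>gauss n)" for y
  proof -
    obtain T where T: "\<And>f. f \<in> borel_measurable (vec_space n) \<Longrightarrow> (\<integral>\<^sup>+x. f (T x) \<partial>gauss n) = (\<integral>\<^sup>+x. f x \<partial>gauss n)"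
      and eq: "\<And>x. det_ratio n k d (Suc a) (y(a := x)) = det_ratio n k d a y * resid_ratio n d a (T x)"
      using det_ratio_Suc[of a d k n y] Suc.prems by auto
    show ?thesis
      unfolding eq by (rule T[of "\<lambda>x. h (det_ratio n k d a y * resid_ratio n d a x)"]) measurable
  qed
  have "(\<integral>\<^sup>+y. h (det_ratio n k d (Suc a) y) \<partial>gauss_columns n (Suc a)) =
      (\<integral>\<^sup>+y. (\<integral>\<^sup>+x. h (det_ratio n k d (Suc a) (y(a := x))) \<partial>gauss n) \<partial>gauss_columns n a)"
    unfolding I by (rule product_nn_integral_insert) (simp_all add: I[symmetric], measurable)
  also have "\<dots> = (\<integral>\<^sup>+y. (\<integral>\<^sup>+x. h (det_ratio n k d a y * resid_ratio n d a x) \<partial>gauss n) \<partial>gauss_columns n a)"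
    unfolding step ..
  also have "\<dots> = (\<integral>\<^sup>+x. (\<integral>\<^sup>+y. h (det_ratio n k d a y * resid_ratio n d a x) \<partial>gauss_columns n a) \<partial>gauss n)"
    by (rule GC.Fubini') measurable
  also have "\<dots> = (\<integral>\<^sup>+x. (\<integral>\<^sup>+y. h (?R y * resid_ratio n d a x) \<partial>gauss_columns n a) \<partial>gauss n)"
    using Suc.prems by (intro nn_integral_cong Suc.IH) auto
  also have "\<dots> = (\<integral>\<^sup>+x. (\<integral>\<^sup>+y. h (\<Prod>b<Suc a. resid_ratio n d b ((y(a := x)) b)) \<partial>gauss_columns n a) \<partial>gauss n)"
    by simp
  also have "\<dots> = (\<integral>\<^sup>+y. h (\<Prod>b<Suc a. resid_ratio n d b (y b)) \<partial>gauss_columns n (Suc a))"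
    unfolding I[symmetric]
    by (subst (2) I, subst product_nn_integral_insert_rev) (simp_all add: I[symmetric] del: prod.lessThan_Suc, measurable)
  finally show ?case .
qed

section \<open>Whitening\<close>

text \<open>Gram-Schmidt for the scalar product given by \<open>S\<close>, applied to the unit
  vectors in order. Rows come out triangular, and as \<open>S\<close> does not link different values
  of \<beta>, no row ever leaves its own class.\<close>

lemma exists_whitening:
  fixes \<beta> :: "nat \<Rightarrow> 'c"
  assumes S: "pos_def_mat p S"
    and zero: "\<And>a b. a < p \<Longrightarrow> b < p \<Longrightarrow> \<beta> a \<noteq> \<beta> b \<Longrightarrow> S $$ (a, b) = 0"
  shows "\<exists>B. (\<forall>a<p. B a a > 0) \<and> (\<forall>a<p. \<forall>c<p. B a c \<noteq> 0 \<longrightarrow> c \<le> a \<and> \<beta> c = \<beta> a) \<and>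
    (\<forall>a<p. \<forall>b<p. (\<Sum>c<p. \<Sum>e<p. B a c * S $$ (c, e) * B b e) = (if a = b then 1 else 0 :: real))"
proof -
  define bf where "bf u v = (\<Sum>c<p. \<Sum>e<p. u c * S $$ (c, e) * v e)" for u v :: "nat \<Rightarrow> real"
  have Sc[simp]: "S \<in> carrier_mat p p" and St: "transpose_mat S = S"
    and Sp: "\<And>v. v \<in> carrier_vec p \<Longrightarrow> v \<noteq> 0\<^sub>v p \<Longrightarrow> scalar_prod v (S *\<^sub>v v) > 0"
    using S by (auto simp: pos_def_mat_def)
  have sym: "S $$ (c, e) = S $$ (e, c)" if "c < p" "e < p" for c e
    using that carrier_matD[OF Sc] by (subst (1) St[symmetric]) simp
  have bf_sym: "bf u v = bf v u" for u v
    unfolding bf_def by (subst sum.swap) (auto intro!: sum.cong simp: sym)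
  have bf_lin: "bf u (\<lambda>c. (v c - (\<Sum>a<m. t a * w a c)) / r) = (bf u v - (\<Sum>a<m. t a * bf u (w a))) / r"
    for u v t r and w :: "nat \<Rightarrow> nat \<Rightarrow> real" and m :: nat
  proof -
    have "(\<Sum>a<m. t a * bf u (w a)) = (\<Sum>a<m. \<Sum>c<p. \<Sum>e<p. t a * (u c * S $$ (c, e) * w a e))"
      by (simp only: bf_def sum_distrib_left)
    also have "\<dots> = (\<Sum>c<p. \<Sum>a<m. \<Sum>e<p. t a * (u c * S $$ (c, e) * w a e))"
      by (rule sum.swap)
    also have "\<dots> = (\<Sum>c<p. \<Sum>e<p. \<Sum>a<m. t a * (u c * S $$ (c, e) * w a e))"
      by (intro sum.cong refl sum.swap)
    finally have "(\<Sum>a<m. t a * bf u (w a)) = \<dots>" .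
    then show ?thesis
      unfolding bf_def
      by (simp add: sum_divide_distrib sum_subtractf[symmetric] diff_divide_distrib[symmetric]
        algebra_simps sum_distrib_left)
  qed
  have bf_pos: "bf u u > 0" if "c < p" "u c \<noteq> 0" for u c
  proof -
    have "Matrix.vec p u \<noteq> 0\<^sub>v p" using that by (metis index_vec index_zero_vec(1))
    from Sp[OF _ this] have "0 < (\<Sum>c<p. u c * (\<Sum>e<p. S $$ (c, e) * u e))"
      using carrier_matD[OF Sc] by (simp add: scalar_prod_def lessThan_atLeast0)
    then show ?thesis by (simp add: bf_def sum_distrib_left mult.assoc)
  qed
  have "\<exists>B. (\<forall>a<m. B a a > 0) \<and> (\<forall>a<m. \<forall>c<p. B a c \<noteq> 0 \<longrightarrow> c \<le> a \<and> \<beta> c = \<beta> a) \<and>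
    (\<forall>a<m. \<forall>b<m. bf (B a) (B b) = (if a = b then 1 else 0 :: real))" if "m \<le> p" for m
    using that
  proof (induction m)
    case (Suc m)
    obtain B where pos: "\<And>a. a < m \<Longrightarrow> B a a > 0"
      and supp: "\<And>a c. a < m \<Longrightarrow> c < p \<Longrightarrow> B a c \<noteq> 0 \<Longrightarrow> c \<le> a \<and> \<beta> c = \<beta> a"
      and orth: "\<And>a b. a < m \<Longrightarrow> b < m \<Longrightarrow> bf (B a) (B b) = (if a = b then 1 else 0)"
      using Suc.IH[OF Suc_leD[OF Suc.prems]] by blast
    have m: "m < p" using Suc.prems by simp
    define e where "e c = (if c = m then 1 else 0 :: real)" for c
    \<comment> \<open>The division by 1 here and the empty sum in \<open>w'\<close> give both
      vectors the shape required by \<open>bf_lin\<close>.\<close>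
    define w where "w c = (e c - (\<Sum>a<m. bf (B a) e * B a c)) / 1" for c
    define r where "r = sqrt (bf w w)"
    define w' where "w' c = (w c - (\<Sum>a<(0::nat). 0 * w c)) / r" for c
    \<comment> \<open>Earlier rows end before column \<open>m\<close>, so \<open>w\<close> keeps the
      coefficient 1 there. This makes \<open>w\<close> nonzero and the new diagonal entry
      positive.\<close>
    have "B a m = 0" if "a < m" for a using supp[OF that m] that by force
    then have wm: "w m = 1" by (simp add: w_def e_def)
    then have "bf w w > 0" using bf_pos[of m w] m by simp
    then have r: "r > 0" "r * r = bf w w" by (auto simp: r_def)
    have bfe: "bf (B a) e = (\<Sum>c<p. B a c * S $$ (c, m))" for a
      using m by (simp add: bf_def e_def if_distrib cong: if_cong)
    have w_supp: "c \<le> m \<and> \<beta> c = \<beta> m" if "c < p" "w c \<noteq> 0" for c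
    proof (cases "c = m")
      case False
      then have "(\<Sum>a<m. bf (B a) e * B a c) \<noteq> 0" using that by (simp add: w_def e_def)
      then obtain a where "a \<in> {..<m}" "bf (B a) e * B a c \<noteq> 0"
        by (rule sum.not_neutral_contains_not_neutral)
      then have a: "a < m" "bf (B a) e \<noteq> 0" "B a c \<noteq> 0" by auto
      \<comment> \<open>A nonzero coefficient of row \<open>a\<close> requires a column where row
        \<open>a\<close> and column \<open>m\<close> of \<open>S\<close> are both nonzero. This puts
        \<open>a\<close> and \<open>m\<close> into one class, and with them
        \<open>c\<close>.\<close>
      obtain c' where "c' \<in> {..<p}" "B a c' * S $$ (c', m) \<noteq> 0"
        using a(2) unfolding bfe by (rule sum.not_neutral_contains_not_neutral)
      then have c': "c' < p" "B a c' \<noteq> 0" "S $$ (c', m) \<noteq> 0" by auto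
      then show ?thesis
        using supp[OF a(1) c'(1,2)] supp[OF a(1) that(1) a(3)] zero[OF c'(1) m] a(1) by force
    qed simp
    have Bw: "bf (B b) w = 0" if "b < m" for b
      unfolding w_def bf_lin using that
      by (simp add: orth if_distrib[of "\<lambda>x. _ * x"] cong: if_cong)
    have bfw': "bf u w' = bf u w / r" for u
      unfolding w'_def bf_lin by simp
    have w'1: "bf w' w' = 1"
      using r(1) by (simp add: bfw' bf_sym[of w' w] r(2)[symmetric])
    have w'2: "bf (B b) w' = 0" if "b < m" for b
      by (simp add: bfw' Bw that)
    have w'3: "bf w' (B b) = 0" if "b < m" for b
      using w'2[OF that] by (subst bf_sym)
    have w'4: "w' m > 0" using r(1) by (simp add: w'_def wm)
    have w'5: "c \<le> m \<and> \<beta> c = \<beta> m" if "c < p" "w' c \<noteq> 0" for c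
    proof -
      have "w c \<noteq> 0" using that(2) by (auto simp: w'_def)
      then show ?thesis by (rule w_supp[OF that(1)])
    qed
    let ?B = "B(m := w')"
    have "?B a a > 0" if "a < Suc m" for a
      using that pos w'4 by (cases "a = m") simp_all
    moreover have "c \<le> a \<and> \<beta> c = \<beta> a" if "a < Suc m" "c < p" "?B a c \<noteq> 0" for a c
    proof (cases "a = m")
      case True
      then show ?thesis using w'5[of c] that by simp
    next
      case False
      then show ?thesis using supp[of a c] that by simp
    qed
    moreover have "bf (?B a) (?B b) = (if a = b then 1 else 0)" if "a < Suc m" "b < Suc m" for a b
      using that orth[of a b] w'1 w'2[of a] w'3[of b] by (cases "a = m"; cases "b = m") simp_all
    ultimately show ?case by blast
  qed simp
  from this[of p] show ?thesis by (auto simp: bf_def)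
qed

text \<open>Centring removes the shift, and the linear part acts on the scatter matrix by
  congruence, hence the square of its determinant.\<close>

lemma scatter_det_affine:
  fixes A :: "nat \<Rightarrow> nat \<Rightarrow> real"
  assumes y: "\<And>a i. a < r \<Longrightarrow> i < n \<Longrightarrow> y (s + a) i = (\<Sum>c<r. A a c * (x i c - \<mu> c))" and "n > 0"
  shows "scatter_det n s r y =
    (Determinant.det (Matrix.mat r r (\<lambda>(a, c). A a c)))\<^sup>2 * Determinant.det (scatter_mat n r x)"
proof -
  define Lm where "Lm = Matrix.mat r r (\<lambda>(a, c). A a c)"
  define z where "z i c = x i c - sample_mean n x c" for i c
  have Sx: "scatter_mat n r x \<in> carrier_mat r r" by (simp add: scatter_mat_def)
  have Lm: "Lm \<in> carrier_mat r r" by (simp add: Lm_def)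
  have cent: "y (s + a) i - sample_mean n (\<lambda>i a. y (s + a) i) a = (\<Sum>c<r. A a c * z i c)"
    if "a < r" "i < n" for a i
  proof -
    have "sample_mean n (\<lambda>i a. y (s + a) i) a = (\<Sum>i<n. \<Sum>c<r. A a c * (x i c - \<mu> c)) / n"
      using that by (simp add: sample_mean_def y)
    also have "\<dots> = (\<Sum>c<r. A a c * ((\<Sum>i<n. x i c) - n * \<mu> c)) / n"
      by (subst sum.swap) (simp add: sum_subtractf sum_distrib_left[symmetric])
    also have "\<dots> = (\<Sum>c<r. A a c * ((\<Sum>i<n. x i c) - n * \<mu> c) / n)"
      by (rule sum_divide_distrib)
    also have "\<dots> = (\<Sum>c<r. A a c * (sample_mean n x c - \<mu> c))"
      using \<open>n > 0\<close> by (intro sum.cong refl) (simp add: sample_mean_def field_simps)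
    finally have mean: "sample_mean n (\<lambda>i a. y (s + a) i) a = \<dots>" .
    show ?thesis
    proof -
      have "y (s + a) i - sample_mean n (\<lambda>i a. y (s + a) i) a =
          (\<Sum>c<r. A a c * (x i c - \<mu> c) - A a c * (sample_mean n x c - \<mu> c))"
        using that by (simp only: y mean sum_subtractf)
      also have "\<dots> = (\<Sum>c<r. A a c * z i c)"
        by (intro sum.cong refl) (simp add: z_def algebra_simps)
      finally show ?thesis .
    qed
  qed
  have "scatter_mat n r (\<lambda>i a. y (s + a) i) = Lm * scatter_mat n r x * transpose_mat Lm"
  proof (rule eq_matI)
    fix a b assume "a < dim_row (Lm * scatter_mat n r x * transpose_mat Lm)"
      "b < dim_col (Lm * scatter_mat n r x * transpose_mat Lm)"
    then have ab: "a < r" "b < r" using Lm by auto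
    have "scatter_mat n r (\<lambda>i a. y (s + a) i) $$ (a, b) =
        (\<Sum>i<n. (\<Sum>c<r. A a c * z i c) * (\<Sum>e<r. A b e * z i e))"
      using ab by (simp add: scatter_mat_def cent)
    also have "\<dots> = (\<Sum>i<n. \<Sum>e<r. \<Sum>c<r. A a c * z i c * (A b e * z i e))"
      by (intro sum.cong refl) (subst sum_product, rule sum.swap)
    also have "\<dots> = (\<Sum>e<r. \<Sum>c<r. \<Sum>i<n. A a c * z i c * (A b e * z i e))"
      by (rule trans[OF sum.swap], rule sum.cong[OF refl], rule sum.swap)
    also have "\<dots> = (\<Sum>e<r. (\<Sum>c<r. A a c * (\<Sum>i<n. z i c * z i e)) * A b e)"
      by (simp add: sum_distrib_left sum_distrib_right algebra_simps)
    also have "\<dots> = (Lm * scatter_mat n r x * transpose_mat Lm) $$ (a, b)"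
      using ab Lm Sx by (simp add: scalar_prod_def lessThan_atLeast0 Lm_def scatter_mat_def z_def)
    finally show "scatter_mat n r (\<lambda>i a. y (s + a) i) $$ (a, b) =
        (Lm * scatter_mat n r x * transpose_mat Lm) $$ (a, b)" .
  qed (use Lm in \<open>auto simp: scatter_mat_def\<close>)
  then show ?thesis
    using Lm Sx by (simp add: scatter_det_def det_mult[of _ r] det_transpose[of _ r] power2_eq_square
      Lm_def[symmetric])
qed

lemma prod_lessThan_add: "(\<Prod>a<m+r. g a) = (\<Prod>a<m. g a) * (\<Prod>b<r. g (m + b :: nat) :: 'b :: comm_monoid_mult)"
  by (induction r) (simp_all add: mult.assoc)

lemma prod_offset: "(\<Prod>a<offset d k. g a) = (\<Prod>j<k. \<Prod>b<d j. g (offset d j + b) :: 'b :: comm_monoid_mult)"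
  by (induction k) (simp_all add: offset_Suc prod_lessThan_add)

definition sample_ratio :: "nat \<Rightarrow> nat \<Rightarrow> (nat \<Rightarrow> nat) \<Rightarrow> (nat \<Rightarrow> nat \<Rightarrow> real) \<Rightarrow> real" where
  "sample_ratio n k d x = Determinant.det (scatter_mat n (total_dim k d) x) /
     (\<Prod>j<k. Determinant.det (scatter_mat n (d j) (sub_obs d j x)))"

text \<open>A triangular transformation that respects the blocks multiplies the full determinant and
  the product of the block determinants by the same number, the squared product of its diagonal.
  Positive diagonal entries allow it to be cancelled.\<close>

lemma det_ratio_affine:
  assumes p: "p = offset d k" and "n > 0"
    and pos: "\<And>a. a < p \<Longrightarrow> B a a > 0"
    and supp: "\<And>a c. a < p \<Longrightarrow> c < p \<Longrightarrow> B a c \<noteq> 0 \<Longrightarrow> c \<le> a \<and> block_index d c = block_index d a"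
    and y: "\<And>a i. a < p \<Longrightarrow> i < n \<Longrightarrow> y a i = (\<Sum>c<p. B a c * (x i c - \<mu> c))"
  shows "det_ratio n k d p y = sample_ratio n k d x"
proof -
  have le: "offset d j + d j \<le> p" if "j < k" for j
    using offset_mono[of "Suc j" k d] that by (simp add: offset_Suc p)
  have diag: "Determinant.det (Matrix.mat r r (\<lambda>(a, c). B (s + a) (s + c))) = (\<Prod>a<r. B (s + a) (s + a))"
    if "s + r \<le> p" for s r
  proof -
    have "B (s + a) (s + c) = 0" if "a < c" "c < r" for a c
      using supp[of "s + a" "s + c"] that \<open>s + r \<le> p\<close> by force
    then show ?thesis
      by (subst det_lower_triangular[where n=r]) (auto simp: prod_list_diag_prod lessThan_atLeast0)
  qed
  have full: "scatter_det n 0 p y = (\<Prod>a<p. B a a)\<^sup>2 * Determinant.det (scatter_mat n p x)"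
    using scatter_det_affine[of p n y 0 B x \<mu>] y \<open>n > 0\<close> diag[of 0 p] by simp
  have blk: "scatter_det n (offset d j) (d j) y =
      (\<Prod>a<d j. B (offset d j + a) (offset d j + a))\<^sup>2 * Determinant.det (scatter_mat n (d j) (sub_obs d j x))"
    if j: "j < k" for j
  proof -
    let ?s = "offset d j"
    have "y (?s + a) i = (\<Sum>c<d j. B (?s + a) (?s + c) * (sub_obs d j x i c - \<mu> (?s + c)))"
      if "a < d j" "i < n" for a i
    proof -
      have bi: "block_index d (?s + a) = j" if "a < d j" for a
        using that by (intro block_index_eqI) auto
      \<comment> \<open>Block \<open>j\<close> is transformed by itself: its rows have no entries in
        columns of other blocks.\<close>
      have "B (?s + a) c = 0" if "c < p" "c \<notin> {?s..<?s + d j}" for c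
        using block_index[of c d k] that supp[of "?s + a" c] bi[of a] \<open>a < d j\<close> le[OF j] p by force
      then have "(\<Sum>c<p. B (?s + a) c * (x i c - \<mu> c)) = (\<Sum>c\<in>{?s..<?s + d j}. B (?s + a) c * (x i c - \<mu> c))"
        using le[OF j] by (intro sum.mono_neutral_right) auto
      also have "\<dots> = (\<Sum>c<d j. B (?s + a) (?s + c) * (x i (?s + c) - \<mu> (?s + c)))"
        using sum.shift_bounds_nat_ivl[of "\<lambda>c. B (?s + a) c * (x i c - \<mu> c)" 0 ?s "d j"]
        by (simp add: lessThan_atLeast0 add.commute)
      finally show ?thesis using y[of "?s + a" i] that le[OF j] by (simp add: sub_obs_def)
    qed
    then show ?thesis
      using diag[OF le[OF j]] \<open>n > 0\<close>
        scatter_det_affine[of "d j" n y ?s "\<lambda>a c. B (?s + a) (?s + c)" "sub_obs d j x" "\<lambda>c. \<mu> (?s + c)"]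
      by simp
  qed
  have le_diff: "d j \<le> p - offset d j" if "j < k" for j
    using le[OF that] by simp
  have "det_ratio n k d p y = scatter_det n 0 p y / (\<Prod>j<k. scatter_det n (offset d j) (d j) y)"
    unfolding det_ratio_def using le_diff by (intro arg_cong2[where f="(/)"] prod.cong refl) (auto simp: min_def)
  also have "\<dots> = (\<Prod>a<p. B a a)\<^sup>2 * Determinant.det (scatter_mat n p x) /
      ((\<Prod>a<p. B a a)\<^sup>2 * (\<Prod>j<k. Determinant.det (scatter_mat n (d j) (sub_obs d j x))))"
  proof -
    have "(\<Prod>j<k. \<Prod>a<d j. B (offset d j + a) (offset d j + a)) = (\<Prod>a<p. B a a)"
      by (simp add: p prod_offset)
    then show ?thesis
      by (simp add: full blk prod.distrib prod_power_distrib[symmetric])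
  qed
  also have "\<dots> = sample_ratio n k d x"
  proof -
    have "(\<Prod>a<p. B a a) > 0" using pos by (intro prod_pos) auto
    from zero_less_power[OF this, of 2] have ne: "(\<Prod>a<p. B a a)\<^sup>2 \<noteq> 0"
      by (rule less_imp_neq[THEN not_sym])
    then show ?thesis by (simp only: sample_ratio_def total_dim_offset p[symmetric] mult_divide_mult_cancel_left[OF ne])
  qed
  finally show ?thesis .
qed

section \<open>Law of the whitened sample\<close>

lemma indep_vars_PiM_components:
  assumes M: "\<And>i. i \<in> I \<Longrightarrow> prob_space (M i)"
  shows "prob_space.indep_vars (PiM I M) M (\<lambda>i \<omega>. \<omega> i) I"
proof -
  interpret P: prob_space "PiM I M" by (rule prob_space_PiM) (rule M)
  show ?thesis
  proof (cases "I = {}")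
    case True
    then show ?thesis unfolding P.indep_vars_def P.indep_sets_def by auto
  next
    case False
    have "distr (PiM I M) (PiM I M) (\<lambda>\<omega>. \<lambda>i\<in>I. \<omega> i) = distr (PiM I M) (PiM I M) (\<lambda>\<omega>. \<omega>)"
      by (rule distr_cong) (simp_all add: space_PiM PiE_def extensional_restrict)
    also have "\<dots> = PiM I M" by simp
    also have "\<dots> = (\<Pi>\<^sub>M i\<in>I. distr (PiM I M) (M i) (\<lambda>\<omega>. \<omega> i))"
      by (rule PiM_cong[OF refl]) (simp add: distr_PiM_component M)
    finally show ?thesis
      by (intro P.indep_vars_iff_distr_eq_PiM'[THEN iffD2, OF False measurable_component_singleton])
  qed
qed

text \<open>Independence of the sample concerns the rows, while the rotations act on columns. Both
  arrangements are images of one array of independent normals indexed by pairs, and swapping the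
  pair preserves its law.\<close>

lemma nn_integral_gauss_transpose:
  assumes F[measurable]: "F \<in> borel_measurable (gauss_columns n p)" and pos: "n > 0" "p > 0"
  shows "(\<integral>\<^sup>+z. F (\<lambda>a\<in>{..<p}. \<lambda>i\<in>{..<n}. z i a) \<partial>gauss_columns p n) = (\<integral>\<^sup>+y. F y \<partial>gauss_columns n p)"
proof -
  let ?N = "std_normal_distribution"
  have N: "prob_space ?N" by (rule prob_space_normal_density) simp
  define flat where "flat = (\<lambda>(n :: nat) (p :: nat). \<Pi>\<^sub>M x\<in>{..<p}\<times>{..<n}. ?N)"
  have flat: "distr (flat n p) (gauss_columns n p) (\<lambda>\<omega>. \<lambda>a\<in>{..<p}. \<lambda>i\<in>{..<n}. \<omega> (a, i)) = gauss_columns n p"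
    if "n > 0" "p > 0" for n p :: nat
  proof -
    interpret F: prob_space "flat n p" unfolding flat_def by (rule prob_space_PiM) (rule N)
    have ind: "F.indep_vars (\<lambda>_. ?N) (\<lambda>x \<omega>. \<omega> x) ({..<p}\<times>{..<n})"
      unfolding flat_def by (rule indep_vars_PiM_components) (rule N)
    let ?K = "\<lambda>a. {a} \<times> {..<n}"
    have "F.indep_vars (\<lambda>a. PiM (?K a) (\<lambda>_. ?N)) (\<lambda>a \<omega>. restrict (\<lambda>x. \<omega> x) (?K a)) {..<p}"
      by (rule F.indep_vars_restrict[OF ind]) (auto simp: disjoint_family_on_def)
    then have "F.indep_vars (\<lambda>a. gauss n) (\<lambda>a \<omega>. (\<lambda>\<eta>. \<lambda>i\<in>{..<n}. \<eta> (a, i)) (restrict (\<lambda>x. \<omega> x) (?K a))) {..<p}"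
      by (rule F.indep_vars_compose2) measurable
    moreover have "(\<lambda>\<eta>. \<lambda>i\<in>{..<n}. \<eta> (a, i)) (restrict (\<lambda>x. \<omega> x) (?K a)) = (\<lambda>i\<in>{..<n}. \<omega> (a, i))"
      for a and \<omega> :: "nat \<times> nat \<Rightarrow> real"
      by (rule restrict_ext) simp
    ultimately have ind': "F.indep_vars (\<lambda>a. gauss n) (\<lambda>a \<omega>. \<lambda>i\<in>{..<n}. \<omega> (a, i)) {..<p}"
      by (simp only:)
    have slice_meas: "(\<lambda>\<omega>. \<lambda>i\<in>{..<n}. \<omega> (a, i)) \<in> measurable (flat n p) (gauss n)" if "a \<in> {..<p}" for a
      unfolding flat_def using that by (intro measurable_restrict measurable_component_singleton) simp
    have slice: "distr (flat n p) (gauss n) (\<lambda>\<omega>. \<lambda>i\<in>{..<n}. \<omega> (a, i)) = gauss n" if "a \<in> {..<p}" for a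
      unfolding flat_def
      by (rule distr_PiM_reindex[where f="\<lambda>i. (a, i)" and M="\<lambda>_. ?N", OF N])
        (use that in \<open>simp_all add: inj_on_def\<close>)
    have "{..<p} \<noteq> {}" using that by auto
    from F.indep_vars_iff_distr_eq_PiM'[THEN iffD1, OF this slice_meas ind']
    have "distr (flat n p) (gauss_columns n p) (\<lambda>\<omega>. \<lambda>a\<in>{..<p}. \<lambda>i\<in>{..<n}. \<omega> (a, i)) =
        (\<Pi>\<^sub>M a\<in>{..<p}. distr (flat n p) (gauss n) (\<lambda>\<omega>. \<lambda>i\<in>{..<n}. \<omega> (a, i)))" .
    moreover have "(\<Pi>\<^sub>M a\<in>{..<p}. distr (flat n p) (gauss n) (\<lambda>\<omega>. \<lambda>i\<in>{..<n}. \<omega> (a, i))) = gauss_columns n p"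
      by (rule PiM_cong[OF refl slice])
    ultimately show ?thesis by (simp only:)
  qed
  have swap: "distr (flat n p) (flat p n) (\<lambda>\<omega>. \<lambda>x\<in>{..<n}\<times>{..<p}. \<omega> (snd x, fst x)) = flat p n"
    unfolding flat_def using N
    by (intro distr_PiM_reindex[where f="\<lambda>x. (snd x, fst x)" and M="\<lambda>_. ?N"]) (auto simp: inj_on_def)
  have comp_meas: "(\<lambda>\<omega>. \<omega> x) \<in> measurable (flat n p) ?N" if "x \<in> {..<p}\<times>{..<n}" for x and n p :: nat
    unfolding flat_def using that by (rule measurable_component_singleton)
  have m1: "(\<lambda>\<omega>. \<lambda>a\<in>{..<p}. \<lambda>i\<in>{..<n}. \<omega> (a, i)) \<in> measurable (flat n p) (gauss_columns n p)" for n p :: nat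
    by (intro measurable_restrict comp_meas) simp
  have m2: "(\<lambda>\<omega>. \<lambda>x\<in>{..<n}\<times>{..<p}. \<omega> (snd x, fst x)) \<in> measurable (flat n p) (flat p n)"
    by (subst (2) flat_def, intro measurable_restrict comp_meas) auto
  have m3: "(\<lambda>z. \<lambda>a\<in>{..<p}. \<lambda>i\<in>{..<n}. z i a) \<in> measurable (gauss_columns p n) (gauss_columns n p)"
  proof (intro measurable_restrict)
    fix a i assume "a \<in> {..<p}" "i \<in> {..<n}"
    then show "(\<lambda>z. z i a) \<in> measurable (gauss_columns p n) ?N"
      using measurable_component_columns[of i a p n] by simp
  qed
  have "(\<integral>\<^sup>+z. F (\<lambda>a\<in>{..<p}. \<lambda>i\<in>{..<n}. z i a) \<partial>gauss_columns p n) =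
     (\<integral>\<^sup>+\<omega>. F (\<lambda>a\<in>{..<p}. \<lambda>i\<in>{..<n}. (\<lambda>i\<in>{..<n}. \<lambda>a\<in>{..<p}. \<omega> (i, a)) i a) \<partial>flat p n)"
    by (subst flat[OF pos(2,1), symmetric])
      (rule nn_integral_distr[OF m1], unfold measurable_distr_eq1, rule measurable_compose[OF m3 F])
  also have "\<dots> = (\<integral>\<^sup>+\<omega>. F (\<lambda>a\<in>{..<p}. \<lambda>i\<in>{..<n}. (\<lambda>i\<in>{..<n}. \<lambda>a\<in>{..<p}.
      (\<lambda>x\<in>{..<n}\<times>{..<p}. \<omega> (snd x, fst x)) (i, a)) i a) \<partial>flat n p)"
    by (subst swap[symmetric])
      (rule nn_integral_distr[OF m2], unfold measurable_distr_eq1, rule measurable_compose[OF measurable_compose[OF m1 m3] F])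
  also have "\<dots> = (\<integral>\<^sup>+\<omega>. F (\<lambda>a\<in>{..<p}. \<lambda>i\<in>{..<n}. \<omega> (a, i)) \<partial>flat n p)"
    by (intro nn_integral_cong arg_cong[where f=F] restrict_ext) simp
  also have "\<dots> = (\<integral>\<^sup>+y. F y \<partial>gauss_columns n p)"
    by (subst flat[OF pos, symmetric]) (rule nn_integral_distr[OF m1, symmetric], unfold measurable_distr_eq1, rule F)
  finally show ?thesis .
qed

definition lin_map :: "nat \<Rightarrow> (nat \<Rightarrow> nat \<Rightarrow> real) \<Rightarrow> (nat \<Rightarrow> real) \<Rightarrow> nat \<Rightarrow> real" where
  "lin_map p B x = (\<lambda>a\<in>{..<p}. \<Sum>c<p. B a c * x c)"

lemma lin_map_measurable [measurable]:
  assumes [measurable]: "\<And>c. (\<lambda>z. x z c) \<in> borel_measurable M"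
  shows "(\<lambda>z. lin_map p B (x z)) \<in> measurable M (vec_space p)"
  unfolding lin_map_def by measurable

lemma lin_map_vadd: "lin_map p B (vadd p x y) = vadd p (lin_map p B x) (lin_map p B y)"
  by (auto simp: lin_map_def vadd_def sum.distrib[symmetric] algebra_simps intro!: sum.cong)

text \<open>From \<open>B S B^T = 1\<close> follows \<open>S^-1 = B^T B\<close>, so the quadratic
  form in the density is the squared norm of the whitened vector. The constant is left unspecified;
  the right inverse in the second part is \<open>S B^T\<close>.\<close>

lemma mvn_density_whitened:
  assumes S: "pos_def_mat p S" and m: "m \<in> carrier_vec p"
    and B: "\<And>a b. a < p \<Longrightarrow> b < p \<Longrightarrow>
      (\<Sum>c<p. \<Sum>e<p. B a c * S $$ (c, e) * B b e) = (if a = b then 1 else 0)"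
  shows "\<exists>C\<ge>0. \<forall>x. mvn_density p m S x = C * gauss_density p (lin_map p B (\<lambda>c. x c - m $ c))"
    and "\<exists>B'. \<forall>y. y \<in> extensional {..<p} \<longrightarrow> lin_map p B (lin_map p B' y) = y"
proof -
  define Bm where "Bm = Matrix.mat p p (\<lambda>(a, c). B a c)"
  have Bm[simp]: "Bm \<in> carrier_mat p p" by (simp add: Bm_def)
  have Sc[simp]: "S \<in> carrier_mat p p" using S by (simp add: pos_def_mat_def)
  have BSB: "Bm * S * transpose_mat Bm = 1\<^sub>m p"
  proof (rule eq_matI)
    fix a b assume "a < dim_row (1\<^sub>m p :: real mat)" "b < dim_col (1\<^sub>m p :: real mat)"
    then have ab: "a < p" "b < p" by auto
    have "(Bm * S * transpose_mat Bm) $$ (a, b) = (\<Sum>e<p. (\<Sum>c<p. B a c * S $$ (c, e)) * B b e)"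
      using ab carrier_matD[OF Sc] by (simp add: scalar_prod_def Bm_def lessThan_atLeast0)
    also have "\<dots> = (\<Sum>c<p. \<Sum>e<p. B a c * S $$ (c, e) * B b e)"
      by (simp only: sum_distrib_right) (rule sum.swap)
    finally show "(Bm * S * transpose_mat Bm) $$ (a, b) = 1\<^sub>m p $$ (a, b)"
      using ab by (simp add: B)
  qed (auto simp: Bm_def)
  define S' where "S' = S * transpose_mat Bm"
  have Bt[simp]: "transpose_mat Bm \<in> carrier_mat p p" using Bm by (simp only: transpose_carrier_mat)
  have S'[simp]: "S' \<in> carrier_mat p p" unfolding S'_def by (rule mult_carrier_mat[OF Sc Bt])
  have BS': "Bm * S' = 1\<^sub>m p"
    using BSB by (simp add: S'_def assoc_mult_mat[of _ p p _ p _ p])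
  then have S'B: "S' * Bm = 1\<^sub>m p" by (rule mat_mult_left_right_inverse[OF Bm S'])
  have BtB: "transpose_mat Bm * Bm \<in> carrier_mat p p" by (rule mult_carrier_mat[OF Bt Bm])
  have SBB: "S * (transpose_mat Bm * Bm) = 1\<^sub>m p"
    using S'B by (simp add: S'_def assoc_mult_mat[of _ p p _ p _ p])
  obtain Si where Si: "mat_inverse S = Some Si"
  proof (cases "mat_inverse S")
    case None
    have "S \<in> Units (ring_mat TYPE(real) p ())"
      unfolding Units_def ring_mat_def using SBB mat_mult_left_right_inverse[OF Sc BtB SBB] BtB by auto
    then show ?thesis using mat_inverse(1)[OF Sc None, of "()"] by simp
  qed
  have Si': "Si * S = 1\<^sub>m p" "Si \<in> carrier_mat p p" using mat_inverse(2)[OF Sc Si] by auto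
  have "Si = Si * (S * (transpose_mat Bm * Bm))" using Si' SBB by simp
  also have "\<dots> = (Si * S) * (transpose_mat Bm * Bm)"
    by (rule assoc_mult_mat[symmetric, OF Si'(2) Sc BtB])
  also have "\<dots> = transpose_mat Bm * Bm" using Si'(1) left_mult_one_mat[OF BtB] by simp
  finally have inv: "the (mat_inverse S) = transpose_mat Bm * Bm" by (simp add: Si)
  have quad: "scalar_prod y (transpose_mat Bm * Bm *\<^sub>v y) = ip p (lin_map p B (\<lambda>c. y $ c)) (lin_map p B (\<lambda>c. y $ c))"
    if y: "y \<in> carrier_vec p" for y
  proof -
    have By: "(Bm *\<^sub>v y) $ a = (\<Sum>c<p. B a c * y $ c)" if "a < p" for a
      using that y by (simp add: Bm_def scalar_prod_def lessThan_atLeast0)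
    have "transpose_mat Bm * Bm *\<^sub>v y = transpose_mat Bm *\<^sub>v (Bm *\<^sub>v y)"
      using y by (intro assoc_mult_mat_vec[of _ p p _ p]) auto
    also have "scalar_prod y \<dots> = (\<Sum>e<p. y $ e * (\<Sum>a<p. B a e * (Bm *\<^sub>v y) $ a))"
      using y by (simp add: Bm_def scalar_prod_def lessThan_atLeast0)
    also have "\<dots> = (\<Sum>a<p. \<Sum>e<p. y $ e * (B a e * (Bm *\<^sub>v y) $ a))"
      by (simp only: sum_distrib_left) (rule sum.swap)
    also have "\<dots> = (\<Sum>a<p. (\<Sum>e<p. B a e * y $ e) * (Bm *\<^sub>v y) $ a)"
      by (intro sum.cong refl) (simp add: sum_distrib_left mult_ac)
    also have "\<dots> = ip p (lin_map p B (\<lambda>c. y $ c)) (lin_map p B (\<lambda>c. y $ c))"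
      by (simp add: ip_def lin_map_def By)
    finally show ?thesis .
  qed
  define C where "C = sqrt (2 * pi) ^ p / sqrt ((2 * pi) ^ p * Determinant.det S)"
  have "mvn_density p m S x = C * gauss_density p (lin_map p B (\<lambda>c. x c - m $ c))" for x
  proof -
    define y where "y = Matrix.vec p x - m"
    have y: "y \<in> carrier_vec p" using m by (simp add: y_def)
    have "lin_map p B (\<lambda>c. y $ c) = lin_map p B (\<lambda>c. x c - m $ c)"
      using m by (auto simp: lin_map_def y_def fun_eq_iff intro!: sum.cong)
    then show ?thesis
      by (simp add: mvn_density_def Let_def y_def[symmetric] inv quad[OF y] gauss_density_ip C_def)
  qed
  \<comment> \<open>The sign matters for \<open>C \<ge> 0\<close>, as \<open>sqrt\<close> of a
    negative number is negative. It comes from \<open>det S * (det B)^2 = 1\<close>.\<close>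
  moreover have "Determinant.det S \<ge> 0"
  proof -
    have "Determinant.det S * (Determinant.det Bm)\<^sup>2 = 1"
      using arg_cong[OF SBB, of Determinant.det]
      by (simp add: det_mult[OF Sc BtB] det_mult[OF Bt Bm] det_transpose[OF Bm] power2_eq_square)
    then show ?thesis by (metis less_eq_real_def linorder_not_le mult_nonpos_nonneg not_one_le_zero zero_le_power2)
  qed
  ultimately show "\<exists>C\<ge>0. \<forall>x. mvn_density p m S x = C * gauss_density p (lin_map p B (\<lambda>c. x c - m $ c))"
    by (intro exI[of _ C]) (auto simp: C_def)
  have "lin_map p B (lin_map p (\<lambda>a c. S' $$ (a, c)) y) = y" if y: "y \<in> extensional {..<p}" for y
  proof -
    define v where "v = Matrix.vec p y"
    have v: "v \<in> carrier_vec p" by (simp add: v_def)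
    have "Bm *\<^sub>v (S' *\<^sub>v v) = v"
      using v BS' by (simp add: assoc_mult_mat_vec[symmetric, of _ p p _ p])
    then have "(Bm *\<^sub>v (S' *\<^sub>v v)) $ a = y a" if "a < p" for a using that by (simp add: v_def)
    moreover have "(Bm *\<^sub>v (S' *\<^sub>v v)) $ a = (\<Sum>c<p. B a c * (\<Sum>e<p. S' $$ (c, e) * y e))" if "a < p" for a
      using that carrier_matD[OF S'] by (simp add: Bm_def scalar_prod_def lessThan_atLeast0 v_def)
    ultimately show ?thesis
      using y by (auto simp: lin_map_def fun_eq_iff extensional_def)
  qed
  then show "\<exists>B'. \<forall>y. y \<in> extensional {..<p} \<longrightarrow> lin_map p B (lin_map p B' y) = y" by blast
qed

text \<open>Neither the normalising constant \<open>C\<close> nor the Jacobian factor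
  \<open>K\<close> is computed: the whitened law is \<open>C * K\<close> times the Gaussian measure,
  and both have total mass 1.\<close>

lemma distr_whitened:
  assumes "prob_space M" and S: "pos_def_mat p S" and m: "m \<in> carrier_vec p"
    and B: "\<And>a b. a < p \<Longrightarrow> b < p \<Longrightarrow>
      (\<Sum>c<p. \<Sum>e<p. B a c * S $$ (c, e) * B b e) = (if a = b then 1 else 0)"
    and X: "distributed M (vec_space p) X (\<lambda>x. ennreal (mvn_density p m S x))"
  shows "distr M (vec_space p) (\<lambda>\<omega>. lin_map p B (\<lambda>c. X \<omega> c - m $ c)) = gauss p"
proof -
  interpret M: prob_space M by fact
  let ?V = "vec_space p"
  obtain C where C: "C \<ge> 0" "\<And>x. mvn_density p m S x = C * gauss_density p (lin_map p B (\<lambda>c. x c - m $ c))"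
    using mvn_density_whitened(1)[OF S m B] by auto
  obtain B' where B': "\<And>y. y \<in> extensional {..<p} \<Longrightarrow> lin_map p B (lin_map p B' y) = y"
    using mvn_density_whitened(2)[OF S m B] by auto
  have Xm[measurable]: "X \<in> measurable M ?V" using X by (simp add: distributed_def)
  have Xc[measurable]: "(\<lambda>\<omega>. X \<omega> c) \<in> borel_measurable M" for c
    using measurable_compose[OF Xm measurable_component_vec] .
  define Z where "Z = (\<lambda>\<omega>. lin_map p B (\<lambda>c. X \<omega> c - m $ c))"
  have [measurable]: "Z \<in> measurable M ?V" unfolding Z_def by measurable
  define K where "K = (\<integral>\<^sup>+x. ennreal (gauss_density p (lin_map p B x)) \<partial>?V)"
  have main: "(\<integral>\<^sup>+\<omega>. h (Z \<omega>) \<partial>M) = ennreal C * K * (\<integral>\<^sup>+x. h x \<partial>gauss p)"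
    if h[measurable]: "h \<in> borel_measurable ?V" for h
  proof -
    let ?F = "\<lambda>u. ennreal C * ennreal (gauss_density p u) * h u"
    have "(\<integral>\<^sup>+\<omega>. h (Z \<omega>) \<partial>M) =
       (\<integral>\<^sup>+x. ennreal (mvn_density p m S x) * h (lin_map p B (\<lambda>c. x c - m $ c)) \<partial>?V)"
      unfolding Z_def by (rule distributed_nn_integral[OF X, symmetric]) measurable
    also have "\<dots> = (\<integral>\<^sup>+x. ?F (lin_map p B (vadd p x (\<lambda>c. - m $ c))) \<partial>?V)"
    proof (intro nn_integral_cong)
      fix x
      have "lin_map p B (vadd p x (\<lambda>c. - m $ c)) = lin_map p B (\<lambda>c. x c - m $ c)"
        by (auto simp: lin_map_def vadd_def fun_eq_iff intro!: sum.cong)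
      then show "ennreal (mvn_density p m S x) * h (lin_map p B (\<lambda>c. x c - m $ c)) =
          ?F (lin_map p B (vadd p x (\<lambda>c. - m $ c)))"
        using C by (simp add: ennreal_mult gauss_density_nonneg)
    qed
    also have "\<dots> = (\<integral>\<^sup>+x. ?F (lin_map p B x) \<partial>?V)"
      by (rule nn_integral_vec_translate) measurable
    also have "\<dots> = K * (\<integral>\<^sup>+x. ?F x \<partial>?V)"
      unfolding K_def
    proof (rule nn_integral_linear_change[where T'="lin_map p B'"])
      show "lin_map p B \<in> measurable ?V ?V" by measurable
    qed (auto simp: B' lin_map_vadd, auto simp: lin_map_def)
    also have "(\<integral>\<^sup>+x. ?F x \<partial>?V) = ennreal C * (\<integral>\<^sup>+x. h x \<partial>gauss p)"
      by (simp add: nn_integral_gauss mult.assoc nn_integral_cmult)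
    finally show ?thesis by (simp add: mult_ac)
  qed
  interpret G: prob_space "gauss p" by (rule prob_space_gauss)
  have CK: "ennreal C * K = 1"
    using main[of "\<lambda>_. 1"] M.emeasure_space_1 G.emeasure_space_1 by simp
  show ?thesis
    unfolding Z_def[symmetric]
  proof (rule measure_eqI)
    fix A assume "A \<in> sets (distr M ?V Z)"
    then have A[measurable]: "A \<in> sets ?V" by simp
    have "emeasure (distr M ?V Z) A = (\<integral>\<^sup>+x. indicator A x \<partial>distr M ?V Z)"
      by (subst nn_integral_indicator) auto
    also have "\<dots> = (\<integral>\<^sup>+\<omega>. indicator A (Z \<omega>) \<partial>M)"
      by (rule nn_integral_distr) auto
    also have "\<dots> = emeasure (gauss p) A"
      using main[of "indicator A"] by (simp add: CK A sets_gauss)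
    finally show "emeasure (distr M ?V Z) A = emeasure (gauss p) A" .
  qed (simp add: sets_gauss)
qed

text \<open>The null hypothesis enters here and only here: it lets the whitening matrix respect the
  blocks, so that the unknown mean and covariance drop out of the ratio.\<close>

lemma nn_integral_sample_ratio:
  assumes ns: "normal_sample M n (total_dim k d) m S X" and H0: "block_independence k d S"
    and dims: "0 < total_dim k d" "total_dim k d \<le> n"
    and h[measurable]: "h \<in> borel_measurable borel"
  shows "(\<integral>\<^sup>+\<omega>. h (sample_ratio n k d (\<lambda>i. X i \<omega>)) \<partial>M) =
    (\<integral>\<^sup>+y. h (\<Prod>b<total_dim k d. resid_ratio n d b (y b)) \<partial>gauss_columns n (total_dim k d))"
proof -
  define p where "p = total_dim k d"
  have p: "p = offset d k" by (simp add: p_def total_dim_offset)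
  have pn: "0 < p" "p \<le> n" "0 < n" using dims by (auto simp: p_def)
  interpret M: prob_space M using ns by (simp add: normal_sample_def)
  have S: "pos_def_mat p S" and m: "m \<in> carrier_vec p"
    and ind: "M.indep_vars (\<lambda>_. vec_space p) X {..<n}"
    and X: "\<And>i. i < n \<Longrightarrow> distributed M (vec_space p) (X i) (\<lambda>x. ennreal (mvn_density p m S x))"
    using ns by (auto simp: normal_sample_def p_def)
  have Sc: "S \<in> carrier_mat p p" and St: "transpose_mat S = S" using S by (auto simp: pos_def_mat_def)
  have upper: "S $$ (a, b) = 0" if "a < p" "b < p" "block_index d a < block_index d b" for a b
  proof -
    note ba = block_index[of a d k, folded p, OF that(1)] and bb = block_index[of b d k, folded p, OF that(2)]
    let ?j = "block_index d a" and ?l = "block_index d b"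
    have "block d S ?j ?l = 0\<^sub>m (d ?j) (d ?l)"
      using H0 that(3) bb(1) by (auto simp: block_independence_def)
    then have "block d S ?j ?l $$ (a - offset d ?j, b - offset d ?l) = 0"
      using ba bb by simp
    then show ?thesis using ba bb by (simp add: block_def)
  qed
  \<comment> \<open>\<open>block_independence\<close> speaks of the blocks above the diagonal;
    symmetry of \<open>S\<close> supplies the others.\<close>
  have zero: "S $$ (a, b) = 0" if ab: "a < p" "b < p" "block_index d a \<noteq> block_index d b" for a b
  proof (cases "block_index d a < block_index d b")
    case False
    then have "S $$ (b, a) = 0" using upper[of b a] ab by simp
    moreover have "S $$ (a, b) = transpose_mat S $$ (a, b)" by (simp add: St)
    ultimately show ?thesis using ab carrier_matD[OF Sc] by simp
  qed (use upper ab in blast)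
  obtain B where B: "\<And>a. a < p \<Longrightarrow> B a a > 0"
    "\<And>a c. a < p \<Longrightarrow> c < p \<Longrightarrow> B a c \<noteq> 0 \<Longrightarrow> c \<le> a \<and> block_index d c = block_index d a"
    "\<And>a b. a < p \<Longrightarrow> b < p \<Longrightarrow> (\<Sum>c<p. \<Sum>e<p. B a c * S $$ (c, e) * B b e) = (if a = b then 1 else 0)"
    using exists_whitening[of p S "block_index d", OF S zero] by blast
  define Z where "Z i \<omega> = lin_map p B (\<lambda>c. X i \<omega> c - m $ c)" for i \<omega>
  have Xm: "X i \<in> measurable M (vec_space p)" if "i < n" for i using X[OF that] by (simp add: distributed_def)
  have "M.indep_vars (\<lambda>_. vec_space p) (\<lambda>i \<omega>. (\<lambda>x. lin_map p B (\<lambda>c. x c - m $ c)) (X i \<omega>)) {..<n}"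
    by (rule M.indep_vars_compose2[OF ind]) measurable
  then have indZ: "M.indep_vars (\<lambda>_. vec_space p) Z {..<n}" by (simp add: Z_def[abs_def])
  have Zm: "Z i \<in> measurable M (vec_space p)" if "i \<in> {..<n}" for i
    using indZ that by (auto simp: M.indep_vars_def2)
  have "{..<n} \<noteq> {}" using pn(3) by (metis empty_iff lessThan_iff)
  from M.indep_vars_iff_distr_eq_PiM'[THEN iffD1, OF this Zm indZ]
  have "distr M (\<Pi>\<^sub>M i\<in>{..<n}. vec_space p) (\<lambda>\<omega>. \<lambda>i\<in>{..<n}. Z i \<omega>) =
      (\<Pi>\<^sub>M i\<in>{..<n}. distr M (vec_space p) (Z i))" .
  also have "\<dots> = gauss_columns p n"
    using distr_whitened[OF M.prob_space_axioms S m B(3) X]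
    by (intro PiM_cong refl) (simp add: Z_def[abs_def])
  finally have joint: "distr M (\<Pi>\<^sub>M i\<in>{..<n}. vec_space p) (\<lambda>\<omega>. \<lambda>i\<in>{..<n}. Z i \<omega>) = gauss_columns p n" .
  have jm: "(\<lambda>\<omega>. \<lambda>i\<in>{..<n}. Z i \<omega>) \<in> measurable M (\<Pi>\<^sub>M i\<in>{..<n}. vec_space p)"
    using Zm by (rule measurable_restrict)
  define H where "H y = h (det_ratio n k d p y)" for y
  have Hm: "(\<lambda>z. H (f z)) \<in> borel_measurable N" if "\<And>a i. (\<lambda>z. f z a i) \<in> borel_measurable N" for f and N :: "'z measure"
    unfolding H_def by (intro measurable_compose[OF det_ratio_measurable h] that)
  have rm: "(\<lambda>z. (\<lambda>a\<in>{..<p}. \<lambda>i\<in>{..<n}. z i a) a i) \<in> borel_measurable (\<Pi>\<^sub>M i\<in>{..<n}. vec_space p)" for a i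
  proof (cases "a < p \<and> i < n")
    case True
    then have "i \<in> {..<n}" by simp
    then have "(\<lambda>z. z i) \<in> measurable (\<Pi>\<^sub>M i\<in>{..<n}. vec_space p) (vec_space p)"
      by (rule measurable_component_singleton)
    from measurable_compose[OF this measurable_component_vec[of a]] show ?thesis using True by simp
  qed (cases "a < p"; auto)
  have "sample_ratio n k d (\<lambda>i. X i \<omega>) = det_ratio n k d p (\<lambda>a\<in>{..<p}. \<lambda>i\<in>{..<n}. (\<lambda>i\<in>{..<n}. Z i \<omega>) i a)" for \<omega>
    by (rule det_ratio_affine[OF p pn(3) B(1,2), where \<mu>="\<lambda>c. m $ c", symmetric]) (auto simp: Z_def lin_map_def)
  then have "(\<integral>\<^sup>+\<omega>. h (sample_ratio n k d (\<lambda>i. X i \<omega>)) \<partial>M) =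
     (\<integral>\<^sup>+\<omega>. H (\<lambda>a\<in>{..<p}. \<lambda>i\<in>{..<n}. (\<lambda>i\<in>{..<n}. Z i \<omega>) i a) \<partial>M)"
    by (simp only: H_def)
  also have "\<dots> = (\<integral>\<^sup>+z. H (\<lambda>a\<in>{..<p}. \<lambda>i\<in>{..<n}. z i a) \<partial>gauss_columns p n)"
    by (subst joint[symmetric], rule nn_integral_distr[OF jm, symmetric], unfold measurable_distr_eq1)
      (rule Hm[OF rm])
  also have "\<dots> = (\<integral>\<^sup>+y. H y \<partial>gauss_columns n p)"
    using pn by (intro nn_integral_gauss_transpose Hm measurable_component_columns) auto
  also have "\<dots> = (\<integral>\<^sup>+y. h (\<Prod>b<p. resid_ratio n d b (y b)) \<partial>gauss_columns n p)"
    unfolding H_def using pn by (intro nn_integral_det_ratio h) (auto simp: p)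
  finally show ?thesis by (simp add: p_def)
qed

section \<open>Moments of logarithms of \<open>\<chi>\<^sup>2\<close> ratios\<close>

definition sq_sum :: "nat set \<Rightarrow> (nat \<Rightarrow> real) \<Rightarrow> real" where
  "sq_sum J x = (\<Sum>c\<in>J. (x c)\<^sup>2)"

lemma sq_sum_measurable [measurable]: "sq_sum J \<in> borel_measurable (gauss n)"
  unfolding sq_sum_def by measurable

lemma sq_sum_nonneg: "0 \<le> sq_sum J x"
  by (simp add: sq_sum_def sum_nonneg)

text \<open>Repeated integration by parts gives an antiderivative of \<open>s\<^sup>k / k! (1 + 2 s)\<^sup>-\<^sup>a\<close>.\<close>
fun beta_antideriv :: "nat \<Rightarrow> real \<Rightarrow> real \<Rightarrow> real" where
  "beta_antideriv 0 a s = - ((1 + 2 * s) powr (1 - a)) / (2 * (a - 1))"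
| "beta_antideriv (Suc k) a s =
     (beta_antideriv k (a - 1) s - s ^ Suc k / fact (Suc k) * (1 + 2 * s) powr (1 - a)) / (2 * (a - 1))"

declare beta_antideriv.simps [simp del]

lemma beta_antideriv_deriv:
  assumes "a > real k + 1" "s \<ge> 0"
  shows "DERIV (beta_antideriv k a) s :> s ^ k / fact k * (1 + 2 * s) powr (- a)"
  using assms
proof (induction k arbitrary: a)
  case 0
  have p: "DERIV (\<lambda>s. (1 + 2 * s) powr (1 - a)) s :> 2 * (1 - a) * (1 + 2 * s) powr (- a)"
    using 0 by (auto intro!: derivative_eq_intros simp: field_simps)
  have "DERIV (beta_antideriv 0 a) s :> - (2 * (1 - a) * (1 + 2 * s) powr (- a)) / (2 * (a - 1))"
    unfolding beta_antideriv.simps by (intro DERIV_cdivide DERIV_minus p)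
  moreover have "- (2 * (1 - a) * (1 + 2 * s) powr (- a)) = 2 * (a - 1) * (1 + 2 * s) powr (- a)"
    by (simp add: algebra_simps)
  moreover have "2 * (a - 1) * (1 + 2 * s) powr (- a) / (2 * (a - 1)) = (1 + 2 * s) powr (- a)"
    using 0 by simp
  ultimately show ?case by (simp only: power_0 fact_0 div_by_1 mult_1_left)
next
  case (Suc k)
  have IH: "DERIV (beta_antideriv k (a - 1)) s :> s ^ k / fact k * (1 + 2 * s) powr (- (a - 1))"
    using Suc.IH[of "a - 1"] Suc.prems by simp
  have p: "DERIV (\<lambda>s. (1 + 2 * s) powr (1 - a)) s :> 2 * (1 - a) * (1 + 2 * s) powr (- a)"
    using Suc.prems by (auto intro!: derivative_eq_intros simp: field_simps)
  have q: "DERIV (\<lambda>s. s ^ Suc k / fact (Suc k)) s :> s ^ k / fact k"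
  proof -
    have "DERIV (\<lambda>s. s ^ Suc k / fact (Suc k)) s :> real (Suc k) * s ^ k / fact (Suc k)"
      using DERIV_cdivide[OF DERIV_pow[of "Suc k" s], of "fact (Suc k)"] by simp
    moreover have "real (Suc k) * s ^ k / fact (Suc k) = s ^ k / fact k"
      unfolding fact_Suc by (simp del: of_nat_Suc)
    ultimately show ?thesis by simp
  qed
  have "DERIV (beta_antideriv (Suc k) a) s :>
      (s ^ k / fact k * (1 + 2 * s) powr (- (a - 1)) -
        (s ^ Suc k / fact (Suc k) * (2 * (1 - a) * (1 + 2 * s) powr (- a)) + s ^ k / fact k * (1 + 2 * s) powr (1 - a)))
      / (2 * (a - 1))"
    unfolding beta_antideriv.simps by (intro DERIV_cdivide DERIV_diff IH DERIV_mult' p q)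
  moreover have "(s ^ k / fact k * (1 + 2 * s) powr (- (a - 1)) -
        (s ^ Suc k / fact (Suc k) * (2 * (1 - a) * (1 + 2 * s) powr (- a)) + s ^ k / fact k * (1 + 2 * s) powr (1 - a)))
      / (2 * (a - 1)) = s ^ Suc k / fact (Suc k) * (1 + 2 * s) powr (- a)"
    using Suc.prems by (simp add: field_simps del: fact_Suc power_Suc)
  ultimately show ?case by simp
qed

lemma beta_antideriv_0:
  assumes "a > real k + 1"
  shows "beta_antideriv k a 0 = - 1 / (\<Prod>i<Suc k. 2 * (a - 1 - real i))"
  using assms
proof (induction k arbitrary: a)
  case (Suc k)
  have "beta_antideriv k (a - 1) 0 = - 1 / (\<Prod>i<Suc k. 2 * (a - 1 - real (Suc i)))"
    using Suc by (simp add: algebra_simps)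
  then show ?case
    by (subst prod.lessThan_Suc_shift) (simp add: beta_antideriv.simps del: prod.lessThan_Suc)
qed (simp add: beta_antideriv.simps)

lemma beta_antideriv_tendsto:
  assumes "a > real k + 1"
  shows "(beta_antideriv k a \<longlongrightarrow> 0) at_top"
  using assms
proof (induction k arbitrary: a)
  case 0
  then have "((\<lambda>s. (1 + 2 * s) powr (1 - a)) \<longlongrightarrow> 0) at_top" by real_asymp
  then have "(beta_antideriv 0 a \<longlongrightarrow> - 0 / (2 * (a - 1))) at_top"
    unfolding beta_antideriv.simps using 0 by (intro tendsto_divide tendsto_minus tendsto_const) auto
  then show ?case by simp
next
  case (Suc k)
  have IH: "(beta_antideriv k (a - 1) \<longlongrightarrow> 0) at_top" using Suc by simp
  have z: "((\<lambda>s. (1 + 2 * s) powr (real (Suc k) + 1 - a)) \<longlongrightarrow> 0) at_top"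
    using Suc.prems by real_asymp
  have "((\<lambda>s. s ^ Suc k * (1 + 2 * s) powr (1 - a)) \<longlongrightarrow> 0) at_top"
  proof (rule tendsto_sandwich[OF _ _ tendsto_const z])
    show "\<forall>\<^sub>F s in at_top. 0 \<le> s ^ Suc k * (1 + 2 * s) powr (1 - a)"
      using eventually_ge_at_top[of 0] by eventually_elim simp
    show "\<forall>\<^sub>F s in at_top. s ^ Suc k * (1 + 2 * s) powr (1 - a) \<le> (1 + 2 * s) powr (real (Suc k) + 1 - a)"
      using eventually_ge_at_top[of 0]
    proof eventually_elim
      case (elim s)
      have "s ^ Suc k \<le> (1 + 2 * s) ^ Suc k" using elim by (intro power_mono) auto
      also have "\<dots> = (1 + 2 * s) powr real (Suc k)" using elim by (intro powr_realpow[symmetric]) auto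
      finally have "s ^ Suc k * (1 + 2 * s) powr (1 - a) \<le> (1 + 2 * s) powr real (Suc k) * (1 + 2 * s) powr (1 - a)"
        by (intro mult_right_mono) auto
      also have "\<dots> = (1 + 2 * s) powr (real (Suc k) + 1 - a)"
        by (simp only: powr_add[symmetric] add_diff_eq)
      finally show ?case .
    qed
  qed
  then have w: "((\<lambda>s. s ^ Suc k / fact (Suc k) * (1 + 2 * s) powr (1 - a)) \<longlongrightarrow> 0 / fact (Suc k)) at_top"
    unfolding times_divide_eq_left by (rule tendsto_divide[OF _ tendsto_const]) simp
  have "(beta_antideriv (Suc k) a \<longlongrightarrow> (0 - 0 / fact (Suc k)) / (2 * (a - 1))) at_top"
    unfolding beta_antideriv.simps using Suc.prems
    by (intro tendsto_divide tendsto_diff IH w tendsto_const) auto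
  then show ?case by simp
qed

text \<open>A Beta integral in closed form. The antiderivative vanishes at infinity, so the value is
  minus the one at 0.\<close>

lemma nn_integral_beta:
  assumes "a > real k + 1"
  shows "(\<integral>\<^sup>+s. ennreal (s ^ k / fact k * (1 + 2 * s) powr (- a)) * indicator {0..} s \<partial>lborel) =
    ennreal (1 / (\<Prod>i<Suc k. 2 * (a - 1 - real i)))"
proof -
  have "(\<integral>\<^sup>+s. ennreal (s ^ k / fact k * (1 + 2 * s) powr (- a)) * indicator {0..} s \<partial>lborel) =
      ennreal (0 - beta_antideriv k a 0)"
    by (rule nn_integral_FTC_atLeast[OF _ beta_antideriv_deriv _ beta_antideriv_tendsto])
      (use assms in auto)
  then show ?thesis by (simp only: beta_antideriv_0[OF assms]) simp
qed

section \<open>Laplace transform and inverse moments of chi-square variables\<close>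

lemma nn_integral_std_normal_exp_sq:
  assumes "s \<ge> 0"
  shows "(\<integral>\<^sup>+x. ennreal (exp (- s * x\<^sup>2)) \<partial>std_normal) = ennreal ((1 + 2 * s) powr (- 1 / 2))"
proof -
  define \<sigma> where "\<sigma> = 1 / sqrt (1 + 2 * s)"
  have \<sigma>: "\<sigma> > 0" "\<sigma>\<^sup>2 = 1 / (1 + 2 * s)" using assms by (auto simp: \<sigma>_def power_divide)
  interpret N: prob_space "density lborel (\<lambda>x. ennreal (normal_density 0 \<sigma> x))"
    by (rule prob_space_normal_density) fact
  \<comment> \<open>Exponential tilting: the integrand is \<sigma> times the density of a centred
    normal with variance \<open>1 / (1 + 2 * s)\<close>.\<close>
  have "std_normal_density x * exp (- s * x\<^sup>2) = \<sigma> * normal_density 0 \<sigma> x" for x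
  proof -
    have "- x\<^sup>2 / 2 + - s * x\<^sup>2 = - x\<^sup>2 / (2 * \<sigma>\<^sup>2)"
      using assms by (simp add: \<sigma>(2) field_simps)
    then have "exp (- x\<^sup>2 / 2) * exp (- s * x\<^sup>2) = exp (- x\<^sup>2 / (2 * \<sigma>\<^sup>2))"
      by (simp only: exp_add[symmetric])
    moreover have "sqrt (2 * pi * \<sigma>\<^sup>2) = sqrt (2 * pi) * \<sigma>"
      using \<sigma>(1) by (simp add: real_sqrt_mult)
    ultimately show ?thesis using \<sigma>(1) by (simp add: std_normal_density_def normal_density_def)
  qed
  then have "(\<integral>\<^sup>+x. ennreal (exp (- s * x\<^sup>2)) \<partial>std_normal) =
      (\<integral>\<^sup>+x. ennreal \<sigma> * ennreal (normal_density 0 \<sigma> x) \<partial>lborel)"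
    using \<sigma>(1) by (subst nn_integral_density) (auto simp: ennreal_mult[symmetric])
  also have "\<dots> = ennreal \<sigma> * emeasure (density lborel (\<lambda>x. ennreal (normal_density 0 \<sigma> x))) UNIV"
    by (simp add: nn_integral_cmult emeasure_density)
  also have "\<dots> = ennreal \<sigma>" using N.emeasure_space_1 by simp
  also have "\<sigma> = (1 + 2 * s) powr (- 1 / 2)"
    using assms by (simp add: \<sigma>_def powr_minus_divide powr_half_sqrt)
  finally show ?thesis .
qed

lemma nn_integral_gauss_exp_sq_sum:
  assumes "J \<subseteq> {..<n}" "s \<ge> 0"
  shows "(\<integral>\<^sup>+x. ennreal (exp (- s * sq_sum J x)) \<partial>gauss n) = ennreal ((1 + 2 * s) powr (- real (card J) / 2))"
proof -
  have fin: "finite J" using assms(1) finite_subset by blast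
  have "ennreal (exp (- s * sq_sum J x)) = (\<Prod>i<n. if i \<in> J then ennreal (exp (- s * (x i)\<^sup>2)) else 1)" for x
  proof -
    have "(\<Prod>i<n. if i \<in> J then ennreal (exp (- s * (x i)\<^sup>2)) else 1) = (\<Prod>i\<in>J. ennreal (exp (- s * (x i)\<^sup>2)))"
      using assms(1) by (simp add: prod.If_cases Int_absorb1)
    also have "\<dots> = ennreal (exp (\<Sum>i\<in>J. - s * (x i)\<^sup>2))"
      by (simp add: prod_ennreal exp_sum[OF fin])
    finally show ?thesis by (simp add: sq_sum_def sum_distrib_left)
  qed
  then have "(\<integral>\<^sup>+x. ennreal (exp (- s * sq_sum J x)) \<partial>gauss n) =
     (\<Prod>i<n. \<integral>\<^sup>+x. (if i \<in> J then ennreal (exp (- s * x\<^sup>2)) else 1) \<partial>std_normal)"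
    by (simp only:) (rule normal_product.product_nn_integral_prod, auto)
  also have "\<dots> = (\<Prod>i<n. if i \<in> J then ennreal ((1 + 2 * s) powr (- 1 / 2)) else 1)"
    using prob_space.emeasure_space_1[OF prob_space_std_normal] nn_integral_std_normal_exp_sq[OF assms(2)]
    by (intro prod.cong) auto
  also have "\<dots> = ennreal (((1 + 2 * s) powr (- 1 / 2)) ^ card J)"
    using assms(1) by (simp add: prod.If_cases Int_absorb1 ennreal_power)
  also have "((1 + 2 * s) powr (- 1 / 2)) ^ card J = (1 + 2 * s) powr (- real (card J) / 2)"
    using assms(2) by (subst powr_realpow[symmetric]) (auto simp: powr_powr)
  finally show ?thesis .
qed

lemma AE_gauss_component_neq_0:
  assumes "c < n"
  shows "AE x in gauss n. x c \<noteq> 0"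
proof (rule AE_PiM_component)
  show "AE x in std_normal. x \<noteq> 0"
    by (subst AE_density) (auto intro: AE_mp[OF AE_lborel_singleton])
qed (use assms prob_space_std_normal in auto)

lemma AE_sq_sum_pos:
  assumes "J \<subseteq> {..<n}" "J \<noteq> {}"
  shows "AE x in gauss n. sq_sum J x > 0"
proof -
  obtain c where c: "c \<in> J" "c < n" using assms by blast
  have fin: "finite J" using assms(1) finite_subset by blast
  show ?thesis
    using AE_gauss_component_neq_0[OF c(2)]
  proof eventually_elim
    case (elim x)
    then have "0 < (x c)\<^sup>2" by simp
    also have "\<dots> \<le> sq_sum J x" unfolding sq_sum_def using fin c by (intro member_le_sum) auto
    finally show ?case .
  qed
qed

text \<open>Negative moments of \<open>\<chi>\<^sup>2\<close>, from \<open>k! / A\<^sup>k\<^sup>+\<^sup>1 = \<integral>s\<^sup>k exp (- s A) ds\<close> and Fubini.\<close>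
lemma sq_sum_inverse_moment:
  assumes J: "J \<subseteq> {..<n}" and \<nu>: "real (card J) > 2 * real k + 2"
  shows "has_bochner_integral (gauss n) (\<lambda>x. 1 / sq_sum J x ^ Suc k)
    (1 / (\<Prod>i<Suc k. real (card J) - 2 - 2 * real i))"
proof -
  interpret G: prob_space "gauss n" by (rule prob_space_gauss)
  interpret P: pair_sigma_finite lborel "gauss n" ..
  let ?\<nu> = "real (card J)"
  have "J \<noteq> {}" using \<nu> by auto
  have pos: "(\<Prod>i<Suc k. ?\<nu> - 2 - 2 * real i) > 0"
  proof (rule prod_pos)
    fix i assume "i \<in> {..<Suc k}"
    then have "real i \<le> real k" by simp
    then show "0 < ?\<nu> - 2 - 2 * real i" using \<nu> by linarith
  qed
  have "(\<integral>\<^sup>+x. ennreal (1 / sq_sum J x ^ Suc k) \<partial>gauss n) =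
    (\<integral>\<^sup>+x. (\<integral>\<^sup>+s. ennreal (s ^ k / fact k * exp (- s * sq_sum J x)) * indicator {0..} s \<partial>lborel) \<partial>gauss n)"
  proof (rule nn_integral_cong_AE)
    show "AE x in gauss n. ennreal (1 / sq_sum J x ^ Suc k) =
      (\<integral>\<^sup>+s. ennreal (s ^ k / fact k * exp (- s * sq_sum J x)) * indicator {0..} s \<partial>lborel)"
      using AE_sq_sum_pos[OF J \<open>J \<noteq> {}\<close>]
    proof eventually_elim
      case (elim x)
      define A where "A = sq_sum J x"
      have A: "A > 0" using elim by (simp add: A_def)
      \<comment> \<open>The integral over \<open>s\<close> is read off from the total mass of the
        Erlang density with rate \<open>A\<close>.\<close>
      interpret E: prob_space "density lborel (\<lambda>s. ennreal (erlang_density k A s))"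
        by (rule prob_space_erlang_density) fact
      have "(\<integral>\<^sup>+s. ennreal (s ^ k / fact k * exp (- s * A)) * indicator {0..} s \<partial>lborel) =
         (\<integral>\<^sup>+s. ennreal (1 / A ^ Suc k) * ennreal (erlang_density k A s) \<partial>lborel)"
      proof (rule nn_integral_cong)
        fix s :: real
        show "ennreal (s ^ k / fact k * exp (- s * A)) * indicator {0..} s =
            ennreal (1 / A ^ Suc k) * ennreal (erlang_density k A s)"
        proof (cases "s < 0")
          case False
          then have "1 / A ^ Suc k * erlang_density k A s = s ^ k / fact k * exp (- s * A)"
            using A by (simp add: erlang_density_def mult.commute)
          then show ?thesis using False A by (simp add: ennreal_mult[symmetric] erlang_density_nonneg)
        qed (simp add: erlang_density_def)
      qed
      also have "\<dots> = ennreal (1 / A ^ Suc k) * emeasure (density lborel (\<lambda>s. ennreal (erlang_density k A s))) UNIV"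
        by (simp add: nn_integral_cmult emeasure_density)
      also have "\<dots> = ennreal (1 / A ^ Suc k)" using E.emeasure_space_1 by simp
      finally show ?case by (simp add: A_def)
    qed
  qed
  also have "\<dots> = (\<integral>\<^sup>+s. (\<integral>\<^sup>+x. ennreal (s ^ k / fact k * exp (- s * sq_sum J x)) * indicator {0..} s \<partial>gauss n) \<partial>lborel)"
    by (rule P.Fubini') measurable
  also have "\<dots> = (\<integral>\<^sup>+s. ennreal (s ^ k / fact k * (1 + 2 * s) powr (- (?\<nu> / 2))) * indicator {0..} s \<partial>lborel)"
  proof (rule nn_integral_cong)
    fix s :: real
    show "(\<integral>\<^sup>+x. ennreal (s ^ k / fact k * exp (- s * sq_sum J x)) * indicator {0..} s \<partial>gauss n) =
      ennreal (s ^ k / fact k * (1 + 2 * s) powr (- (?\<nu> / 2))) * indicator {0..} s"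
    proof (cases "s \<ge> 0")
      case True
      then show ?thesis
        by (simp add: ennreal_mult nn_integral_cmult nn_integral_gauss_exp_sq_sum[OF J True, simplified]
          del: times_divide_eq_left)
    qed simp
  qed
  also have "\<dots> = ennreal (1 / (\<Prod>i<Suc k. 2 * (?\<nu> / 2 - 1 - real i)))"
    using \<nu> by (intro nn_integral_beta) simp
  also have "(\<Prod>i<Suc k. 2 * (?\<nu> / 2 - 1 - real i)) = (\<Prod>i<Suc k. ?\<nu> - 2 - 2 * real i)"
    by (intro prod.cong) auto
  finally show ?thesis
    using pos by (intro has_bochner_integral_nn_integral) (auto simp: sq_sum_nonneg less_imp_le)
qed

section \<open>Independence and positive moments of sums of squares\<close>

lemma indep_var_sq_sum:
  assumes "I \<inter> J = {}" "I \<subseteq> {..<n}" "J \<subseteq> {..<n}"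
  shows "prob_space.indep_var (gauss n) borel (sq_sum I) borel (sq_sum J)"
proof -
  interpret G: prob_space "gauss n" by (rule prob_space_gauss)
  have "G.indep_vars (\<lambda>_. std_normal) (\<lambda>i \<omega>. \<omega> i) {..<n}"
    by (rule indep_vars_PiM_components) (rule prob_space_std_normal)
  from G.indep_var_restrict[OF this assms]
  have i: "G.indep_var (PiM I (\<lambda>_. std_normal)) (\<lambda>\<omega>. restrict (\<lambda>i. \<omega> i) I) (PiM J (\<lambda>_. std_normal)) (\<lambda>\<omega>. restrict (\<lambda>i. \<omega> i) J)" .
  have m: "sq_sum K \<in> borel_measurable (PiM K (\<lambda>_. std_normal))" for K
    unfolding sq_sum_def
  proof (intro borel_measurable_sum borel_measurable_power)
    fix c assume "c \<in> K"
    then have "(\<lambda>x. x c) \<in> measurable (PiM K (\<lambda>_. std_normal)) std_normal" by (rule measurable_component_singleton)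
    then show "(\<lambda>x. x c) \<in> borel_measurable (PiM K (\<lambda>_. std_normal))" by simp
  qed
  have "sq_sum K \<circ> (\<lambda>\<omega>. restrict (\<lambda>i. \<omega> i) K) = sq_sum K" for K
    by (auto simp: sq_sum_def fun_eq_iff)
  then show ?thesis using G.indep_var_compose[OF i m m] by simp
qed

lemma (in prob_space) indep_var_has_bochner_integral_mult:
  fixes f g :: "real \<Rightarrow> real"
  assumes ind: "indep_var borel X borel Y"
    and [measurable]: "f \<in> borel_measurable borel" "g \<in> borel_measurable borel"
    and f: "has_bochner_integral M (\<lambda>\<omega>. f (X \<omega>)) a" and g: "has_bochner_integral M (\<lambda>\<omega>. g (Y \<omega>)) b"
  shows "has_bochner_integral M (\<lambda>\<omega>. f (X \<omega>) * g (Y \<omega>)) (a * b)"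
proof -
  have i: "indep_var borel (\<lambda>\<omega>. f (X \<omega>)) borel (\<lambda>\<omega>. g (Y \<omega>))"
    using indep_var_compose[OF ind assms(2,3)] by (simp add: comp_def)
  show ?thesis
    using indep_var_integrable[OF i] indep_var_lebesgue_integral[OF i] f g
    by (auto simp: has_bochner_integral_iff)
qed

lemma gauss_component_moments:
  assumes "c < n"
  shows "has_bochner_integral (gauss n) (\<lambda>x. ((x c)\<^sup>2) ^ k) (fact (2 * k) / (2 ^ k * fact k))"
proof -
  have d: "distr (gauss n) std_normal (\<lambda>x. x c) = std_normal"
    using distr_PiM_component[of "{..<n}" "\<lambda>_. std_normal" c] assms prob_space_std_normal by simp
  have m: "(\<lambda>x. x c) \<in> measurable (gauss n) std_normal"
    using assms by (intro measurable_component_singleton) simp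
  have "integrable std_normal (\<lambda>z. z ^ (2 * k))" by (rule integrable_std_normal_power)
  moreover have "(\<integral>z. z ^ (2 * k) \<partial>std_normal) = fact (2 * k) / (2 ^ k * fact k)"
    using integral_std_normal_moment_even[of k] by (subst integral_density) auto
  ultimately have "integrable (distr (gauss n) std_normal (\<lambda>x. x c)) (\<lambda>z. z ^ (2 * k))"
    "(\<integral>z. z ^ (2 * k) \<partial>distr (gauss n) std_normal (\<lambda>x. x c)) = fact (2 * k) / (2 ^ k * fact k)"
    unfolding d by auto
  then show ?thesis
    using m by (subst (asm) integrable_distr_eq, simp, simp, subst (asm) integral_distr, simp, simp)
      (simp add: has_bochner_integral_iff power_mult)
qed

text \<open>All four moments are carried through one induction over the coordinates, since the
  binomial expansion after adding a coordinate involves all lower ones. The numbers 1, 3, 15 and 105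
  are the moments of a squared standard normal.\<close>

lemma sq_sum_moments:
  assumes "J \<subseteq> {..<n}"
  defines "q \<equiv> real (card J)"
  shows "has_bochner_integral (gauss n) (\<lambda>x. sq_sum J x ^ 1) q"
    and "has_bochner_integral (gauss n) (\<lambda>x. sq_sum J x ^ 2) (q * (q + 2))"
    and "has_bochner_integral (gauss n) (\<lambda>x. sq_sum J x ^ 3) (q * (q + 2) * (q + 4))"
    and "has_bochner_integral (gauss n) (\<lambda>x. sq_sum J x ^ 4) (q * (q + 2) * (q + 4) * (q + 6))"
proof -
  interpret G: prob_space "gauss n" by (rule prob_space_gauss)
  let ?h = "has_bochner_integral (gauss n)"
  have "finite J" using assms(1) finite_subset by blast
  then have "?h (\<lambda>x. sq_sum J x ^ 1) (real (card J)) \<and>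
    ?h (\<lambda>x. sq_sum J x ^ 2) (real (card J) * (real (card J) + 2)) \<and>
    ?h (\<lambda>x. sq_sum J x ^ 3) (real (card J) * (real (card J) + 2) * (real (card J) + 4)) \<and>
    ?h (\<lambda>x. sq_sum J x ^ 4) (real (card J) * (real (card J) + 2) * (real (card J) + 4) * (real (card J) + 6))"
    using assms(1)
  proof (induction J rule: finite_induct)
    case empty
    have "?h (\<lambda>x. 0) 0" by (rule has_bochner_integral_zero)
    then show ?case by (simp add: sq_sum_def)
  next
    case (insert c J)
    define q where "q = real (card J)"
    have sub: "J \<subseteq> {..<n}" "c < n" using insert.prems by auto
    note IH = insert.IH[OF sub(1), folded q_def]
    define S Y where "S = sq_sum J" and "Y = sq_sum {c}"
    have Y1: "Y x = (x c)\<^sup>2" for x by (simp add: Y_def sq_sum_def)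
    have split: "sq_sum (insert c J) x = S x + Y x" for x
      using insert.hyps by (simp add: S_def Y_def sq_sum_def)
    have ind: "G.indep_var borel S borel Y"
      unfolding S_def Y_def using insert sub by (intro indep_var_sq_sum) auto
    have S: "?h (\<lambda>x. S x ^ 0) 1" "?h (\<lambda>x. S x ^ 1) q" "?h (\<lambda>x. S x ^ 2) (q * (q + 2))"
      "?h (\<lambda>x. S x ^ 3) (q * (q + 2) * (q + 4))" "?h (\<lambda>x. S x ^ 4) (q * (q + 2) * (q + 4) * (q + 6))"
      using IH G.prob_space by (auto simp: S_def has_bochner_integral_iff)
    have Y: "?h (\<lambda>x. Y x ^ 0) 1" "?h (\<lambda>x. Y x ^ 1) 1" "?h (\<lambda>x. Y x ^ 2) 3" "?h (\<lambda>x. Y x ^ 3) 15" "?h (\<lambda>x. Y x ^ 4) 105"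
      using gauss_component_moments[OF sub(2), of 0] gauss_component_moments[OF sub(2), of 1]
        gauss_component_moments[OF sub(2), of 2] gauss_component_moments[OF sub(2), of 3]
        gauss_component_moments[OF sub(2), of 4]
      by (simp_all add: Y1 fact_numeral)
    have SY: "?h (\<lambda>x. S x ^ i * Y x ^ j) (a * b)" if "?h (\<lambda>x. S x ^ i) a" "?h (\<lambda>x. Y x ^ j) b" for i j a b
      by (rule G.indep_var_has_bochner_integral_mult[OF ind _ _ that]) measurable
    have q: "real (card (insert c J)) = q + 1" using insert.hyps by (simp add: q_def)
    have 1: "?h (\<lambda>x. sq_sum (insert c J) x ^ 1) (q + 1)"
      unfolding split using has_bochner_integral_add[OF S(2) Y(2)] by simp
    have 2: "?h (\<lambda>x. sq_sum (insert c J) x ^ 2) ((q + 1) * (q + 1 + 2))"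
    proof -
      have "?h (\<lambda>x. S x ^ 2 * Y x ^ 0 + 2 * (S x ^ 1 * Y x ^ 1) + S x ^ 0 * Y x ^ 2)
         (q * (q + 2) * 1 + 2 * (q * 1) + 1 * 3)"
        by (intro has_bochner_integral_add has_bochner_integral_mult_right SY S Y)
      then show ?thesis unfolding split by (simp add: algebra_simps power2_eq_square)
    qed
    have 3: "?h (\<lambda>x. sq_sum (insert c J) x ^ 3) ((q + 1) * (q + 1 + 2) * (q + 1 + 4))"
    proof -
      have "?h (\<lambda>x. S x ^ 3 * Y x ^ 0 + 3 * (S x ^ 2 * Y x ^ 1) + 3 * (S x ^ 1 * Y x ^ 2) + S x ^ 0 * Y x ^ 3)
         (q * (q + 2) * (q + 4) * 1 + 3 * (q * (q + 2) * 1) + 3 * (q * 3) + 1 * 15)"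
        by (intro has_bochner_integral_add has_bochner_integral_mult_right SY S Y)
      moreover have "q * (q + 2) * (q + 4) * 1 + 3 * (q * (q + 2) * 1) + 3 * (q * 3) + 1 * 15 =
          (q + 1) * (q + 1 + 2) * (q + 1 + 4)"
        by (simp add: algebra_simps)
      moreover have "S x ^ 3 * Y x ^ 0 + 3 * (S x ^ 2 * Y x ^ 1) + 3 * (S x ^ 1 * Y x ^ 2) + S x ^ 0 * Y x ^ 3 =
          (S x + Y x) ^ 3" for x
        by (simp add: algebra_simps power2_eq_square power3_eq_cube)
      ultimately show ?thesis unfolding split by simp
    qed
    have 4: "?h (\<lambda>x. sq_sum (insert c J) x ^ 4) ((q + 1) * (q + 1 + 2) * (q + 1 + 4) * (q + 1 + 6))"
    proof -
      have "?h (\<lambda>x. S x ^ 4 * Y x ^ 0 + 4 * (S x ^ 3 * Y x ^ 1) + 6 * (S x ^ 2 * Y x ^ 2) +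
            4 * (S x ^ 1 * Y x ^ 3) + S x ^ 0 * Y x ^ 4)
         (q * (q + 2) * (q + 4) * (q + 6) * 1 + 4 * (q * (q + 2) * (q + 4) * 1) + 6 * (q * (q + 2) * 3) +
            4 * (q * 15) + 1 * 105)"
        by (intro has_bochner_integral_add has_bochner_integral_mult_right SY S Y)
      moreover have "q * (q + 2) * (q + 4) * (q + 6) * 1 + 4 * (q * (q + 2) * (q + 4) * 1) + 6 * (q * (q + 2) * 3) +
            4 * (q * 15) + 1 * 105 = (q + 1) * (q + 1 + 2) * (q + 1 + 4) * (q + 1 + 6)"
        by (simp add: algebra_simps)
      moreover have "S x ^ 4 * Y x ^ 0 + 4 * (S x ^ 3 * Y x ^ 1) + 6 * (S x ^ 2 * Y x ^ 2) +
            4 * (S x ^ 1 * Y x ^ 3) + S x ^ 0 * Y x ^ 4 = (S x + Y x) ^ 4" for x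
        by (simp add: algebra_simps power2_eq_square power3_eq_cube power4_eq_xxxx)
      ultimately show ?thesis unfolding split by simp
    qed
    show ?case unfolding q using 1 2 3 4 by blast
  qed
  then show "?h (\<lambda>x. sq_sum J x ^ 1) q" "?h (\<lambda>x. sq_sum J x ^ 2) (q * (q + 2))"
    "?h (\<lambda>x. sq_sum J x ^ 3) (q * (q + 2) * (q + 4))"
    "?h (\<lambda>x. sq_sum J x ^ 4) (q * (q + 2) * (q + 4) * (q + 6))"
    by (simp_all add: q_def)
qed

section \<open>Moments of the logarithm of one plus a chi-square ratio\<close>

lemma power4_add_le: "(x + y) ^ 4 \<le> 8 * (x ^ 4 + y ^ 4 :: real)"
proof -
  have "(x + y)\<^sup>2 \<le> 2 * (x\<^sup>2 + y\<^sup>2)"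
    using sum_squares_bound[of x y] by (simp add: power2_eq_square algebra_simps)
  then have "((x + y)\<^sup>2)\<^sup>2 \<le> (2 * (x\<^sup>2 + y\<^sup>2))\<^sup>2" by (intro power_mono) auto
  also have "\<dots> \<le> 8 * ((x\<^sup>2)\<^sup>2 + (y\<^sup>2)\<^sup>2)"
    using sum_squares_bound[of "x\<^sup>2" "y\<^sup>2"] by (simp add: power2_eq_square algebra_simps)
  finally show ?thesis by (simp add: power_mult[symmetric])
qed

text \<open>With \<open>D = U - v\<close> and \<open>l = ln ((1 + U) / (1 + v))\<close>, the
  inequality ln x <= x - 1 used in both directions gives
  \<open>D / (1 + U) \<le> l \<le> D / (1 + v)\<close>. So \<open>l\<close> is dominated by
  \<open>D\<close> and differs from it by a second-order remainder \<rho>. The free parameter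
  \<kappa> trades the third moment of \<open>D\<close> for the second and fourth.\<close>

lemma (in prob_space) log_moments:
  fixes U :: "'a \<Rightarrow> real" and v s2 m4 \<kappa> :: real
  assumes U[measurable]: "U \<in> borel_measurable M" and U0: "\<And>\<omega>. 0 \<le> U \<omega>" and v: "0 \<le> v"
    and mean: "has_bochner_integral M U v"
    and var: "has_bochner_integral M (\<lambda>\<omega>. (U \<omega> - v)\<^sup>2) s2"
    and four: "integrable M (\<lambda>\<omega>. (U \<omega> - v) ^ 4)" "expectation (\<lambda>\<omega>. (U \<omega> - v) ^ 4) \<le> m4"
    and \<kappa>: "0 < \<kappa>"
  defines "\<xi> \<equiv> \<lambda>\<omega>. ln (1 + U \<omega>)"
  defines "X \<equiv> \<lambda>\<omega>. \<xi> \<omega> - expectation \<xi>"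
  shows "integrable M \<xi>" and "integrable M (\<lambda>\<omega>. (X \<omega>)\<^sup>2)" and "integrable M (\<lambda>\<omega>. (X \<omega>) ^ 4)"
    and "ln (1 + v) - s2 \<le> expectation \<xi>" "expectation \<xi> \<le> ln (1 + v)"
    and "\<bar>expectation (\<lambda>\<omega>. (X \<omega>)\<^sup>2) - s2\<bar> \<le> (\<kappa> + 4 * v + 16 * v\<^sup>2) * s2 + (1 / \<kappa> + 4) * m4"
    and "expectation (\<lambda>\<omega>. (X \<omega>) ^ 4) \<le> 8 * (m4 + s2 ^ 4)"
proof -
  define D where "D \<omega> = U \<omega> - v" for \<omega>
  define l where "l \<omega> = \<xi> \<omega> - ln (1 + v)" for \<omega>
  define \<rho> where "\<rho> \<omega> = D \<omega> - l \<omega>" for \<omega>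
  have [measurable]: "D \<in> borel_measurable M"
    unfolding D_def[abs_def] by measurable
  have [measurable]: "\<xi> \<in> borel_measurable M"
    unfolding \<xi>_def by (rule borel_measurable_ln) measurable
  have [measurable]: "l \<in> borel_measurable M"
    unfolding l_def[abs_def] by measurable
  have [measurable]: "\<rho> \<in> borel_measurable M"
    unfolding \<rho>_def[abs_def] by measurable
  have l_ln: "l \<omega> = ln ((1 + U \<omega>) / (1 + v))" for \<omega>
    using U0[of \<omega>] v by (simp add: l_def \<xi>_def ln_div)
  have l_up: "l \<omega> \<le> D \<omega> / (1 + v)" for \<omega>
  proof -
    have "l \<omega> \<le> (1 + U \<omega>) / (1 + v) - 1"
      unfolding l_ln using U0[of \<omega>] v by (intro ln_le_minus_one) (auto intro: divide_pos_pos)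
    also have "\<dots> = D \<omega> / (1 + v)" using v by (simp add: D_def field_simps)
    finally show ?thesis .
  qed
  have l_lo: "D \<omega> / (1 + U \<omega>) \<le> l \<omega>" for \<omega>
  proof -
    have "ln ((1 + v) / (1 + U \<omega>)) \<le> (1 + v) / (1 + U \<omega>) - 1"
      using U0[of \<omega>] v by (intro ln_le_minus_one) (auto intro: divide_pos_pos)
    moreover have "ln ((1 + v) / (1 + U \<omega>)) = - l \<omega>"
      using U0[of \<omega>] v by (simp add: l_def \<xi>_def ln_div)
    moreover have "(1 + v) / (1 + U \<omega>) - 1 = - (D \<omega> / (1 + U \<omega>))"
      using U0[of \<omega>] v by (simp add: D_def field_simps)
    ultimately show ?thesis by simp
  qed
  have div: "\<bar>D \<omega> / (1 + w)\<bar> \<le> \<bar>D \<omega>\<bar>" "\<bar>D \<omega> - D \<omega> / (1 + w)\<bar> \<le> w * \<bar>D \<omega>\<bar>" if "0 \<le> w" for \<omega> w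
  proof -
    show "\<bar>D \<omega> / (1 + w)\<bar> \<le> \<bar>D \<omega>\<bar>" using that by (simp add: abs_divide divide_le_eq mult_right_le_one_le[of "\<bar>D \<omega>\<bar>"] distrib_left)
    have "D \<omega> - D \<omega> / (1 + w) = w / (1 + w) * D \<omega>" using that by (simp add: field_simps)
    moreover have "w / (1 + w) \<le> w" using that by (simp add: divide_le_eq distrib_left)
    ultimately show "\<bar>D \<omega> - D \<omega> / (1 + w)\<bar> \<le> w * \<bar>D \<omega>\<bar>"
      using that by (simp only: abs_mult) (intro mult_right_mono, auto)
  qed
  have l_abs: "\<bar>l \<omega>\<bar> \<le> \<bar>D \<omega>\<bar>" for \<omega>
    using l_up[of \<omega>] l_lo[of \<omega>] div(1)[OF v, of \<omega>] div(1)[OF U0[of \<omega>], of \<omega>] by linarith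
  \<comment> \<open>Both bounds for \<open>l\<close> are linear in \<open>D\<close> up to relative
    errors \<open>v\<close> and \<open>U\<close>, and \<open>U\<close> is at most
    \<open>v + \<bar>D\<bar>\<close>.\<close>
  have \<rho>_abs: "\<bar>\<rho> \<omega>\<bar> \<le> D \<omega> ^ 2 + 2 * v * \<bar>D \<omega>\<bar>" for \<omega>
  proof -
    have "\<bar>\<rho> \<omega>\<bar> \<le> v * \<bar>D \<omega>\<bar> + U \<omega> * \<bar>D \<omega>\<bar>"
    proof -
      have "0 \<le> v * \<bar>D \<omega>\<bar>" "0 \<le> U \<omega> * \<bar>D \<omega>\<bar>" using U0[of \<omega>] v by auto
      then show ?thesis
        using l_up[of \<omega>] l_lo[of \<omega>] div(2)[OF v, of \<omega>] div(2)[OF U0[of \<omega>], of \<omega>] unfolding \<rho>_def by linarith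
    qed
    also have "U \<omega> * \<bar>D \<omega>\<bar> \<le> (v + \<bar>D \<omega>\<bar>) * \<bar>D \<omega>\<bar>" by (intro mult_right_mono) (auto simp: D_def)
    finally show ?thesis by (simp add: algebra_simps power2_eq_square)
  qed
  have D4: "integrable M (\<lambda>\<omega>. D \<omega> ^ 4)" "expectation (\<lambda>\<omega>. D \<omega> ^ 4) \<le> m4"
    and D2: "integrable M (\<lambda>\<omega>. D \<omega> ^ 2)" "expectation (\<lambda>\<omega>. D \<omega> ^ 2) = s2"
    using four var by (simp_all add: D_def has_bochner_integral_iff)
  have D1: "integrable M D" "expectation D = 0"
    using mean by (auto simp: D_def[abs_def] has_bochner_integral_iff prob_space)
  have l2: "\<bar>l \<omega> ^ 2\<bar> \<le> \<bar>D \<omega> ^ 2\<bar>" and l4: "\<bar>l \<omega> ^ 4\<bar> \<le> \<bar>D \<omega> ^ 4\<bar>" for \<omega>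
    using power_mono[OF l_abs[of \<omega>], of 2] power_mono[OF l_abs[of \<omega>], of 4] by (simp_all add: power_abs)
  have il: "integrable M l" by (rule Bochner_Integration.integrable_bound[OF D1(1)]) (auto simp: l_abs)
  have il2: "integrable M (\<lambda>\<omega>. l \<omega> ^ 2)"
    by (rule Bochner_Integration.integrable_bound[OF D2(1)]) (use l2 in auto)
  have il4: "integrable M (\<lambda>\<omega>. l \<omega> ^ 4)"
    by (rule Bochner_Integration.integrable_bound[OF D4(1)]) (use l4 in auto)
  have \<rho>2: "\<rho> \<omega> ^ 2 \<le> 2 * D \<omega> ^ 4 + 8 * v\<^sup>2 * D \<omega> ^ 2" for \<omega>
  proof -
    have "\<rho> \<omega> ^ 2 \<le> (D \<omega> ^ 2 + 2 * v * \<bar>D \<omega>\<bar>)\<^sup>2"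
      using power_mono[OF \<rho>_abs[of \<omega>], of 2] by simp
    also have "\<dots> \<le> 2 * (D \<omega> ^ 2)\<^sup>2 + 2 * (2 * v * \<bar>D \<omega>\<bar>)\<^sup>2"
      using sum_squares_bound[of "D \<omega> ^ 2" "2 * v * \<bar>D \<omega>\<bar>"] by (simp add: power2_sum)
    finally show ?thesis by (simp add: power_mult_distrib power_mult[symmetric])
  qed
  have i\<rho>: "integrable M \<rho>" unfolding \<rho>_def[abs_def] using D1 il by simp
  have i\<rho>b: "integrable M (\<lambda>\<omega>. 2 * D \<omega> ^ 4 + 8 * v\<^sup>2 * D \<omega> ^ 2)"
    using D4(1) D2(1) by simp
  have i\<rho>2: "integrable M (\<lambda>\<omega>. \<rho> \<omega> ^ 2)"
    by (rule Bochner_Integration.integrable_bound[OF i\<rho>b]) (auto intro: \<rho>2)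
  show i\<xi>: "integrable M \<xi>"
    using Bochner_Integration.integrable_add[OF il integrable_const[of "ln (1 + v)"]] by (simp add: l_def[abs_def])
  have El: "expectation l = expectation \<xi> - ln (1 + v)"
    unfolding l_def[abs_def] using i\<xi> by (simp add: prob_space)
  have Xl: "X \<omega> = l \<omega> - expectation l" for \<omega>
    by (simp add: X_def El l_def)
  show up: "expectation \<xi> \<le> ln (1 + v)"
  proof -
    have "expectation l \<le> expectation (\<lambda>\<omega>. D \<omega> / (1 + v))"
      using D1(1) by (intro integral_mono[OF il] l_up) auto
    then show ?thesis using D1(2) El by simp
  qed
  show lo: "ln (1 + v) - s2 \<le> expectation \<xi>"
  proof -
    have "D \<omega> / (1 + v) - D \<omega> ^ 2 \<le> l \<omega>" for \<omega>
    proof -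
      \<comment> \<open>Upper and lower bound for \<open>l\<close> differ by at most
        \<open>D^2\<close>, so the bias of the logarithm is at most the variance of
        \<open>U\<close>.\<close>
      have "D \<omega> / (1 + v) - D \<omega> / (1 + U \<omega>) = D \<omega> ^ 2 / ((1 + v) * (1 + U \<omega>))"
        using U0[of \<omega>] v by (simp add: D_def field_simps power2_eq_square)
      also have "\<dots> \<le> D \<omega> ^ 2 / 1"
      proof (intro divide_left_mono)
        show "1 \<le> (1 + v) * (1 + U \<omega>)" using U0[of \<omega>] v by (simp add: algebra_simps)
      qed (use U0[of \<omega>] v in auto)
      finally show ?thesis using l_lo[of \<omega>] by simp
    qed
    then have "expectation (\<lambda>\<omega>. D \<omega> / (1 + v) - D \<omega> ^ 2) \<le> expectation l"
      using D1(1) D2(1) by (intro integral_mono[OF _ il]) auto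
    then show ?thesis using D1 D2 El by simp
  qed
  have [measurable]: "X \<in> borel_measurable M"
    unfolding X_def by measurable
  have X2: "(X \<omega>)\<^sup>2 = l \<omega> ^ 2 - 2 * expectation l * l \<omega> + (expectation l)\<^sup>2" for \<omega>
    by (simp add: Xl power2_diff)
  show "integrable M (\<lambda>\<omega>. (X \<omega>)\<^sup>2)"
    unfolding X2 using il il2 by simp
  have pw4: "(X \<omega>) ^ 4 \<le> 8 * (l \<omega> ^ 4 + (expectation l) ^ 4)" for \<omega>
    using power4_add_le[of "l \<omega>" "- expectation l"] by (simp add: Xl)
  have ib4: "integrable M (\<lambda>\<omega>. 8 * (l \<omega> ^ 4 + (expectation l) ^ 4))" using il4 by simp
  show iX4: "integrable M (\<lambda>\<omega>. (X \<omega>) ^ 4)"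
    by (rule Bochner_Integration.integrable_bound[OF ib4])
      (use pw4 in \<open>auto simp: distrib_left\<close>)
  have s2: "0 \<le> s2" using D2(2) by (metis Bochner_Integration.integral_nonneg zero_le_power2)
  have El4: "(expectation l) ^ 4 \<le> s2 ^ 4"
  proof -
    have "\<bar>expectation l\<bar> \<le> s2" using up lo El s2 by simp
    from power_mono[OF this, of 4] show ?thesis by (simp add: power_abs)
  qed
  have l4m: "expectation (\<lambda>\<omega>. l \<omega> ^ 4) \<le> m4"
  proof -
    have "l \<omega> ^ 4 \<le> D \<omega> ^ 4" for \<omega> using l4[of \<omega>] by simp
    then have "expectation (\<lambda>\<omega>. l \<omega> ^ 4) \<le> expectation (\<lambda>\<omega>. D \<omega> ^ 4)"
      by (rule integral_mono[OF il4 D4(1)])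
    then show ?thesis using D4(2) by linarith
  qed
  have "expectation (\<lambda>\<omega>. (X \<omega>) ^ 4) \<le> expectation (\<lambda>\<omega>. 8 * (l \<omega> ^ 4 + (expectation l) ^ 4))"
    by (rule integral_mono[OF iX4 ib4 pw4])
  also have "\<dots> = 8 * (expectation (\<lambda>\<omega>. l \<omega> ^ 4) + (expectation l) ^ 4)"
    using il4 by (simp add: prob_space)
  also have "\<dots> \<le> 8 * (m4 + s2 ^ 4)" using l4m El4 by simp
  finally show "expectation (\<lambda>\<omega>. (X \<omega>) ^ 4) \<le> 8 * (m4 + s2 ^ 4)" .
  have EX2: "expectation (\<lambda>\<omega>. (X \<omega>)\<^sup>2) = expectation (\<lambda>\<omega>. l \<omega> ^ 2) - (expectation l)\<^sup>2"
    unfolding X2 using il il2 by (simp add: prob_space power2_eq_square)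
  have E\<rho>2: "expectation (\<lambda>\<omega>. \<rho> \<omega> ^ 2) \<le> 2 * m4 + 8 * v\<^sup>2 * s2"
  proof -
    have "expectation (\<lambda>\<omega>. \<rho> \<omega> ^ 2) \<le> expectation (\<lambda>\<omega>. 2 * D \<omega> ^ 4 + 8 * v\<^sup>2 * D \<omega> ^ 2)"
      by (rule integral_mono[OF i\<rho>2 i\<rho>b \<rho>2])
    also have "\<dots> \<le> 2 * m4 + 8 * v\<^sup>2 * s2" using D4 D2 by simp
    finally show ?thesis .
  qed
  \<comment> \<open>\<open>D\<close> has mean 0, hence the mean of \<open>l\<close> is minus that of
    \<rho>, and its square is bounded by the second moment of \<rho>.\<close>
  have "(expectation l)\<^sup>2 = (expectation \<rho>)\<^sup>2"
    unfolding \<rho>_def[abs_def] using D1 il by simp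
  also have "\<dots> \<le> expectation (\<lambda>\<omega>. \<rho> \<omega> ^ 2)"
  proof -
    have "0 \<le> expectation (\<lambda>\<omega>. (\<rho> \<omega> - expectation \<rho>)\<^sup>2)" by (intro Bochner_Integration.integral_nonneg) simp
    also have "\<dots> = expectation (\<lambda>\<omega>. \<rho> \<omega> ^ 2) - (expectation \<rho>)\<^sup>2"
      using i\<rho> i\<rho>2 by (simp add: power2_diff prob_space) (simp add: power2_eq_square)
    finally show ?thesis by simp
  qed
  finally have El2: "(expectation l)\<^sup>2 \<le> 2 * m4 + 8 * v\<^sup>2 * s2" using E\<rho>2 by simp
  define W where "W \<omega> = (\<kappa> + 4 * v + 8 * v\<^sup>2) * D \<omega> ^ 2 + (1 / \<kappa> + 2) * D \<omega> ^ 4" for \<omega>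
  have W: "\<bar>l \<omega> ^ 2 - D \<omega> ^ 2\<bar> \<le> W \<omega>" for \<omega>
  proof -
    have "l \<omega> ^ 2 - D \<omega> ^ 2 = \<rho> \<omega> ^ 2 - 2 * (D \<omega> * \<rho> \<omega>)"
      by (simp add: \<rho>_def power2_eq_square algebra_simps)
    then have "\<bar>l \<omega> ^ 2 - D \<omega> ^ 2\<bar> \<le> \<rho> \<omega> ^ 2 + 2 * \<bar>D \<omega> * \<rho> \<omega>\<bar>"
      by (smt (verit) zero_le_power2)
    moreover have "\<bar>D \<omega> * \<rho> \<omega>\<bar> \<le> \<bar>D \<omega>\<bar> ^ 3 + 2 * v * D \<omega> ^ 2"
    proof -
      have "\<bar>D \<omega> * \<rho> \<omega>\<bar> \<le> \<bar>D \<omega>\<bar> * (D \<omega> ^ 2 + 2 * v * \<bar>D \<omega>\<bar>)"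
        unfolding abs_mult by (intro mult_left_mono \<rho>_abs) simp
      also have "\<dots> = \<bar>D \<omega>\<bar> ^ 3 + 2 * v * \<bar>D \<omega>\<bar> ^ 2"
        by (subst power2_abs[symmetric]) (simp add: algebra_simps power2_eq_square power3_eq_cube del: power2_abs)
      finally show ?thesis by simp
    qed
    \<comment> \<open>Arithmetic-geometric mean inequality with weight \<kappa>.\<close>
    moreover have "2 * \<bar>D \<omega>\<bar> ^ 3 \<le> \<kappa> * D \<omega> ^ 2 + 1 / \<kappa> * D \<omega> ^ 4"
    proof -
      have "0 \<le> 1 / \<kappa> * (\<bar>D \<omega>\<bar> * (\<kappa> - \<bar>D \<omega>\<bar>))\<^sup>2" using \<kappa> by simp
      also have "\<dots> = \<kappa> * \<bar>D \<omega>\<bar> ^ 2 + 1 / \<kappa> * \<bar>D \<omega>\<bar> ^ 4 - 2 * \<bar>D \<omega>\<bar> ^ 3"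
        using \<kappa> by (simp add: field_simps power2_eq_square power3_eq_cube power4_eq_xxxx del: abs_mult_self_eq)
      finally show ?thesis by simp
    qed
    ultimately show ?thesis
      using \<rho>2[of \<omega>] unfolding W_def by (simp add: algebra_simps)
  qed
  have iW: "integrable M W" unfolding W_def[abs_def] using D2(1) D4(1) by simp
  have "\<bar>expectation (\<lambda>\<omega>. l \<omega> ^ 2) - s2\<bar> = \<bar>expectation (\<lambda>\<omega>. l \<omega> ^ 2 - D \<omega> ^ 2)\<bar>"
    using il2 D2 by simp
  also have "\<dots> \<le> expectation W"
    by (rule abs_expectation_le[OF _ iW W]) (use il2 D2 in simp)
  also have "\<dots> = (\<kappa> + 4 * v + 8 * v\<^sup>2) * s2 + (1 / \<kappa> + 2) * expectation (\<lambda>\<omega>. D \<omega> ^ 4)"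
    unfolding W_def[abs_def] using D2 D4(1) by simp
  also have "\<dots> \<le> (\<kappa> + 4 * v + 8 * v\<^sup>2) * s2 + (1 / \<kappa> + 2) * m4"
    using D4(2) \<kappa> by (intro add_left_mono mult_left_mono) auto
  finally have "\<bar>expectation (\<lambda>\<omega>. l \<omega> ^ 2) - s2\<bar> \<le> (\<kappa> + 4 * v + 8 * v\<^sup>2) * s2 + (1 / \<kappa> + 2) * m4" .
  moreover have "(\<kappa> + 4 * v + 8 * v\<^sup>2) * s2 + (1 / \<kappa> + 2) * m4 + (2 * m4 + 8 * v\<^sup>2 * s2) =
      (\<kappa> + 4 * v + 16 * v\<^sup>2) * s2 + (1 / \<kappa> + 4) * m4"
    by (simp add: algebra_simps)
  moreover have "0 \<le> (expectation l)\<^sup>2" by simp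
  ultimately show "\<bar>expectation (\<lambda>\<omega>. (X \<omega>)\<^sup>2) - s2\<bar> \<le> (\<kappa> + 4 * v + 16 * v\<^sup>2) * s2 + (1 / \<kappa> + 4) * m4"
    using El2 unfolding EX2 by linarith
qed

text \<open>\<open>U = B / A\<close> with \<open>B \<sim> \<chi>\<^sup>2\<^sub>q\<close> and \<open>A \<sim> \<chi>\<^sup>2\<^sub>\<nu>\<close> independent.\<close>
context
  fixes n :: nat and I J :: "nat set" and q \<nu> t :: real and U :: "(nat \<Rightarrow> real) \<Rightarrow> real"
  assumes disj: "I \<inter> J = {}" and sub: "I \<subseteq> {..<n}" "J \<subseteq> {..<n}"
    and big: "16 \<le> card J" and le: "card I \<le> card J"
  defines "q \<equiv> real (card I)" and "\<nu> \<equiv> real (card J)" and "t \<equiv> real (card J) - 2"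
    and "U \<equiv> \<lambda>x. sq_sum I x / sq_sum J x"
begin

interpretation G: prob_space "gauss n" by (rule prob_space_gauss)

text \<open>As a cardinality, \<open>q\<close> is 0 or at least 1, so
  \<open>q \<le> q\<^sup>2\<close> throughout; this merges lower-order terms into multiples of
  \<open>q\<^sup>2\<close>. The shift \<open>t = \<nu> - 2\<close> is the one for which
  \<open>1 / A\<close> has mean \<open>1 / t\<close>.\<close>

lemma chi_q: "0 \<le> q" "q \<le> \<nu>" "q = 0 \<or> 1 \<le> q" and chi_t: "t = \<nu> - 2" "14 \<le> t"
  using le big by (auto simp: q_def \<nu>_def t_def)

lemma chi_U_nonneg: "0 \<le> U x"
  by (simp add: U_def sq_sum_nonneg)

lemma chi_inverse_moments:
  shows "has_bochner_integral (gauss n) (\<lambda>x. (1 / sq_sum J x) ^ 1) (1 / t)"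
    and "has_bochner_integral (gauss n) (\<lambda>x. (1 / sq_sum J x) ^ 2) (1 / (t * (t - 2)))"
    and "has_bochner_integral (gauss n) (\<lambda>x. (1 / sq_sum J x) ^ 3) (1 / (t * (t - 2) * (t - 4)))"
    and "has_bochner_integral (gauss n) (\<lambda>x. (1 / sq_sum J x) ^ 4) (1 / (t * (t - 2) * (t - 4) * (t - 6)))"
proof -
  have p: "(\<Prod>i<Suc 0. real (card J) - 2 - 2 * real i) = t"
    "(\<Prod>i<Suc 1. real (card J) - 2 - 2 * real i) = t * (t - 2)"
    "(\<Prod>i<Suc 2. real (card J) - 2 - 2 * real i) = t * (t - 2) * (t - 4)"
    "(\<Prod>i<Suc 3. real (card J) - 2 - 2 * real i) = t * (t - 2) * (t - 4) * (t - 6)"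
    by (simp_all add: t_def numeral_eq_Suc)
  have b: "real (card J) > 2 * real k + 2" if "k \<le> 3" for k using big that by linarith
  show "has_bochner_integral (gauss n) (\<lambda>x. (1 / sq_sum J x) ^ 1) (1 / t)"
    using sq_sum_inverse_moment[OF sub(2) b[of 0]] unfolding p by (simp add: power_one_over)
  show "has_bochner_integral (gauss n) (\<lambda>x. (1 / sq_sum J x) ^ 2) (1 / (t * (t - 2)))"
    using sq_sum_inverse_moment[OF sub(2) b[of 1]] unfolding p by (simp add: power_one_over numeral_eq_Suc)
  show "has_bochner_integral (gauss n) (\<lambda>x. (1 / sq_sum J x) ^ 3) (1 / (t * (t - 2) * (t - 4)))"
    using sq_sum_inverse_moment[OF sub(2) b[of 2]] unfolding p by (simp add: power_one_over numeral_eq_Suc)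
  show "has_bochner_integral (gauss n) (\<lambda>x. (1 / sq_sum J x) ^ 4) (1 / (t * (t - 2) * (t - 4) * (t - 6)))"
    using sq_sum_inverse_moment[OF sub(2) b[of 3]] unfolding p by (simp add: power_one_over numeral_eq_Suc)
qed

lemma chi_mult:
  assumes [measurable]: "f \<in> borel_measurable borel" "g \<in> borel_measurable borel"
    and "has_bochner_integral (gauss n) (\<lambda>x. f (sq_sum I x)) a" "has_bochner_integral (gauss n) (\<lambda>x. g (sq_sum J x)) b"
  shows "has_bochner_integral (gauss n) (\<lambda>x. f (sq_sum I x) * g (sq_sum J x)) (a * b :: real)"
  by (rule G.indep_var_has_bochner_integral_mult[OF indep_var_sq_sum[OF disj sub] assms])

lemma chi_U_mean: "has_bochner_integral (gauss n) U (q / t)"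
  using chi_mult[of "\<lambda>x. x ^ 1" "\<lambda>x. (1 / x) ^ 1", OF _ _ sq_sum_moments(1)[OF sub(1)] chi_inverse_moments(1)]
  by (simp add: U_def q_def)

lemma chi_U_variance:
  "has_bochner_integral (gauss n) (\<lambda>x. (U x - q / t)\<^sup>2) (2 * q * (q + t) / (t\<^sup>2 * (t - 2)))"
proof -
  have "has_bochner_integral (gauss n) (\<lambda>x. (U x)\<^sup>2) (q * (q + 2) * (1 / (t * (t - 2))))"
    using chi_mult[of "\<lambda>x. x^2" "\<lambda>x. (1 / x)^2", OF _ _ sq_sum_moments(2)[OF sub(1)] chi_inverse_moments(2)]
    by (simp add: U_def q_def power_divide)
  moreover have "has_bochner_integral (gauss n) (\<lambda>x. (q / t)\<^sup>2) ((q / t)\<^sup>2)"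
    using G.prob_space by (simp add: has_bochner_integral_iff)
  ultimately have "has_bochner_integral (gauss n) (\<lambda>x. (U x)\<^sup>2 - 2 * (q / t) * U x + (q / t)\<^sup>2)
      (q * (q + 2) * (1 / (t * (t - 2))) - 2 * (q / t) * (q / t) + (q / t)\<^sup>2)"
    by (intro has_bochner_integral_add has_bochner_integral_diff has_bochner_integral_mult_right chi_U_mean)
  moreover have "(U x)\<^sup>2 - 2 * (q / t) * U x + (q / t)\<^sup>2 = (U x - q / t)\<^sup>2" for x
    by (simp add: power2_diff)
  moreover have "q * (q + 2) * (1 / (t * (t - 2))) - 2 * (q / t) * (q / t) + (q / t)\<^sup>2 =
      2 * q * (q + t) / (t\<^sup>2 * (t - 2))"
    using chi_t by (simp add: field_simps power2_eq_square)
  ultimately show ?thesis by simp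
qed

text \<open>With \<open>A\<close> now denoting the inverse of the denominator,
  \<open>U - q / t = (B - q) * A + q * (A - 1 / t)\<close> separates the fluctuation of the
  numerator from that of the denominator. Each part has an explicit fourth moment by independence,
  in which the leading terms cancel.\<close>

lemma chi_U_fourth:
  shows "integrable (gauss n) (\<lambda>x. (U x - q / t) ^ 4)"
    and "(\<integral>x. (U x - q / t) ^ 4 \<partial>gauss n) \<le> 20000 * q\<^sup>2 / \<nu> ^ 4"
proof -
  let ?h = "has_bochner_integral (gauss n)"
  let ?B = "sq_sum I" and ?A = "\<lambda>x. 1 / sq_sum J x"
  have one: "?h (\<lambda>x. c) c" for c :: real using G.prob_space by (simp add: has_bochner_integral_iff)
  have "?h (\<lambda>x. ?B x ^ 4 - 4 * q * ?B x ^ 3 + 6 * q\<^sup>2 * ?B x ^ 2 - 4 * q ^ 3 * ?B x ^ 1 + q ^ 4)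
     (q * (q + 2) * (q + 4) * (q + 6) - 4 * q * (q * (q + 2) * (q + 4)) + 6 * q\<^sup>2 * (q * (q + 2)) - 4 * q ^ 3 * q + q ^ 4)"
    unfolding q_def
    by (intro has_bochner_integral_add has_bochner_integral_diff has_bochner_integral_mult_right
        sq_sum_moments[OF sub(1)] one)
  moreover have "?B x ^ 4 - 4 * q * ?B x ^ 3 + 6 * q\<^sup>2 * ?B x ^ 2 - 4 * q ^ 3 * ?B x ^ 1 + q ^ 4 = (?B x - q) ^ 4" for x
    by (simp add: algebra_simps power2_eq_square power3_eq_cube power4_eq_xxxx)
  moreover have "q * (q + 2) * (q + 4) * (q + 6) - 4 * q * (q * (q + 2) * (q + 4)) + 6 * q\<^sup>2 * (q * (q + 2)) - 4 * q ^ 3 * q + q ^ 4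
     = 12 * q\<^sup>2 + 48 * q"
    by (simp add: algebra_simps power2_eq_square power3_eq_cube power4_eq_xxxx)
  ultimately have B4: "?h (\<lambda>x. (?B x - q) ^ 4) (12 * q\<^sup>2 + 48 * q)" by simp
  have BA: "?h (\<lambda>x. (?B x - q) ^ 4 * ?A x ^ 4) ((12 * q\<^sup>2 + 48 * q) * (1 / (t * (t - 2) * (t - 4) * (t - 6))))"
    using chi_mult[of "\<lambda>x. (x - q) ^ 4" "\<lambda>x. (1 / x) ^ 4", OF _ _ B4 chi_inverse_moments(4)] by simp
  have "?h (\<lambda>x. ?A x ^ 4 - 4 * (1 / t) * ?A x ^ 3 + 6 * (1 / t)\<^sup>2 * ?A x ^ 2 - 4 * (1 / t) ^ 3 * ?A x ^ 1 + (1 / t) ^ 4)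
     (1 / (t * (t - 2) * (t - 4) * (t - 6)) - 4 * (1 / t) * (1 / (t * (t - 2) * (t - 4))) +
      6 * (1 / t)\<^sup>2 * (1 / (t * (t - 2))) - 4 * (1 / t) ^ 3 * (1 / t) + (1 / t) ^ 4)"
    by (intro has_bochner_integral_add has_bochner_integral_diff has_bochner_integral_mult_right
        chi_inverse_moments one)
  moreover have "?A x ^ 4 - 4 * (1 / t) * ?A x ^ 3 + 6 * (1 / t)\<^sup>2 * ?A x ^ 2 - 4 * (1 / t) ^ 3 * ?A x ^ 1 + (1 / t) ^ 4
      = (?A x - 1 / t) ^ 4" for x
  proof -
    have "a ^ 4 - 4 * b * a ^ 3 + 6 * b\<^sup>2 * a ^ 2 - 4 * b ^ 3 * a ^ 1 + b ^ 4 = (a - b) ^ 4" for a b :: real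
      by (simp add: algebra_simps power2_eq_square power3_eq_cube power4_eq_xxxx)
    then show ?thesis .
  qed
  moreover have "1 / (t * (t - 2) * (t - 4) * (t - 6)) - 4 * (1 / t) * (1 / (t * (t - 2) * (t - 4))) +
      6 * (1 / t)\<^sup>2 * (1 / (t * (t - 2))) - 4 * (1 / t) ^ 3 * (1 / t) + (1 / t) ^ 4 =
      (12 * t + 144) / (t ^ 4 * ((t - 2) * (t - 4) * (t - 6)))"
  proof -
    \<comment> \<open>The factors become atoms while the denominators are cleared and are expanded
      only afterwards, where the cubic and quadratic terms in \<open>t\<close> cancel.\<close>
    define a b c where "a = t - 2" and "b = t - 4" and "c = t - 6"
    have "t \<noteq> 0" "a \<noteq> 0" "b \<noteq> 0" "c \<noteq> 0" using chi_t by (auto simp: a_def b_def c_def)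
    then have "1 / (t * a * b * c) - 4 * (1 / t) * (1 / (t * a * b)) +
      6 * (1 / t)\<^sup>2 * (1 / (t * a)) - 4 * (1 / t) ^ 3 * (1 / t) + (1 / t) ^ 4 =
      (t ^ 3 - 4 * t\<^sup>2 * c + 6 * t * b * c - 3 * (a * b * c)) / (t ^ 4 * (a * b * c))"
      by (simp add: field_simps power2_eq_square power3_eq_cube power4_eq_xxxx)
    also have "t ^ 3 - 4 * t\<^sup>2 * c + 6 * t * b * c - 3 * (a * b * c) = 12 * t + 144"
      by (simp add: a_def b_def c_def algebra_simps power2_eq_square power3_eq_cube)
    finally show ?thesis by (simp only: a_def b_def c_def)
  qed
  ultimately have A4: "?h (\<lambda>x. (?A x - 1 / t) ^ 4) ((12 * t + 144) / (t ^ 4 * ((t - 2) * (t - 4) * (t - 6))))" by simp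
  have qA: "?h (\<lambda>x. q ^ 4 * (?A x - 1 / t) ^ 4) (q ^ 4 * ((12 * t + 144) / (t ^ 4 * ((t - 2) * (t - 4) * (t - 6)))))"
    by (intro has_bochner_integral_mult_right A4)
  have bound: "?h (\<lambda>x. 8 * ((?B x - q) ^ 4 * ?A x ^ 4 + q ^ 4 * (?A x - 1 / t) ^ 4))
     (8 * ((12 * q\<^sup>2 + 48 * q) * (1 / (t * (t - 2) * (t - 4) * (t - 6))) +
       q ^ 4 * ((12 * t + 144) / (t ^ 4 * ((t - 2) * (t - 4) * (t - 6))))))"
    by (intro has_bochner_integral_add has_bochner_integral_mult_right BA qA)
  have pw: "(U x - q / t) ^ 4 \<le> 8 * ((?B x - q) ^ 4 * ?A x ^ 4 + q ^ 4 * (?A x - 1 / t) ^ 4)" for x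
  proof -
    have "U x - q / t = (?B x - q) * ?A x + q * (?A x - 1 / t)"
      by (simp add: U_def algebra_simps diff_divide_distrib)
    then have "(U x - q / t) ^ 4 \<le> 8 * (((?B x - q) * ?A x) ^ 4 + (q * (?A x - 1 / t)) ^ 4)"
      by (simp only: power4_add_le)
    then show ?thesis by (simp only: power_mult_distrib)
  qed
  show int: "integrable (gauss n) (\<lambda>x. (U x - q / t) ^ 4)"
  proof (rule Bochner_Integration.integrable_bound)
    show "integrable (gauss n) (\<lambda>x. 8 * ((?B x - q) ^ 4 * ?A x ^ 4 + q ^ 4 * (?A x - 1 / t) ^ 4))"
      using bound by (simp add: has_bochner_integral_iff)
    show "(\<lambda>x. (U x - q / t) ^ 4) \<in> borel_measurable (gauss n)" unfolding U_def by measurable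
    show "AE x in gauss n. norm ((U x - q / t) ^ 4) \<le> norm (8 * ((?B x - q) ^ 4 * ?A x ^ 4 + q ^ 4 * (?A x - 1 / t) ^ 4))"
      using pw by (intro AE_I2) (simp add: order_trans[OF pw abs_ge_self])
  qed
  have "(\<integral>x. (U x - q / t) ^ 4 \<partial>gauss n) \<le>
     8 * ((12 * q\<^sup>2 + 48 * q) * (1 / (t * (t - 2) * (t - 4) * (t - 6))) +
       q ^ 4 * ((12 * t + 144) / (t ^ 4 * ((t - 2) * (t - 4) * (t - 6)))))"
    using integral_mono[OF int _ pw] bound by (simp add: has_bochner_integral_iff)
  \<comment> \<open>Numerator and denominator part contribute 60 * 16 = 960 and 24 * 64 = 1536; 8 *
    (960 + 1536) = 19968 explains the constant 20000.\<close>
  also have "\<dots> \<le> 8 * (60 * q\<^sup>2 * (16 / \<nu> ^ 4) + q\<^sup>2 * (1536 / \<nu> ^ 4))"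
  proof (intro mult_left_mono add_mono)
    have \<nu>: "16 \<le> \<nu>" using chi_t by simp
    \<comment> \<open>The assumption \<open>16 \<le> card J\<close> is exactly
      \<open>\<nu> / 2 \<le> \<nu> - 8\<close>, which keeps all denominators comparable to powers of
      \<nu>.\<close>
    have h: "\<nu> / 2 \<le> t - 6" "\<nu> / 2 \<le> t - 4" "\<nu> / 2 \<le> t - 2" "\<nu> / 2 \<le> t" using \<nu> chi_t(1) by auto
    have prod3: "(\<nu> / 2) * (\<nu> / 2) * (\<nu> / 2) \<le> (t - 2) * (t - 4) * (t - 6)"
      using h \<nu> by (intro mult_mono) auto
    then have prod4: "(\<nu> / 2) * ((\<nu> / 2) * (\<nu> / 2) * (\<nu> / 2)) \<le> t * ((t - 2) * (t - 4) * (t - 6))"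
      using h \<nu> by (intro mult_mono) auto
    have "12 * q\<^sup>2 + 48 * q \<le> 60 * q\<^sup>2"
      using chi_q(3) by (auto simp: power2_eq_square)
    moreover have "1 / (t * (t - 2) * (t - 4) * (t - 6)) \<le> 16 / \<nu> ^ 4"
    proof -
      have "1 / (t * ((t - 2) * (t - 4) * (t - 6))) \<le> 1 / ((\<nu> / 2) * ((\<nu> / 2) * (\<nu> / 2) * (\<nu> / 2)))"
        using prod4 \<nu> by (intro divide_left_mono) (auto intro!: mult_pos_pos simp: chi_t(1))
      then show ?thesis by (simp add: power4_eq_xxxx mult.assoc)
    qed
    ultimately show "(12 * q\<^sup>2 + 48 * q) * (1 / (t * (t - 2) * (t - 4) * (t - 6))) \<le> 60 * q\<^sup>2 * (16 / \<nu> ^ 4)"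
      using chi_t by (intro mult_mono) auto
    have "(12 * t + 144) / (t ^ 4 * ((t - 2) * (t - 4) * (t - 6))) \<le> (24 * t) / (t ^ 4 * ((\<nu> / 2) * (\<nu> / 2) * (\<nu> / 2)))"
      using prod3 \<nu> chi_t by (intro frac_le mult_left_mono) auto
    also have "\<dots> = 24 / (t * t * t * ((\<nu> / 2) * (\<nu> / 2) * (\<nu> / 2)))"
      using chi_t(2) by (simp add: power4_eq_xxxx)
    also have "\<dots> \<le> 24 / (((\<nu> / 2) * (\<nu> / 2) * (\<nu> / 2)) * ((\<nu> / 2) * (\<nu> / 2) * (\<nu> / 2)))"
      using h \<nu> chi_t by (intro divide_left_mono mult_right_mono mult_mono) auto
    also have "\<dots> = 1536 / \<nu> ^ 6" by (simp add: numeral_eq_Suc)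
    finally have "(12 * t + 144) / (t ^ 4 * ((t - 2) * (t - 4) * (t - 6))) \<le> 1536 / \<nu> ^ 6" .
    then have "q ^ 4 * ((12 * t + 144) / (t ^ 4 * ((t - 2) * (t - 4) * (t - 6)))) \<le> q ^ 4 * (1536 / \<nu> ^ 6)"
      by (intro mult_left_mono) auto
    also have "q ^ 4 \<le> q\<^sup>2 * \<nu>\<^sup>2"
      using chi_q \<nu> mult_left_mono[of "q\<^sup>2" "\<nu>\<^sup>2" "q\<^sup>2"] by (simp add: power4_eq_xxxx power2_eq_square mult.assoc mult_mono)
    then have "q ^ 4 * (1536 / \<nu> ^ 6) \<le> q\<^sup>2 * \<nu>\<^sup>2 * (1536 / \<nu> ^ 6)" using \<nu> by (intro mult_right_mono) auto
    also have "\<dots> = q\<^sup>2 * (1536 / \<nu> ^ 4)" using \<nu> by (simp add: numeral_eq_Suc)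
    finally show "q ^ 4 * ((12 * t + 144) / (t ^ 4 * ((t - 2) * (t - 4) * (t - 6)))) \<le> q\<^sup>2 * (1536 / \<nu> ^ 4)" .
  qed simp
  also have "\<dots> \<le> 20000 * q\<^sup>2 / \<nu> ^ 4"
    using chi_t(1,2) by (simp add: divide_simps)
  finally show "(\<integral>x. (U x - q / t) ^ 4 \<partial>gauss n) \<le> 20000 * q\<^sup>2 / \<nu> ^ 4" .
qed

text \<open>The exact variance of \<open>U\<close> is \<open>2 * q / \<nu>\<^sup>2\<close> up to a
  relative error of order \<open>q / \<nu>\<close>. In the last bound 64 is 16 + 48: the first from
  the term quadratic in \<open>q\<close>, the second from replacing \<open>t * (t - 2)\<close> by
  \<open>\<nu>\<^sup>2\<close>.\<close>

lemma chi_s2: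
  shows "2 * q / \<nu>\<^sup>2 \<le> 2 * q * (q + t) / (t\<^sup>2 * (t - 2))"
    and "2 * q * (q + t) / (t\<^sup>2 * (t - 2)) \<le> 32 * q / \<nu>\<^sup>2"
    and "2 * q * (q + t) / (t\<^sup>2 * (t - 2)) \<le> 2 * q / \<nu>\<^sup>2 + 64 * q\<^sup>2 / \<nu> ^ 3"
proof -
  have \<nu>: "16 \<le> \<nu>" using chi_t by simp
  have h: "\<nu> / 2 \<le> t - 2" "\<nu> / 2 \<le> t" "t \<le> \<nu>" using \<nu> chi_t(1) by auto
  have pos: "0 < t" "0 < t - 2" "0 < \<nu>" using \<nu> h by auto
  have split: "2 * q * (q + t) / (t\<^sup>2 * (t - 2)) = 2 * q * (q / (t\<^sup>2 * (t - 2)) + 1 / (t * (t - 2)))"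
  proof -
    define a where "a = t - 2"
    have "a \<noteq> 0" "t \<noteq> 0" using pos by (auto simp: a_def)
    then have "2 * q * (q + t) / (t\<^sup>2 * a) = 2 * q * (q / (t\<^sup>2 * a) + 1 / (t * a))"
      by (simp add: field_simps power2_eq_square)
    then show ?thesis by (simp only: a_def)
  qed
  have tt: "t * (t - 2) \<le> \<nu>\<^sup>2" unfolding power2_eq_square using h pos by (intro mult_mono) auto
  have t2: "(\<nu> / 2) * (\<nu> / 2) \<le> t * (t - 2)" using h pos by (intro mult_mono) auto
  have t3: "(\<nu> / 2) * (\<nu> / 2) * (\<nu> / 2) \<le> t\<^sup>2 * (t - 2)"
    unfolding power2_eq_square using h pos by (intro mult_mono) auto
  have a: "q / (t\<^sup>2 * (t - 2)) \<le> 8 * q / \<nu> ^ 3"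
  proof -
    have "q / (t\<^sup>2 * (t - 2)) \<le> q / ((\<nu> / 2) * (\<nu> / 2) * (\<nu> / 2))"
      using t3 pos chi_q(1) by (intro divide_left_mono) auto
    then show ?thesis by (simp add: power3_eq_cube mult_ac)
  qed
  have b0: "1 / \<nu>\<^sup>2 \<le> 1 / (t * (t - 2))" using tt pos by (intro divide_left_mono) auto
  have b: "1 / (t * (t - 2)) \<le> 1 / \<nu>\<^sup>2 + 24 / \<nu> ^ 3"
  proof -
    have "1 / (t * (t - 2)) - 1 / \<nu>\<^sup>2 = (\<nu>\<^sup>2 - t * (t - 2)) / (\<nu>\<^sup>2 * (t * (t - 2)))"
      using pos by (simp add: field_simps)
    also have "\<dots> \<le> (6 * \<nu>) / (\<nu>\<^sup>2 * ((\<nu> / 2) * (\<nu> / 2)))"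
    proof (rule frac_le)
      \<comment> \<open>With \<open>t = \<nu> - 2\<close> the left side is
        \<open>6 * \<nu> - 8\<close>.\<close>
      show "\<nu>\<^sup>2 - t * (t - 2) \<le> 6 * \<nu>" using pos by (simp add: chi_t(1) power2_eq_square algebra_simps)
      show "\<nu>\<^sup>2 * ((\<nu> / 2) * (\<nu> / 2)) \<le> \<nu>\<^sup>2 * (t * (t - 2))" using t2 by (intro mult_left_mono) auto
    qed (use pos in auto)
    also have "\<dots> = 24 / \<nu> ^ 3" using pos by (simp add: power2_eq_square power3_eq_cube)
    finally show ?thesis by simp
  qed
  show "2 * q / \<nu>\<^sup>2 \<le> 2 * q * (q + t) / (t\<^sup>2 * (t - 2))"
  proof -
    have "2 * q * (1 / \<nu>\<^sup>2) \<le> 2 * q * (q / (t\<^sup>2 * (t - 2)) + 1 / (t * (t - 2)))"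
      using b0 pos chi_q(1) by (intro mult_left_mono add_increasing) auto
    then show ?thesis unfolding split by simp
  qed
  have ab: "2 * q * (q + t) / (t\<^sup>2 * (t - 2)) \<le> 2 * q * (8 * q / \<nu> ^ 3 + (1 / \<nu>\<^sup>2 + 24 / \<nu> ^ 3))"
    unfolding split using a b chi_q(1) by (intro mult_left_mono add_mono) auto
  show "2 * q * (q + t) / (t\<^sup>2 * (t - 2)) \<le> 32 * q / \<nu>\<^sup>2"
  proof -
    have "8 * q / \<nu> ^ 3 + (1 / \<nu>\<^sup>2 + 24 / \<nu> ^ 3) \<le> 16 / \<nu>\<^sup>2"
    proof -
      have "8 * q / \<nu> ^ 3 \<le> 8 / \<nu>\<^sup>2"
        using chi_q(2) pos by (simp add: field_simps power2_eq_square power3_eq_cube)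
      moreover have "24 / \<nu> ^ 3 \<le> 7 / \<nu>\<^sup>2"
        using \<nu> by (simp add: field_simps power2_eq_square power3_eq_cube)
      ultimately show ?thesis by (simp add: add_divide_distrib[symmetric])
    qed
    from mult_left_mono[OF this, of "2 * q"] show ?thesis using ab chi_q(1) by simp
  qed
  show "2 * q * (q + t) / (t\<^sup>2 * (t - 2)) \<le> 2 * q / \<nu>\<^sup>2 + 64 * q\<^sup>2 / \<nu> ^ 3"
  proof -
    have "2 * q * (8 * q / \<nu> ^ 3 + (1 / \<nu>\<^sup>2 + 24 / \<nu> ^ 3)) = 2 * q / \<nu>\<^sup>2 + (16 * q\<^sup>2 + 48 * q) / \<nu> ^ 3"
      by (simp add: distrib_left add_divide_distrib power2_eq_square)
    also have "\<dots> \<le> 2 * q / \<nu>\<^sup>2 + 64 * q\<^sup>2 / \<nu> ^ 3"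
    proof -
      have "16 * q\<^sup>2 + 48 * q \<le> 64 * q\<^sup>2" using chi_q(3) by (auto simp: power2_eq_square)
      then show ?thesis using pos by (simp add: divide_right_mono)
    qed
    finally show ?thesis using ab by simp
  qed
qed

text \<open>The bias of the mean has the order of the variance of \<open>U\<close>, so the summed
  bias is of order f / n^2. The variance is needed with its leading constant, the fourth moment only
  in order of magnitude.\<close>

lemma chi_log:
  defines "\<xi> \<equiv> \<lambda>x. ln (1 + U x)"
  defines "X \<equiv> \<lambda>x. \<xi> x - (\<integral>x. \<xi> x \<partial>gauss n)"
  shows "integrable (gauss n) \<xi>" and "integrable (gauss n) (\<lambda>x. (X x)\<^sup>2)" and "integrable (gauss n) (\<lambda>x. (X x) ^ 4)"
    and "\<bar>(\<integral>x. \<xi> x \<partial>gauss n) - ln (1 + q / \<nu>)\<bar> \<le> 40 * q / \<nu>\<^sup>2"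
    and "\<bar>(\<integral>x. (X x)\<^sup>2 \<partial>gauss n) - 2 * q / \<nu>\<^sup>2\<bar> \<le> 200000 * q\<^sup>2 / \<nu> ^ 3"
    and "(\<integral>x. (X x) ^ 4 \<partial>gauss n) \<le> 300000 * q\<^sup>2 / \<nu> ^ 4"
proof -
  have \<nu>: "16 \<le> \<nu>" using chi_t by simp
  \<comment> \<open>With \<open>\<kappa> = q / \<nu>\<close> both \<open>\<kappa> * s2\<close> and
    \<open>m4 / \<kappa>\<close> are at most of order \<open>q\<^sup>2 / \<nu> ^ 3\<close>. For
    \<open>q = 0\<close> any positive value serves.\<close>
  define \<kappa> where "\<kappa> = (if q = 0 then 1 else q / \<nu>)"
  have \<kappa>: "0 < \<kappa>" using chi_q \<nu> by (auto simp: \<kappa>_def)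
  have v: "0 \<le> q / t" using chi_q chi_t by auto
  have Um: "U \<in> borel_measurable (gauss n)" unfolding U_def by measurable
  let ?s2 = "2 * q * (q + t) / (t\<^sup>2 * (t - 2))" and ?m4 = "20000 * q\<^sup>2 / \<nu> ^ 4"
  have L: "integrable (gauss n) \<xi>" "integrable (gauss n) (\<lambda>x. (X x)\<^sup>2)" "integrable (gauss n) (\<lambda>x. (X x) ^ 4)"
    "ln (1 + q / t) - ?s2 \<le> (\<integral>x. \<xi> x \<partial>gauss n)" "(\<integral>x. \<xi> x \<partial>gauss n) \<le> ln (1 + q / t)"
    "\<bar>(\<integral>x. (X x)\<^sup>2 \<partial>gauss n) - ?s2\<bar> \<le> (\<kappa> + 4 * (q / t) + 16 * (q / t)\<^sup>2) * ?s2 + (1 / \<kappa> + 4) * ?m4"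
    "(\<integral>x. (X x) ^ 4 \<partial>gauss n) \<le> 8 * (?m4 + ?s2 ^ 4)"
    unfolding X_def \<xi>_def
    by (rule G.log_moments[OF Um chi_U_nonneg v chi_U_mean chi_U_variance chi_U_fourth \<kappa>])+
  show "integrable (gauss n) \<xi>" "integrable (gauss n) (\<lambda>x. (X x)\<^sup>2)" "integrable (gauss n) (\<lambda>x. (X x) ^ 4)"
    using L(1-3) by auto
  have s2: "0 \<le> ?s2" using chi_s2(1) chi_q(1) by (meson divide_nonneg_nonneg mult_nonneg_nonneg order_trans zero_le_numeral zero_le_power2)
  have vq: "q / \<nu> \<le> q / t" "q / t \<le> q / \<nu> + 4 * q / \<nu>\<^sup>2" "q / t \<le> 2 * q / \<nu>"
  proof -
    show "q / \<nu> \<le> q / t" using chi_q chi_t by (intro divide_left_mono) auto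
    have "q / t - q / \<nu> = q * (\<nu> - t) / (\<nu> * t)" using \<nu> chi_t(2) by (simp add: field_simps)
    then have e: "q / t - q / \<nu> = 2 * q / (\<nu> * t)" by (simp add: chi_t(1))
    have "2 * q / (\<nu> * t) \<le> 2 * q / (\<nu> * (\<nu> / 2))"
      using chi_q \<nu> chi_t by (intro divide_left_mono mult_left_mono) auto
    then show 1: "q / t \<le> q / \<nu> + 4 * q / \<nu>\<^sup>2" using e by (simp add: power2_eq_square)
    have "q / t \<le> q / (\<nu> / 2)" using chi_q \<nu> chi_t by (intro divide_left_mono) auto
    then show "q / t \<le> 2 * q / \<nu>" by (simp add: mult.commute)
  qed
  have qn: "0 \<le> q / \<nu>" using chi_q \<nu> by auto
  have l1: "ln (1 + q / \<nu>) \<le> ln (1 + q / t)" using vq(1) qn by (intro ln_mono) auto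
  have l2: "ln (1 + q / t) - ln (1 + q / \<nu>) \<le> q / t - q / \<nu>"
  proof -
    have "ln (1 + q / t) - ln (1 + q / \<nu>) = ln ((1 + q / t) / (1 + q / \<nu>))"
      using v qn by (subst ln_div) auto
    also have "\<dots> \<le> (1 + q / t) / (1 + q / \<nu>) - 1"
      using v qn by (intro ln_le_minus_one) (auto intro: divide_pos_pos)
    also have "\<dots> = (q / t - q / \<nu>) / (1 + q / \<nu>)" using qn by (simp add: field_simps)
    also have "\<dots> \<le> (q / t - q / \<nu>) / 1" using vq(1) qn by (intro divide_left_mono) auto
    finally show ?thesis by simp
  qed
  show "\<bar>(\<integral>x. \<xi> x \<partial>gauss n) - ln (1 + q / \<nu>)\<bar> \<le> 40 * q / \<nu>\<^sup>2"
  proof -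
    have "0 \<le> q / \<nu>\<^sup>2" using chi_q by auto
    then show ?thesis using L(4,5) l1 l2 vq(2) chi_s2(2) by (simp add: abs_le_iff)
  qed
  show "(\<integral>x. (X x) ^ 4 \<partial>gauss n) \<le> 300000 * q\<^sup>2 / \<nu> ^ 4"
  proof -
    have "?s2 ^ 4 \<le> (32 * q / \<nu>\<^sup>2) ^ 4" by (intro power_mono chi_s2(2) s2)
    also have "\<dots> = 32 ^ 4 * (q\<^sup>2 * q\<^sup>2) / (\<nu> ^ 4 * (\<nu>\<^sup>2 * \<nu>\<^sup>2))"
      by (simp add: power_divide power_mult_distrib power4_eq_xxxx power2_eq_square)
    also have "\<dots> \<le> 32 ^ 4 * (q\<^sup>2 * \<nu>\<^sup>2) / (\<nu> ^ 4 * (256 * \<nu>\<^sup>2))"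
    proof (intro frac_le mult_left_mono mult_right_mono)
      show "q\<^sup>2 \<le> \<nu>\<^sup>2" using chi_q by (intro power_mono) auto
      show "256 \<le> \<nu>\<^sup>2" using power_mono[OF \<nu>, of 2] by simp
    qed (use \<nu> in auto)
    also have "\<dots> = 4096 * q\<^sup>2 / \<nu> ^ 4" using \<nu> by simp
    finally have "?s2 ^ 4 \<le> 4096 * q\<^sup>2 / \<nu> ^ 4" .
    moreover have "0 \<le> q\<^sup>2 / \<nu> ^ 4" by simp
    \<comment> \<open>Stated for variables and then instantiated, so that linear arithmetic does not
      meet the large terms; 8 * (20000 + 4096) = 192768.\<close>
    moreover have "e \<le> 300000 * y" if "e \<le> 8 * (20000 * y + z)" "z \<le> 4096 * y" "0 \<le> y" for e y z :: real
      using that by (simp add: algebra_simps)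
    note this[of _ "q\<^sup>2 / \<nu> ^ 4" "?s2 ^ 4", unfolded times_divide_eq_right, OF L(7)]
    ultimately show ?thesis by blast
  qed
  show "\<bar>(\<integral>x. (X x)\<^sup>2 \<partial>gauss n) - 2 * q / \<nu>\<^sup>2\<bar> \<le> 200000 * q\<^sup>2 / \<nu> ^ 3"
  proof (cases "q = 0")
    case True
    then show ?thesis using L(6) by simp
  next
    case False
    then have q1: "1 \<le> q" using chi_q(3) by auto
    have q\<nu>: "q / \<nu> \<le> 1" using chi_q(2) \<nu> by simp
    have v2: "(q / t)\<^sup>2 \<le> 4 * (q / \<nu>)"
    proof -
      have "(q / t)\<^sup>2 \<le> (2 * q / \<nu>)\<^sup>2" using vq(3) v by (intro power_mono) auto
      also have "\<dots> = 4 * ((q / \<nu>) * (q / \<nu>))" by (simp add: power2_eq_square)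
      also have "\<dots> \<le> 4 * (1 * (q / \<nu>))" using q\<nu> qn by (intro mult_left_mono mult_right_mono) auto
      finally show ?thesis by simp
    qed
    \<comment> \<open>73 is 1 + 8 + 64, from \<kappa>, from \<open>q / t \<le> 2 * q / \<nu>\<close>
      and from \<open>v2\<close>.\<close>
    have c: "\<kappa> + 4 * (q / t) + 16 * (q / t)\<^sup>2 \<le> 73 * (q / \<nu>)"
      using v2 vq(3) False by (simp add: \<kappa>_def)
    have "(\<kappa> + 4 * (q / t) + 16 * (q / t)\<^sup>2) * ?s2 \<le> 73 * (q / \<nu>) * (32 * q / \<nu>\<^sup>2)"
      using c chi_s2(2) s2 qn by (intro mult_mono) auto
    also have "\<dots> = 2336 * q\<^sup>2 / \<nu> ^ 3" by (simp add: power2_eq_square power3_eq_cube)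
    finally have A: "(\<kappa> + 4 * (q / t) + 16 * (q / t)\<^sup>2) * ?s2 \<le> 2336 * q\<^sup>2 / \<nu> ^ 3" .
    have "(1 / \<kappa> + 4) * ?m4 = 20000 * (q * \<nu> + 4 * q\<^sup>2) / \<nu> ^ 4"
      using False \<nu> by (simp add: \<kappa>_def field_simps power2_eq_square)
    also have "\<dots> \<le> 20000 * (q\<^sup>2 * \<nu> + q\<^sup>2 * \<nu>) / \<nu> ^ 4"
    proof (intro divide_right_mono mult_left_mono add_mono)
      show "q * \<nu> \<le> q\<^sup>2 * \<nu>" using q1 \<nu> by (intro mult_right_mono) (auto simp: power2_eq_square)
      show "4 * q\<^sup>2 \<le> q\<^sup>2 * \<nu>" using \<nu> mult_left_mono[of 4 \<nu> "q\<^sup>2"] by simp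
    qed (use \<nu> in auto)
    also have "\<dots> = 40000 * q\<^sup>2 / \<nu> ^ 3" using \<nu> by (simp add: field_simps power3_eq_cube power4_eq_xxxx)
    finally have B: "(1 / \<kappa> + 4) * ?m4 \<le> 40000 * q\<^sup>2 / \<nu> ^ 3" .
    have "0 \<le> q\<^sup>2 / \<nu> ^ 3" using \<nu> by simp
    moreover have "\<bar>e - b\<bar> \<le> 200000 * y"
      if "\<bar>e - s\<bar> \<le> c1 + c2" "c1 \<le> 2336 * y" "c2 \<le> 40000 * y" "b \<le> s" "s \<le> b + 64 * y" "0 \<le> y"
      for e s c1 c2 b y :: real
      using that by linarith
    note this[of _ _ _ _ "q\<^sup>2 / \<nu> ^ 3", unfolded times_divide_eq_right, OF L(6) A B chi_s2(1,3)]
    ultimately show ?thesis by blast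
  qed
qed

end

section \<open>Normal approximation of the likelihood ratio\<close>

text \<open>After scaling to total variance 1, the third moments of the summands and of their
  Gaussian replacements together are at most \<open>3 * sqrt l\<close>, by the inequality
  \<open>cube\<close> with weight \<open>\<kappa> = sqrt l\<close>. Lindeberg and smoothing then
  give the rate.\<close>

lemma (in prob_space) normal_approximation:
  fixes X :: "nat \<Rightarrow> 'a \<Rightarrow> real" and m :: nat
  assumes ind: "indep_vars (\<lambda>_. borel) X {..<m}"
    and int: "\<And>a. a < m \<Longrightarrow> integrable M (X a)" "\<And>a. a < m \<Longrightarrow> expectation (X a) = 0"
      "\<And>a. a < m \<Longrightarrow> integrable M (\<lambda>\<omega>. (X a \<omega>)\<^sup>2)" "\<And>a. a < m \<Longrightarrow> integrable M (\<lambda>\<omega>. (X a \<omega>) ^ 4)"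
    and V: "V = (\<Sum>a<m. expectation (\<lambda>\<omega>. (X a \<omega>)\<^sup>2))" "V > 0"
    and l: "(\<Sum>a<m. expectation (\<lambda>\<omega>. (X a \<omega>) ^ 4)) \<le> l * V\<^sup>2" "l > 0"
  shows "\<bar>prob {\<omega> \<in> space M. (\<Sum>a<m. X a \<omega>) > sqrt V * t} - normal_tail t\<bar> \<le> 7 * l powr (1 / 8)"
proof -
  define w where "w = 1 / sqrt V"
  have w: "w > 0" "w\<^sup>2 = 1 / V" using V(2) by (auto simp: w_def power_divide)
  define Z where "Z a \<omega> = w * X a \<omega>" for a \<omega>
  define v where "v a = expectation (\<lambda>\<omega>. (Z a \<omega>)\<^sup>2)" for a
  define m4 where "m4 a = expectation (\<lambda>\<omega>. (Z a \<omega>) ^ 4)" for a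
  define \<kappa> where "\<kappa> = sqrt l"
  have \<kappa>: "\<kappa> > 0" "\<kappa> * \<kappa> = l" using l(2) by (auto simp: \<kappa>_def)
  have indZ: "indep_vars (\<lambda>_. borel) Z {..<m}"
    unfolding Z_def[abs_def] by (rule indep_vars_compose2[OF ind]) measurable
  have Zm: "Z a \<in> borel_measurable M" if "a < m" for a
    using indZ that by (auto simp: indep_vars_def2)
  have Z2: "(Z a \<omega>)\<^sup>2 = w\<^sup>2 * (X a \<omega>)\<^sup>2" and Z4: "(Z a \<omega>) ^ 4 = w ^ 4 * (X a \<omega>) ^ 4" for a \<omega>
    by (simp_all add: Z_def power_mult_distrib)
  have iZ: "integrable M (Z a)" "integrable M (\<lambda>\<omega>. (Z a \<omega>)\<^sup>2)" "integrable M (\<lambda>\<omega>. (Z a \<omega>) ^ 4)"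
    "expectation (Z a) = 0" if "a < m" for a
    unfolding Z2 Z4 using int[OF that] by (simp_all add: Z_def[abs_def])
  have cube: "\<bar>x\<bar> ^ 3 \<le> (\<kappa> * x\<^sup>2 + x ^ 4 / \<kappa>) / 2" for x :: real
  proof -
    have "0 \<le> (\<bar>x\<bar> * (\<kappa> - \<bar>x\<bar>))\<^sup>2 / \<kappa>" using \<kappa> by simp
    also have "\<dots> = \<kappa> * \<bar>x\<bar>\<^sup>2 + \<bar>x\<bar> ^ 4 / \<kappa> - 2 * \<bar>x\<bar> ^ 3"
      using \<kappa>(1) by (simp add: field_simps power2_eq_square power3_eq_cube power4_eq_xxxx del: abs_mult_self_eq)
    finally show ?thesis by simp
  qed
  have ib: "integrable M (\<lambda>\<omega>. (\<kappa> * (Z a \<omega>)\<^sup>2 + (Z a \<omega>) ^ 4 / \<kappa>) / 2)" if "a < m" for a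
    using iZ[OF that] by simp
  have i3: "integrable M (\<lambda>\<omega>. \<bar>Z a \<omega>\<bar> ^ 3)" if "a < m" for a
  proof (rule Bochner_Integration.integrable_bound[OF ib[OF that]])
    show "(\<lambda>\<omega>. \<bar>Z a \<omega>\<bar> ^ 3) \<in> borel_measurable M" using Zm[OF that] by measurable
    show "AE \<omega> in M. norm (\<bar>Z a \<omega>\<bar> ^ 3) \<le> norm ((\<kappa> * (Z a \<omega>)\<^sup>2 + (Z a \<omega>) ^ 4 / \<kappa>) / 2)"
      using cube \<kappa>(1) by (intro AE_I2) (simp add: power_abs[symmetric])
  qed
  have third: "expectation (\<lambda>\<omega>. \<bar>Z a \<omega>\<bar> ^ 3) \<le> (\<kappa> * v a + m4 a / \<kappa>) / 2" if "a < m" for a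
  proof -
    have "expectation (\<lambda>\<omega>. \<bar>Z a \<omega>\<bar> ^ 3) \<le> expectation (\<lambda>\<omega>. (\<kappa> * (Z a \<omega>)\<^sup>2 + (Z a \<omega>) ^ 4 / \<kappa>) / 2)"
      by (rule integral_mono[OF i3[OF that] ib[OF that] cube])
    also have "\<dots> = (\<kappa> * v a + m4 a / \<kappa>) / 2"
      using iZ[OF that] by (simp add: v_def m4_def)
    finally show ?thesis .
  qed
  have v0: "0 \<le> v a" for a unfolding v_def by (intro Bochner_Integration.integral_nonneg) simp
  \<comment> \<open>Nonnegativity of the variance of \<open>Z^2\<close>. It makes the fourth-moment
    ratio control the Gaussian replacements as well.\<close>
  have v4: "(v a)\<^sup>2 \<le> m4 a" if "a < m" for a
  proof -
    have "0 \<le> expectation (\<lambda>\<omega>. ((Z a \<omega>)\<^sup>2 - v a)\<^sup>2)" by (intro Bochner_Integration.integral_nonneg) simp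
    also have "\<dots> = expectation (\<lambda>\<omega>. (Z a \<omega>) ^ 4 - 2 * v a * (Z a \<omega>)\<^sup>2 + (v a)\<^sup>2)"
      by (simp add: power2_diff power_mult[symmetric] algebra_simps)
    also have "\<dots> = m4 a - (v a)\<^sup>2"
      using iZ[OF that] by (simp add: v_def[symmetric] m4_def prob_space) (simp add: power2_eq_square)
    finally show ?thesis by simp
  qed
  have sq3: "sqrt (v a) ^ 3 \<le> (\<kappa> * v a + m4 a / \<kappa>) / 2" if "a < m" for a
  proof -
    have "sqrt (v a) ^ 3 \<le> (\<kappa> * (sqrt (v a))\<^sup>2 + (sqrt (v a)) ^ 4 / \<kappa>) / 2"
      using cube[of "sqrt (v a)"] v0 by simp
    also have "(sqrt (v a)) ^ 4 = (v a)\<^sup>2"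
      using v0[of a] by (simp add: power4_eq_xxxx power2_eq_square)
    also have "(\<kappa> * (sqrt (v a))\<^sup>2 + (v a)\<^sup>2 / \<kappa>) / 2 \<le> (\<kappa> * v a + m4 a / \<kappa>) / 2"
      using v0[of a] v4[OF that] \<kappa>(1) by (simp add: divide_right_mono)
    finally show ?thesis .
  qed
  have sumv: "(\<Sum>a<m. v a) = 1"
  proof -
    have "(\<Sum>a<m. v a) = w\<^sup>2 * V"
      unfolding v_def Z2 V(1) by (simp add: sum_distrib_left)
    then show ?thesis using V(2) by (simp add: w(2))
  qed
  have sum4: "(\<Sum>a<m. m4 a) \<le> l"
  proof -
    have "(\<Sum>a<m. m4 a) = w ^ 4 * (\<Sum>a<m. expectation (\<lambda>\<omega>. (X a \<omega>) ^ 4))"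
      unfolding m4_def Z4 by (simp add: sum_distrib_left)
    also have "\<dots> \<le> w ^ 4 * (l * V\<^sup>2)" using l w by (intro mult_left_mono) auto
    also have "w ^ 4 = (w\<^sup>2)\<^sup>2" by (simp add: power_mult[symmetric])
    finally show ?thesis using w V(2) by (simp add: power_divide)
  qed
  have \<epsilon>: "(\<Sum>a<m. expectation (\<lambda>\<omega>. \<bar>Z a \<omega>\<bar> ^ 3) + 2 * sqrt (v a) ^ 3) \<le> 3 * \<kappa>"
  proof -
    have "(\<Sum>a<m. expectation (\<lambda>\<omega>. \<bar>Z a \<omega>\<bar> ^ 3) + 2 * sqrt (v a) ^ 3) \<le>
       (\<Sum>a<m. 3 / 2 * (\<kappa> * v a + m4 a / \<kappa>))"
    proof (rule sum_mono)
      fix a assume "a \<in> {..<m}"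
      moreover have "x + 2 * y \<le> 3 / 2 * W" if "x \<le> W / 2" "y \<le> W / 2" for x y W :: real
        using that by linarith
      ultimately show "expectation (\<lambda>\<omega>. \<bar>Z a \<omega>\<bar> ^ 3) + 2 * sqrt (v a) ^ 3 \<le> 3 / 2 * (\<kappa> * v a + m4 a / \<kappa>)"
        using third sq3 by blast
    qed
    also have "\<dots> = 3 / 2 * (\<kappa> * (\<Sum>a<m. v a) + (\<Sum>a<m. m4 a) / \<kappa>)"
      by (simp only: sum_distrib_left[symmetric] sum.distrib sum_divide_distrib)
    also have "\<dots> \<le> 3 / 2 * (\<kappa> + l / \<kappa>)"
      using sumv sum4 \<kappa>(1) by (simp add: divide_right_mono)
    also have "l / \<kappa> = \<kappa>" using \<kappa> by (simp add: field_simps)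
    finally show ?thesis by simp
  qed
  define S where "S \<omega> = (\<Sum>a<m. Z a \<omega>)" for \<omega>
  have Sm: "S \<in> borel_measurable M" unfolding S_def[abs_def] using Zm by (intro borel_measurable_sum) simp
  have test: "\<bar>expectation (\<lambda>\<omega>. g (S \<omega>)) - (\<integral>z. g z \<partial>std_normal)\<bar> \<le> K * (3 * \<kappa>)"
    if K: "K \<ge> 0" and g: "taylor3 K g a b" for K g a b
  proof -
    have "\<bar>expectation (\<lambda>\<omega>. g (\<Sum>a<m. Z a \<omega>)) - (\<integral>z. g (sqrt (\<Sum>a<m. v a) * z) \<partial>std_normal)\<bar>
      \<le> K * (\<Sum>a<m. expectation (\<lambda>\<omega>. \<bar>Z a \<omega>\<bar> ^ 3) + 2 * sqrt (v a) ^ 3)"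
      by (rule lindeberg[OF indZ iZ(1,4,2) i3 _ g K]) (auto simp: v_def)
    also have "\<dots> \<le> K * (3 * \<kappa>)" using K \<epsilon> by (intro mult_left_mono)
    finally show ?thesis by (simp add: sumv S_def)
  qed
  \<comment> \<open>The choice for which \<kappa> is the fourth power of \<eta>, so that
    \<open>3 * \<eta> + 4 * \<kappa> / \<eta> ^ 3\<close> becomes \<open>7 * \<eta>\<close>.\<close>
  define \<eta> where "\<eta> = l powr (1 / 8)"
  have \<eta>: "\<eta> > 0" using l(2) by (simp add: \<eta>_def)
  have \<kappa>\<eta>: "\<kappa> = \<eta> ^ 4"
    using l(2) by (simp add: \<kappa>_def \<eta>_def powr_half_sqrt[symmetric] powr_realpow[symmetric] powr_powr)
  have "{\<omega> \<in> space M. S \<omega> > t} = {\<omega> \<in> space M. (\<Sum>a<m. X a \<omega>) > sqrt V * t}"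
  proof -
    have "S \<omega> = (\<Sum>a<m. X a \<omega>) / sqrt V" for \<omega>
      by (simp add: S_def Z_def w_def sum_divide_distrib)
    then show ?thesis using V(2) by (simp add: less_divide_eq mult.commute)
  qed
  then have "\<bar>prob {\<omega> \<in> space M. (\<Sum>a<m. X a \<omega>) > sqrt V * t} - normal_tail t\<bar> \<le> 3 * \<eta> + 4 / 3 * (3 * \<kappa>) / \<eta> ^ 3"
    using smoothing[OF Sm \<eta> test, where t=t] by simp
  also have "\<dots> = 7 * \<eta>" using \<eta> by (simp add: \<kappa>\<eta> power4_eq_xxxx power3_eq_cube)
  finally show ?thesis by (simp add: \<eta>_def)
qed

text \<open>A Lipschitz bound would leave a factor \<open>\<bar>y\<bar>\<close>, and the threshold
  is arbitrary. As \<open>r\<close> is at least 1/2, all points between \<open>y\<close> and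
  \<open>r * y\<close> are at distance at least \<open>\<bar>y\<bar> / 2\<close> from 0, and there
  the density decays fast enough to absorb that factor.\<close>

lemma normal_tail_scale:
  assumes r: "1 / 2 \<le> r" "r \<le> 3 / 2"
  shows "\<bar>normal_tail (r * y) - normal_tail y\<bar> \<le> 2 * \<bar>r - 1\<bar>"
proof -
  define b where "b = exp (- y\<^sup>2 / 8)"
  have dens: "std_normal_density x \<le> b" if "\<bar>y\<bar> / 2 \<le> \<bar>x\<bar>" for x
  proof -
    have "(\<bar>y\<bar> / 2)\<^sup>2 \<le> \<bar>x\<bar>\<^sup>2" using that by (intro power_mono) auto
    then have "exp (- x\<^sup>2 / 2) \<le> b" by (simp add: b_def power_divide)
    moreover have "1 \<le> sqrt (2 * pi)" using pi_gt3 by (intro real_le_rsqrt) simp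
    then have "1 / sqrt (2 * pi) * exp (- x\<^sup>2 / 2) \<le> 1 * exp (- x\<^sup>2 / 2)"
      by (intro mult_right_mono) auto
    ultimately show ?thesis by (simp add: std_normal_density_def)
  qed
  have diff: "\<bar>normal_tail s - normal_tail t\<bar> \<le> b * \<bar>s - t\<bar>"
    if "\<And>x. min s t \<le> x \<Longrightarrow> x \<le> max s t \<Longrightarrow> \<bar>y\<bar> / 2 \<le> \<bar>x\<bar>" for s t
  proof (cases "s \<le> t")
    case True
    then show ?thesis
      using normal_tail_diff_le[OF True, of b] dens that normal_tail_mono[OF True] by (simp add: min_def max_def)
  next
    case False
    then have le: "t \<le> s" by simp
    show ?thesis
      using normal_tail_diff_le[OF le, of b] dens that normal_tail_mono[OF le] False by (simp add: min_def max_def)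
  qed
  have ry: "\<bar>y\<bar> / 2 \<le> \<bar>x\<bar>" if "min (r * y) y \<le> x" "x \<le> max (r * y) y" for x
  proof (cases "0 \<le> y")
    case True
    then have "y / 2 \<le> r * y" using mult_right_mono[OF r(1) True] by simp
    then show ?thesis using that True by (simp add: min_def split: if_splits)
  next
    case False
    then have "r * y \<le> y / 2" using mult_right_mono_neg[OF r(1), of y] by simp
    moreover have "x \<le> r * y \<or> x \<le> y" using that by (auto simp: max_def split: if_splits)
    ultimately show ?thesis using False by linarith
  qed
  have "\<bar>normal_tail (r * y) - normal_tail y\<bar> \<le> b * \<bar>r * y - y\<bar>"
    by (rule diff[OF ry])
  also have "\<dots> = (b * \<bar>y\<bar>) * \<bar>r - 1\<bar>"
  proof -
    have "r * y - y = (r - 1) * y" by (simp add: algebra_simps)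
    then show ?thesis by (simp add: abs_mult)
  qed
  also have "b * \<bar>y\<bar> \<le> 2"
  proof -
    have "0 \<le> (\<bar>y\<bar> / 4 - 1)\<^sup>2" by simp
    then have "\<bar>y\<bar> / 2 \<le> 1 + \<bar>y\<bar>\<^sup>2 / 16" by (simp add: power2_diff power_divide)
    also have "\<dots> \<le> 1 + y\<^sup>2 / 8" by simp
    also have "\<dots> \<le> exp (y\<^sup>2 / 8)" by (rule exp_ge_add_one_self)
    finally have "\<bar>y\<bar> \<le> 2 * exp (y\<^sup>2 / 8)" by simp
    then show ?thesis by (simp add: b_def exp_minus field_simps)
  qed
  then have "(b * \<bar>y\<bar>) * \<bar>r - 1\<bar> \<le> 2 * \<bar>r - 1\<bar>" by (intro mult_right_mono) auto
  finally show ?thesis .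
qed

section \<open>Sums over blocks and expansions of logarithms\<close>

lemma sum_lessThan_add: "(\<Sum>a<m+r. g a) = (\<Sum>a<m. g a) + (\<Sum>b<r. g (m + b :: nat) :: 'b :: comm_monoid_add)"
  by (induction r) (simp_all add: add.assoc)

lemma sum_offset: "(\<Sum>a<offset d k. g a) = (\<Sum>j<k. \<Sum>b<d j. g (offset d j + b) :: 'b :: comm_monoid_add)"
  by (induction k) (simp_all add: offset_Suc sum_lessThan_add)

lemma block_start_offset: "b < d j \<Longrightarrow> block_start d (offset d j + b) = offset d j"
  unfolding block_start_def by (subst block_index_eqI[of d j]) auto

text \<open>Both sides count the pairs of coordinates in different blocks. Through this identity the
  leading variances \<open>2 * o_a / n^2\<close> of the single columns add up to
  \<open>2 * f / n^2\<close>.\<close>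

lemma sum_block_start: "(\<Sum>a<offset d k. real (block_start d a)) = lrt_df k d"
proof -
  have "(\<Sum>a<offset d k. real (block_start d a)) = (\<Sum>j<k. real (d j) * real (offset d j))"
    unfolding sum_offset by (intro sum.cong refl) (simp add: block_start_offset)
  also have "\<dots> = lrt_df k d"
    by (induction k)
      (simp_all add: lrt_df_def total_dim_offset offset_Suc power2_eq_square field_simps)
  finally show ?thesis .
qed

text \<open>Comparison of derivatives from 0. The coefficient 1 of the cube, in place of 1/3, pays
  for the rest of the series: on the interval the factor \<open>2 - 3 * z\<close> stays
  positive.\<close>

lemma neg_ln_one_minus:
  fixes x :: real
  assumes "0 \<le> x" "x \<le> 1 / 2"
  shows "x + x\<^sup>2 / 2 \<le> - ln (1 - x)" "- ln (1 - x) \<le> x + x\<^sup>2 / 2 + x ^ 3"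
proof -
  let ?f = "\<lambda>x :: real. - ln (1 - x) - (x + x\<^sup>2 / 2)"
  let ?g = "\<lambda>x :: real. x + x\<^sup>2 / 2 + x ^ 3 - - ln (1 - x)"
  have "?f 0 \<le> ?f x"
  proof (rule DERIV_nonneg_imp_nondecreasing[OF assms(1)])
    fix z assume z: "0 \<le> z" "z \<le> x"
    have "(?f has_real_derivative (1 / (1 - z) - (1 + z))) (at z)"
      using z assms by (auto intro!: derivative_eq_intros simp: field_simps)
    moreover have "0 \<le> 1 / (1 - z) - (1 + z)"
    proof -
      have "1 / (1 - z) - (1 + z) = z\<^sup>2 / (1 - z)" using z assms by (simp add: field_simps power2_eq_square)
      then show ?thesis using z assms by simp
    qed
    ultimately show "\<exists>y. (?f has_real_derivative y) (at z) \<and> 0 \<le> y" by blast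
  qed
  then show "x + x\<^sup>2 / 2 \<le> - ln (1 - x)" by simp
  have "?g 0 \<le> ?g x"
  proof (rule DERIV_nonneg_imp_nondecreasing[OF assms(1)])
    fix z assume z: "0 \<le> z" "z \<le> x"
    have "(?g has_real_derivative (1 + z + 3 * z\<^sup>2 - 1 / (1 - z))) (at z)"
      using z assms by (auto intro!: derivative_eq_intros simp: field_simps)
    moreover have "0 \<le> 1 + z + 3 * z\<^sup>2 - 1 / (1 - z)"
    proof -
      have "1 + z + 3 * z\<^sup>2 - 1 / (1 - z) = z\<^sup>2 * (2 - 3 * z) / (1 - z)"
        using z assms by (simp add: field_simps power2_eq_square)
      then show ?thesis using z assms by simp
    qed
    ultimately show "\<exists>y. (?g has_real_derivative y) (at z) \<and> 0 \<le> y" by blast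
  qed
  then show "- ln (1 - x) \<le> x + x\<^sup>2 / 2 + x ^ 3" by simp
qed

text \<open>A Stirling-type estimate with centre \<open>(N - m - 1/2) ln (1 - m/N)\<close>. The term linear in \<open>m\<close>
  is kept separate: it cancels between the full matrix and the blocks.\<close>
lemma sum_ln_one_minus:
  fixes N :: real
  assumes "real m \<le> N / 2" "4 \<le> N"
  shows "\<bar>(\<Sum>i<m. - ln (1 - real i / N)) - (N - real m - 1 / 2) * ln (1 - real m / N) - (1 - 1 / N) * real m\<bar>
    \<le> 5 * (real m)\<^sup>2 / N\<^sup>2"
proof -
  define D where "D m = (\<Sum>i<m. - ln (1 - real i / N)) - (N - real m - 1 / 2) * ln (1 - real m / N) - (1 - 1 / N) * real m" for m
  \<comment> \<open>Induction over increments: one step costs at most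
    \<open>(2 * m + 4) / N\<^sup>2\<close>, which the growth of \<open>m^2 + 4 * m\<close>
    covers.\<close>
  have "\<bar>D m\<bar> \<le> ((real m)\<^sup>2 + 4 * real m) / N\<^sup>2"
    using assms(1)
  proof (induction m)
    case 0
    then show ?case by (simp add: D_def)
  next
    case (Suc m)
    define R where "R = N - real m"
    define y where "y = 1 / R"
    have m: "real m + 1 \<le> N / 2" using Suc.prems by simp
    have R: "N / 2 \<le> R" "2 \<le> R" "R \<le> N" using m assms(2) by (auto simp: R_def)
    have y: "0 < y" "y \<le> 1 / 2" using R by (auto simp: y_def)
    define h where "h = - ln (1 - y)"
    have h: "y + y\<^sup>2 / 2 \<le> h" "h \<le> y + y\<^sup>2 / 2 + y ^ 3"
      using neg_ln_one_minus[of y] y by (auto simp: h_def)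
    have split: "ln (1 - real (Suc m) / N) = ln (1 - real m / N) - h"
    proof -
      have "1 - real (Suc m) / N = (1 - real m / N) * (1 - y)"
        using R assms(2) by (simp add: y_def R_def field_simps)
      moreover have "0 < 1 - real m / N" using m assms(2) by (simp add: field_simps)
      moreover have "N \<noteq> real m" using R by (auto simp: R_def)
      ultimately show ?thesis using y by (simp add: h_def ln_mult)
    qed
    \<comment> \<open>The logarithm at \<open>m\<close> cancels. As \<open>R * y = 1\<close>, the
      product with \<open>h = y + y^2 / 2 + ...\<close> is \<open>1 - y\<close> up to
      \<open>y^2\<close>, and \<open>y\<close> in turn is \<open>1 / N\<close> up to
      \<open>2 * m / N^2\<close>; this is what the term linear in \<open>m\<close> was chosen to
      absorb.\<close>
    have "D (Suc m) - D m = (R - 3 / 2) * h - 1 + 1 / N"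
      unfolding D_def split by (simp add: R_def algebra_simps)
    moreover have "\<bar>(R - 3 / 2) * h - 1 + y\<bar> \<le> y\<^sup>2"
    proof -
      have Ry: "R * y = 1" using R by (simp add: y_def)
      have e: "R * (y * z) = z" for z using Ry by (simp add: mult.assoc[symmetric])
      have "(R - 3 / 2) * (y + y\<^sup>2 / 2) = 1 - y - 3 / 4 * y\<^sup>2"
        by (simp add: power2_eq_square algebra_simps e Ry)
      moreover have "(R - 3 / 2) * (y + y\<^sup>2 / 2 + y ^ 3) = 1 - y + y\<^sup>2 / 4 - 3 / 2 * y ^ 3"
        by (simp add: power2_eq_square power3_eq_cube algebra_simps e Ry)
      moreover have "(R - 3 / 2) * (y + y\<^sup>2 / 2) \<le> (R - 3 / 2) * h" "(R - 3 / 2) * h \<le> (R - 3 / 2) * (y + y\<^sup>2 / 2 + y ^ 3)"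
        using h R by (auto intro!: mult_left_mono)
      moreover have "0 \<le> y ^ 3" "0 \<le> y\<^sup>2" using y by auto
      ultimately show ?thesis by linarith
    qed
    moreover have "\<bar>y - 1 / N\<bar> \<le> 2 * real m / N\<^sup>2"
    proof -
      have "y - 1 / N = real m / (N * R)" using R assms(2) by (simp add: y_def R_def field_simps)
      also have "\<dots> \<le> real m / (N * (N / 2))" using R assms(2) by (intro divide_left_mono mult_left_mono) auto
      finally have "y - 1 / N \<le> 2 * real m / N\<^sup>2" by (simp add: power2_eq_square mult.commute)
      moreover have "0 \<le> y - 1 / N" using R assms(2) by (simp add: y_def field_simps)
      ultimately show ?thesis by simp
    qed
    moreover have "y\<^sup>2 \<le> 4 / N\<^sup>2"
    proof -
      have "y \<le> 1 / (N / 2)" unfolding y_def using R assms(2) by (intro divide_left_mono) auto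
      then have "y\<^sup>2 \<le> (2 / N)\<^sup>2" using y by (intro power_mono) auto
      then show ?thesis by (simp add: power_divide)
    qed
    ultimately have "\<bar>D (Suc m) - D m\<bar> \<le> 2 * real m / N\<^sup>2 + 4 / N\<^sup>2" by linarith
    moreover have "\<bar>D m\<bar> \<le> ((real m)\<^sup>2 + 4 * real m) / N\<^sup>2" using Suc by simp
    ultimately have "\<bar>D (Suc m)\<bar> \<le> ((real m)\<^sup>2 + 4 * real m) / N\<^sup>2 + (2 * real m / N\<^sup>2 + 4 / N\<^sup>2)" by linarith
    also have "\<dots> = ((real m)\<^sup>2 + 4 * real m + (2 * real m + 4)) / N\<^sup>2" by (simp add: add_divide_distrib)
    also have "\<dots> \<le> ((real (Suc m))\<^sup>2 + 4 * real (Suc m)) / N\<^sup>2"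
      by (intro divide_right_mono) (simp_all add: power2_eq_square algebra_simps)
    finally show ?case .
  qed
  also have "\<dots> \<le> 5 * (real m)\<^sup>2 / N\<^sup>2"
  proof (intro divide_right_mono)
    have "real m \<le> (real m)\<^sup>2" by (cases m) (auto simp: power2_eq_square)
    then show "(real m)\<^sup>2 + 4 * real m \<le> 5 * (real m)\<^sup>2" by simp
  qed simp
  finally show ?thesis by (simp add: D_def)
qed

section \<open>The statistic as a sum of independent logarithms\<close>

definition log_resid :: "nat \<Rightarrow> (nat \<Rightarrow> nat) \<Rightarrow> nat \<Rightarrow> (nat \<Rightarrow> real) \<Rightarrow> real" where
  "log_resid n d a z = ln (1 + sq_sum {1 + (a - block_start d a)..<1 + a} z / sq_sum {1 + a..<n} z)"

lemma log_resid_measurable [measurable]: "log_resid n d a \<in> borel_measurable (gauss n)"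
  unfolding log_resid_def by measurable

lemma ln_resid_ratio:
  assumes "a < n" "sq_sum {1 + a..<n} z > 0"
  shows "0 < resid_ratio n d a z" "- ln (resid_ratio n d a z) = log_resid n d a z"
proof -
  let ?s = "block_start d a"
  let ?A = "sq_sum {1 + a..<n} z" and ?B = "sq_sum {1 + (a - ?s)..<1 + a} z"
  have B: "0 \<le> ?B" by (rule sq_sum_nonneg)
  have r: "resid_ratio n d a z = ?A / (?B + ?A)"
  proof -
    have "(\<Sum>c\<in>{1 + (a - ?s)..<n}. (z c)\<^sup>2) = ?B + ?A"
      unfolding sq_sum_def using assms(1) by (intro sum.atLeastLessThan_concat[symmetric]) auto
    then show ?thesis by (simp add: resid_ratio_def sq_sum_def)
  qed
  show "0 < resid_ratio n d a z" unfolding r using assms(2) B by simp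
  have "log_resid n d a z = ln ((?B + ?A) / ?A)"
    using assms(2) by (simp add: log_resid_def add_divide_distrib add.commute)
  then show "- ln (resid_ratio n d a z) = log_resid n d a z"
    unfolding r using assms(2) B by (simp add: ln_div)
qed

text \<open>Peeling off columns writes the determinant as a product of sums of squares. The sign is
  wanted for each determinant separately, because \<open>LRT\<close> applies \<open>powr\<close> to
  each of them.\<close>

lemma scatter_det_nonneg:
  assumes "r < n"
  shows "0 \<le> scatter_det n s r y"
  using assms
proof (induction r)
  case (Suc r)
  define v where "v b = (if b = 0 then (\<lambda>_. 1) else y (s + (b - 1)))" for b
  obtain T where iso: "\<And>x y. ip n (T x) (T y) = ip n x y"
    and tri: "\<And>b c. b < Suc r \<Longrightarrow> c < n \<Longrightarrow> b < c \<Longrightarrow> T (v b) c = 0"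
    using exists_triangularising_isometry[OF less_imp_le[OF Suc.prems], of v] by blast
  have one: "T (\<lambda>_. 1) c = 0" if "0 < c" "c < n" for c
    using tri[of 0 c] that by (simp add: v_def)
  have "T (y (s + b)) c = 0" if "b < r" "1 + r \<le> c" "c < n" for b c
    using tri[of "1 + b" c] that by (simp add: v_def)
  then have "scatter_det n s (Suc r) y = scatter_det n s r y * (\<Sum>c\<in>{1+r..<n}. (T (y (s + r)) c)\<^sup>2)"
    using Suc.prems by (intro scatter_det_Suc[OF iso one]) auto
  then show ?case using Suc by (simp add: sum_nonneg)
qed simp

text \<open>A positive quotient forces every determinant to be nonzero, since division by 0 gives 0;
  being nonnegative, they are all positive, and the rules for logarithms apply.\<close>

lemma LRT_sample_ratio:
  assumes "total_dim k d < n" and pos: "0 < sample_ratio n k d x"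
  shows "- 2 * ln (LRT n k d x) = - real n * ln (sample_ratio n k d x)"
proof -
  define D where "D = Determinant.det (scatter_mat n (total_dim k d) x)"
  define P where "P j = Determinant.det (scatter_mat n (d j) (sub_obs d j x))" for j
  have sr: "sample_ratio n k d x = D / (\<Prod>j<k. P j)" by (simp add: sample_ratio_def D_def P_def)
  have D0: "0 \<le> D"
    using scatter_det_nonneg[OF assms(1), of 0 "\<lambda>a i. x i a"] by (simp add: scatter_det_def D_def)
  have P0: "0 \<le> P j" if "j < k" for j
  proof -
    have "offset d j + d j \<le> offset d k" using offset_mono[of "Suc j" k d] that by (simp add: offset_Suc)
    then have "d j < n" using assms(1) by (simp add: total_dim_offset)
    then show ?thesis
      using scatter_det_nonneg[of "d j" n 0 "\<lambda>a i. sub_obs d j x i a"] by (simp add: scatter_det_def P_def)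
  qed
  have "D \<noteq> 0" and prod0: "(\<Prod>j<k. P j) \<noteq> 0" using pos unfolding sr by (intro notI; simp)+
  then have D: "0 < D" using D0 by simp
  have P: "0 < P j" if "j < k" for j
  proof -
    have "P j \<noteq> 0" using prod0 that by simp
    then show ?thesis using P0[OF that] by simp
  qed
  have "ln (LRT n k d x) = ln (D powr (real n / 2) * (\<Prod>j<k. P j powr (- real n / 2)))"
    by (simp add: LRT_def D_def P_def)
  also have "\<dots> = ln (D powr (real n / 2)) + (\<Sum>j<k. ln (P j powr (- real n / 2)))"
  proof -
    have pw: "0 < P j powr (- real n / 2)" if "j < k" for j using P[OF that] by simp
    then have "0 < (\<Prod>j<k. P j powr (- real n / 2))" by (intro prod_pos) simp
    moreover have "0 < D powr (real n / 2)" using D by simp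
    moreover have "ln (\<Prod>j<k. P j powr (- real n / 2)) = (\<Sum>j<k. ln (P j powr (- real n / 2)))"
      using pw by (intro ln_prod) auto
    ultimately show ?thesis by (simp only: ln_mult_pos)
  qed
  also have "\<dots> = real n / 2 * (ln D - (\<Sum>j<k. ln (P j)))"
  proof -
    have "(\<Sum>j<k. ln (P j powr (- real n / 2))) = - real n / 2 * (\<Sum>j<k. ln (P j))"
      unfolding sum_distrib_left using P by (intro sum.cong refl) (simp add: ln_powr)
    moreover have "ln (D powr (real n / 2)) = real n / 2 * ln D" using D by (simp add: ln_powr)
    ultimately show ?thesis by (simp only: right_diff_distrib minus_divide_left[symmetric] mult_minus_left add_uminus_conv_diff)
  qed
  also have "ln D - (\<Sum>j<k. ln (P j)) = ln (sample_ratio n k d x)"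
  proof -
    have "P j \<noteq> 0" if "j \<in> {..<k}" for j using P[of j] that by simp
    then have "ln (\<Prod>j<k. P j) = (\<Sum>j<k. ln (P j))" by (intro ln_prod) auto
    moreover have "0 < (\<Prod>j<k. P j)" using P by (intro prod_pos) simp
    ultimately show ?thesis unfolding sr using D by (simp only: ln_divide_pos)
  qed
  finally show ?thesis by simp
qed

text \<open>Equality in law with indicators as test functions. Both sides are rewritten only almost
  everywhere, where the ratios are positive and the logarithm of the product splits.\<close>

lemma prob_LRT:
  assumes ns: "normal_sample M n (total_dim k d) m S X" and H0: "block_independence k d S"
    and dims: "0 < total_dim k d" "total_dim k d + 1 < n"
  shows "measure M {\<omega> \<in> space M. - 2 * ln (LRT n k d (\<lambda>i. X i \<omega>)) > x} =
    measure (gauss_columns n (total_dim k d))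
      {y \<in> space (gauss_columns n (total_dim k d)). real n * (\<Sum>a<total_dim k d. log_resid n d a (y a)) > x}"
proof -
  define p where "p = total_dim k d"
  let ?G = "gauss_columns n p"
  interpret M: prob_space M using ns by (simp add: normal_sample_def)
  interpret G: prob_space ?G by (rule prob_space_gauss_columns)
  have Xm: "(\<lambda>\<omega>. X i \<omega> a) \<in> borel_measurable M" if "i < n" for i a
  proof -
    have "X i \<in> measurable M (vec_space p)" using ns that by (auto simp: normal_sample_def p_def distributed_def)
    from measurable_compose[OF this measurable_component_vec] show ?thesis .
  qed
  have detm: "(\<lambda>\<omega>. Determinant.det (scatter_mat n r (\<lambda>i a. X i \<omega> (s + a)))) \<in> borel_measurable M" for r s
    unfolding scatter_mat_def sample_mean_def
    by (intro borel_measurable_det borel_measurable_sum borel_measurable_times borel_measurable_diff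
        borel_measurable_divide borel_measurable_const Xm) auto
  have det0: "(\<lambda>\<omega>. Determinant.det (scatter_mat n (total_dim k d) (\<lambda>i. X i \<omega>))) \<in> borel_measurable M"
    using detm[of "total_dim k d" 0] by simp
  have detj: "(\<lambda>\<omega>. Determinant.det (scatter_mat n (d j) (sub_obs d j (\<lambda>i. X i \<omega>)))) \<in> borel_measurable M" for j
    using detm[of "d j" "offset d j"] by (simp add: sub_obs_def[abs_def])
  have [measurable]: "(\<lambda>\<omega>. sample_ratio n k d (\<lambda>i. X i \<omega>)) \<in> borel_measurable M"
    unfolding sample_ratio_def by (intro borel_measurable_divide borel_measurable_prod det0 detj)
  have [measurable]: "(\<lambda>\<omega>. LRT n k d (\<lambda>i. X i \<omega>)) \<in> borel_measurable M"
    unfolding LRT_def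
    by (intro borel_measurable_times borel_measurable_prod powr_real_measurable det0 detj borel_measurable_const)
  let ?R = "\<lambda>\<omega>. sample_ratio n k d (\<lambda>i. X i \<omega>)"
  let ?Q = "\<lambda>y. \<Prod>b<p. resid_ratio n d b (y b)"
  have law: "emeasure M {\<omega> \<in> space M. ?R \<omega> \<in> B} = emeasure ?G {y \<in> space ?G. ?Q y \<in> B}"
    if [measurable]: "B \<in> sets borel" for B
  proof -
    have Qm[measurable]: "?Q \<in> borel_measurable ?G"
      by (intro borel_measurable_prod resid_ratio_measurable measurable_component_columns)
    have ind: "emeasure K {\<omega> \<in> space K. f \<omega> \<in> B} = (\<integral>\<^sup>+\<omega>. indicator B (f \<omega>) \<partial>K)"
      if [measurable]: "f \<in> borel_measurable K" for K :: "'k measure" and f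
    proof -
      have "emeasure K {\<omega> \<in> space K. f \<omega> \<in> B} = (\<integral>\<^sup>+\<omega>. indicator {\<omega> \<in> space K. f \<omega> \<in> B} \<omega> \<partial>K)"
        by (rule nn_integral_indicator[symmetric]) measurable
      also have "\<dots> = (\<integral>\<^sup>+\<omega>. indicator B (f \<omega>) \<partial>K)"
        by (rule nn_integral_cong) (simp add: indicator_def)
      finally show ?thesis .
    qed
    have "emeasure M {\<omega> \<in> space M. ?R \<omega> \<in> B} = (\<integral>\<^sup>+\<omega>. indicator B (?R \<omega>) \<partial>M)"
      by (rule ind) measurable
    also have "\<dots> = (\<integral>\<^sup>+y. indicator B (?Q y) \<partial>?G)"
      unfolding p_def using dims by (intro nn_integral_sample_ratio[OF ns H0]) auto
    also have "\<dots> = emeasure ?G {y \<in> space ?G. ?Q y \<in> B}"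
      by (rule ind[symmetric]) (rule Qm)
    finally show ?thesis .
  qed
  have lr[measurable]: "(\<lambda>y. log_resid n d a (y a)) \<in> borel_measurable ?G" if "a \<in> {..<p}" for a
    using measurable_compose[OF measurable_component_singleton[OF that] log_resid_measurable] .
  have AEpos: "AE y in ?G. \<forall>a\<in>{..<p}. sq_sum {1 + a..<n} (y a) > 0"
  proof (intro AE_finite_allI)
    fix a assume a: "a \<in> {..<p}"
    then have "AE z in gauss n. sq_sum {1 + a..<n} z > 0"
      using dims by (intro AE_sq_sum_pos) (auto simp: p_def)
    then show "AE y in ?G. sq_sum {1 + a..<n} (y a) > 0"
      using a by (intro AE_PiM_component[where i=a and M="\<lambda>_. gauss n"] prob_space_gauss) auto
  qed simp
  have AEQ: "AE y in ?G. 0 < ?Q y \<and> - ln (?Q y) = (\<Sum>a<p. log_resid n d a (y a))"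
    using AEpos
  proof eventually_elim
    case (elim y)
    have r: "0 < resid_ratio n d a (y a)" "- ln (resid_ratio n d a (y a)) = log_resid n d a (y a)" if "a < p" for a
      using elim that dims by (auto intro!: ln_resid_ratio simp: p_def)
    have "- ln (?Q y) = (\<Sum>a<p. - ln (resid_ratio n d a (y a)))"
      using r(1) by (subst ln_prod) (auto simp: sum_negf less_imp_neq[THEN not_sym])
    then show ?case using r by (auto intro!: prod_pos)
  qed
  \<comment> \<open>Nonsingularity of the sample is itself read off from the Gaussian side, by the
    equality in law for the set of nonpositive values.\<close>
  have "AE \<omega> in M. 0 < ?R \<omega>"
  proof -
    have "emeasure M {\<omega> \<in> space M. ?R \<omega> \<in> {..0}} = emeasure ?G {y \<in> space ?G. ?Q y \<in> {..0}}"
      by (rule law) simp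
    also have "\<dots> = 0"
      using AEQ by (intro emeasure_eq_0_AE) (auto elim!: eventually_mono)
    finally show ?thesis by (intro AE_I'[of "{\<omega> \<in> space M. ?R \<omega> \<in> {..0}}"]) (auto simp: null_sets_def not_less)
  qed
  define B where "B = {r :: real. - real n * ln r > x}"
  have B[measurable]: "B \<in> sets borel" unfolding B_def by measurable
  have "emeasure M {\<omega> \<in> space M. - 2 * ln (LRT n k d (\<lambda>i. X i \<omega>)) > x} = emeasure M {\<omega> \<in> space M. ?R \<omega> \<in> B}"
  proof (rule emeasure_eq_AE)
    show "AE \<omega> in M. \<omega> \<in> {\<omega> \<in> space M. - 2 * ln (LRT n k d (\<lambda>i. X i \<omega>)) > x} \<longleftrightarrow> \<omega> \<in> {\<omega> \<in> space M. ?R \<omega> \<in> B}"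
      using \<open>AE \<omega> in M. 0 < ?R \<omega>\<close>
    proof eventually_elim
      case (elim \<omega>)
      then have "- 2 * ln (LRT n k d (\<lambda>i. X i \<omega>)) = - real n * ln (?R \<omega>)"
        using dims by (intro LRT_sample_ratio) auto
      then show ?case by (simp add: B_def)
    qed
  qed measurable
  also have "\<dots> = emeasure ?G {y \<in> space ?G. ?Q y \<in> B}" by (rule law) (rule B)
  also have "\<dots> = emeasure ?G {y \<in> space ?G. real n * (\<Sum>a<p. log_resid n d a (y a)) > x}"
  proof (rule emeasure_eq_AE)
    show "AE y in ?G. y \<in> {y \<in> space ?G. ?Q y \<in> B} \<longleftrightarrow> y \<in> {y \<in> space ?G. real n * (\<Sum>a<p. log_resid n d a (y a)) > x}"
      using AEQ
    proof eventually_elim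
      case (elim y)
      then have "(\<Sum>a<p. log_resid n d a (y a)) = - ln (?Q y)" by (elim conjE) (rule sym)
      then have "real n * (\<Sum>a<p. log_resid n d a (y a)) = - real n * ln (?Q y)"
        by (simp only: mult_minus_left mult_minus_right)
      then show ?case by (simp only: B_def mem_Collect_eq)
    qed
    have "?Q \<in> borel_measurable ?G"
      by (intro borel_measurable_prod resid_ratio_measurable measurable_component_columns)
    then show "{y \<in> space ?G. ?Q y \<in> B} \<in> sets ?G" by measurable
    have "(\<lambda>y. \<Sum>a<p. log_resid n d a (y a)) \<in> borel_measurable ?G" by (intro borel_measurable_sum lr)
    then show "{y \<in> space ?G. real n * (\<Sum>a<p. log_resid n d a (y a)) > x} \<in> sets ?G" by measurable
  qed
  finally show ?thesis
    by (simp add: p_def[symmetric] M.emeasure_eq_measure G.emeasure_eq_measure)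
qed

text \<open>\<open>chi_log\<close> with \<open>q = o_a\<close> and \<open>\<nu> = n - 1 - a\<close>.
  Since \<nu> lies between n / 2 and n, error terms may be expressed through n at the cost of
  constants; the mean keeps its exact logarithm, which is summed later without loss.\<close>

lemma log_resid_moments:
  assumes a: "a < p" "p = offset d k" "2 * p + 34 \<le> n"
  defines "s \<equiv> real (block_start d a)" and "e \<equiv> \<integral>z. log_resid n d a z \<partial>gauss n"
  shows "integrable (gauss n) (log_resid n d a)"
    and "integrable (gauss n) (\<lambda>z. (log_resid n d a z - e)\<^sup>2)"
    and "integrable (gauss n) (\<lambda>z. (log_resid n d a z - e) ^ 4)"
    and "\<bar>e - ln (1 + s / (real n - 1 - real a))\<bar> \<le> 160 * s / (real n)\<^sup>2"
    and "\<bar>(\<integral>z. (log_resid n d a z - e)\<^sup>2 \<partial>gauss n) - 2 * s / (real n)\<^sup>2\<bar> \<le> 1600016 * s * real p / real n ^ 3"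
    and "(\<integral>z. (log_resid n d a z - e) ^ 4 \<partial>gauss n) \<le> 4800000 * s * real p / real n ^ 4"
proof -
  let ?I = "{1 + (a - block_start d a)..<1 + a}" and ?J = "{1 + a..<n}"
  have bs: "block_start d a \<le> a" using a by (intro block_start_le[of a d k]) simp
  have cI: "card ?I = block_start d a" and cJ: "card ?J = n - 1 - a" using bs by auto
  define \<nu> where "\<nu> = real n - 1 - real a"
  have \<nu>J: "real (card ?J) = \<nu>" unfolding cJ using a by (simp add: \<nu>_def of_nat_diff)
  have sI: "real (card ?I) = s" unfolding cI by (simp add: s_def)
  have h: "?I \<inter> ?J = {}" "?I \<subseteq> {..<n}" "?J \<subseteq> {..<n}" "16 \<le> card ?J" "card ?I \<le> card ?J"
    using a bs unfolding cI cJ by auto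
  note L = chi_log[OF h, unfolded sI \<nu>J, folded log_resid_def, folded e_def]
  show "integrable (gauss n) (log_resid n d a)" "integrable (gauss n) (\<lambda>z. (log_resid n d a z - e)\<^sup>2)"
    "integrable (gauss n) (\<lambda>z. (log_resid n d a z - e) ^ 4)"
    using L(1-3) by (simp_all add: log_resid_def[abs_def])
  have n: "real n / 2 \<le> \<nu>" "\<nu> \<le> real n" "0 < real n" using a by (auto simp: \<nu>_def)
  have s: "0 \<le> s" "s \<le> real p" using bs a by (auto simp: s_def)
  have inv: "1 / \<nu> ^ j \<le> 2 ^ j / real n ^ j" for j
  proof -
    have "(real n / 2) ^ j \<le> \<nu> ^ j" using n by (intro power_mono) auto
    then have "1 / \<nu> ^ j \<le> 1 / (real n / 2) ^ j" using n by (intro divide_left_mono) auto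
    then show ?thesis by (simp add: power_divide)
  qed
  have scale: "C * x / \<nu> ^ j \<le> C * 2 ^ j * x / real n ^ j" if "0 \<le> C" "0 \<le> x" for C x j
    using mult_left_mono[OF inv[of j], of "C * x"] that by (simp add: mult_ac)
  have "40 * s / \<nu>\<^sup>2 \<le> 160 * s / (real n)\<^sup>2" using scale[of 40 s 2] s by simp
  then show "\<bar>e - ln (1 + s / (real n - 1 - real a))\<bar> \<le> 160 * s / (real n)\<^sup>2"
    using L(4) unfolding \<nu>_def[symmetric] by linarith
  have ss: "s\<^sup>2 \<le> s * real p" using s by (simp add: power2_eq_square mult_left_mono)
  have "(\<integral>z. (log_resid n d a z - e) ^ 4 \<partial>gauss n) \<le> 300000 * s\<^sup>2 / \<nu> ^ 4" using L(6) .
  also have "\<dots> \<le> 4800000 * s\<^sup>2 / real n ^ 4" using scale[of 300000 "s\<^sup>2" 4] by simp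
  also have "\<dots> \<le> 4800000 * (s * real p) / real n ^ 4" using ss by (intro divide_right_mono mult_left_mono) auto
  finally show "(\<integral>z. (log_resid n d a z - e) ^ 4 \<partial>gauss n) \<le> 4800000 * s * real p / real n ^ 4"
    by (simp add: mult.assoc)
  have "200000 * s\<^sup>2 / \<nu> ^ 3 \<le> 1600000 * s\<^sup>2 / real n ^ 3" using scale[of 200000 "s\<^sup>2" 3] by simp
  also have "\<dots> \<le> 1600000 * (s * real p) / real n ^ 3" using ss by (intro divide_right_mono mult_left_mono) auto
  finally have 1: "200000 * s\<^sup>2 / \<nu> ^ 3 \<le> 1600000 * (s * real p / real n ^ 3)" by simp
  \<comment> \<open>In the leading term the change from \<nu> to n must itself be small; it is, as
    \<open>n - \<nu> = 1 + a\<close> is at most \<open>p\<close>.\<close>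
  have 2: "\<bar>2 * s / \<nu>\<^sup>2 - 2 * s / (real n)\<^sup>2\<bar> \<le> 16 * (s * real p / real n ^ 3)"
  proof -
    have e: "2 * s / \<nu>\<^sup>2 - 2 * s / (real n)\<^sup>2 = 2 * s * ((real n - \<nu>) * (real n + \<nu>)) / (\<nu>\<^sup>2 * (real n)\<^sup>2)"
      using n by (simp add: field_simps power2_eq_square)
    have "(real n - \<nu>) * (real n + \<nu>) \<le> real p * (2 * real n)"
      using n a by (intro mult_mono) (auto simp: \<nu>_def)
    then have "2 * s * ((real n - \<nu>) * (real n + \<nu>)) / (\<nu>\<^sup>2 * (real n)\<^sup>2) \<le>
        2 * s * (real p * (2 * real n)) / ((real n / 2)\<^sup>2 * (real n)\<^sup>2)"
      using s n by (intro frac_le mult_left_mono mult_right_mono power_mono) auto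
    also have "\<dots> = 16 * (s * real p / real n ^ 3)"
      using n by (simp add: field_simps power2_eq_square power3_eq_cube)
    finally have "2 * s / \<nu>\<^sup>2 - 2 * s / (real n)\<^sup>2 \<le> 16 * (s * real p / real n ^ 3)" unfolding e .
    moreover have "0 \<le> 2 * s / \<nu>\<^sup>2 - 2 * s / (real n)\<^sup>2"
      unfolding e using s n by (intro divide_nonneg_nonneg mult_nonneg_nonneg) auto
    ultimately show ?thesis by simp
  qed
  have "1600016 * s * real p / real n ^ 3 = 1600016 * (s * real p / real n ^ 3)" by simp
  then show "\<bar>(\<integral>z. (log_resid n d a z - e)\<^sup>2 \<partial>gauss n) - 2 * s / (real n)\<^sup>2\<bar> \<le> 1600016 * s * real p / real n ^ 3"
    using L(5) 1 2 by linarith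
qed

text \<open>Each logarithm is a difference of two values of \<open>g\<close>, so the sum becomes one
  over 0, ..., p - 1 minus the analogous sums for the blocks. \<open>sum_ln_one_minus\<close>
  applied to each of them produces the terms of \<open>lrt_mu\<close>; \<open>N = n - 1\<close>
  turns 1/2 into 3/2.\<close>

lemma sum_ln_lrt_mu:
  assumes p: "p = offset d k" "2 * p + 34 \<le> n"
  shows "\<bar>(\<Sum>a<p. ln (1 + real (block_start d a) / (real n - 1 - real a))) + 2 * lrt_mu n k d / real n\<bar>
    \<le> 20 * ((real p)\<^sup>2 + (\<Sum>j<k. (real (d j))\<^sup>2)) / (real n)\<^sup>2"
proof -
  define N where "N = real n - 1"
  define g where "g i = - ln (1 - real i / N)" for i :: nat
  define H where "H m = (N - real m - 1 / 2) * ln (1 - real m / N)" for m :: nat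
  have N: "4 \<le> N" "real p \<le> N / 2" "real n / 2 \<le> N" using p by (auto simp: N_def)
  have dp: "d j \<le> p" if "j < k" for j
    using offset_mono[of "Suc j" k d] that by (simp add: offset_Suc p)
  \<comment> \<open>\<open>1 + s / (N - a)\<close> is the quotient of \<open>N - (a - s)\<close> and
    \<open>N - a\<close>, where \<open>a - s\<close> is the position of the column inside its
    block.\<close>
  have summand: "ln (1 + real (block_start d a) / (N - real a)) = g a - g (a - block_start d a)" if "a < p" for a
  proof -
    have bs: "block_start d a \<le> a" using that p by (intro block_start_le[of a d k]) simp
    have pos: "0 < N - real a" using that N by auto
    have "1 + real (block_start d a) / (N - real a) = (1 - real (a - block_start d a) / N) / (1 - real a / N)"
      using pos N bs by (simp add: field_simps of_nat_diff)
    moreover have "0 < 1 - real a / N" "0 < 1 - real (a - block_start d a) / N"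
      using pos N bs by (auto simp: field_simps of_nat_diff)
    ultimately show ?thesis by (simp only: g_def ln_divide_pos)
  qed
  have "(\<Sum>a<p. ln (1 + real (block_start d a) / (N - real a))) = (\<Sum>a<p. g a) - (\<Sum>a<p. g (a - block_start d a))"
    by (simp add: summand sum_subtractf)
  also have "(\<Sum>a<p. g (a - block_start d a)) = (\<Sum>j<k. \<Sum>b<d j. g b)"
    unfolding p(1) sum_offset by (intro sum.cong refl) (simp add: block_start_offset)
  finally have S: "(\<Sum>a<p. ln (1 + real (block_start d a) / (N - real a))) = (\<Sum>a<p. g a) - (\<Sum>j<k. \<Sum>b<d j. g b)" .
  have mu: "2 * lrt_mu n k d / real n = - H p + (\<Sum>j<k. H (d j))"
  proof -
    have "H m = (real n - real m - 3 / 2) * L (real n - 1) (real m)" for m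
    proof -
      have "N - real m - 1 / 2 = real n - real m - 3 / 2" by (simp add: N_def)
      then show ?thesis by (simp only: H_def L_def N_def)
    qed
    then have "lrt_mu n k d = real n / 2 * (- H p + (\<Sum>j<k. H (d j)))"
      by (simp only: lrt_mu_def Let_def total_dim_offset p(1)[symmetric] mult_minus_left)
    moreover have "real n \<noteq> 0" using p(2) by simp
    ultimately show ?thesis by (simp add: field_simps)
  qed
  define D where "D m = (\<Sum>i<m. g i) - H m - (1 - 1 / N) * real m" for m :: nat
  have D: "\<bar>D m\<bar> \<le> 5 * (real m)\<^sup>2 / N\<^sup>2" if "m \<le> p" for m
    unfolding D_def g_def H_def using that N by (intro sum_ln_one_minus) auto
  have ps: "real p = (\<Sum>j<k. real (d j))" by (simp add: p(1) offset_def)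
  have "(\<Sum>a<p. g a) - (\<Sum>j<k. \<Sum>b<d j. g b) + (- H p + (\<Sum>j<k. H (d j))) = D p - (\<Sum>j<k. D (d j))"
    by (simp add: D_def sum_subtractf sum_distrib_left[symmetric] ps)
  also have "\<bar>\<dots>\<bar> \<le> \<bar>D p\<bar> + (\<Sum>j<k. \<bar>D (d j)\<bar>)"
    using sum_abs[of "\<lambda>j. D (d j)" "{..<k}"] by linarith
  also have "\<dots> \<le> 5 * (real p)\<^sup>2 / N\<^sup>2 + (\<Sum>j<k. 5 * (real (d j))\<^sup>2 / N\<^sup>2)"
    using D dp by (intro add_mono sum_mono) auto
  also have "\<dots> = 5 * ((real p)\<^sup>2 + (\<Sum>j<k. (real (d j))\<^sup>2)) / N\<^sup>2"
    by (simp add: sum_distrib_left sum_divide_distrib add_divide_distrib distrib_left)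
  also have "\<dots> \<le> 5 * ((real p)\<^sup>2 + (\<Sum>j<k. (real (d j))\<^sup>2)) / (real n / 2)\<^sup>2"
    using N p by (intro divide_left_mono power_mono mult_nonneg_nonneg add_nonneg_nonneg sum_nonneg) auto
  also have "\<dots> = 20 * ((real p)\<^sup>2 + (\<Sum>j<k. (real (d j))\<^sup>2)) / (real n)\<^sup>2"
    by (simp add: power_divide)
  finally show ?thesis unfolding S[unfolded N_def] mu .
qed

text \<open>In the expansion of the logarithms the linear terms cancel, because the block sizes add
  up to p, and the quadratic ones leave f / N^2. The error is cubic in p / n.\<close>

lemma lrt_sigma_approx:
  assumes p: "p = offset d k" "2 * p + 34 \<le> n"
  defines "Q \<equiv> - L (real n - 1) (real p) + (\<Sum>j<k. L (real n - 1) (real (d j)))"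
  shows "lrt_sigma n k d = sqrt (Q / 2)"
    and "\<bar>2 * Q - 2 * lrt_df k d / (real n)\<^sup>2\<bar> \<le> (16 * lrt_df k d + 32 * (real p)\<^sup>2 * real p) / real n ^ 3"
proof -
  define N where "N = real n - 1"
  define f where "f = lrt_df k d"
  have N: "4 \<le> N" "real p \<le> N / 2" "real n / 2 \<le> N" "real n = N + 1" using p by (auto simp: N_def)
  show "lrt_sigma n k d = sqrt (Q / 2)"
    by (simp add: lrt_sigma_def Q_def total_dim_offset p(1))
  have dp: "d j \<le> p" if "j < k" for j
    using offset_mono[of "Suc j" k d] that by (simp add: offset_Suc p)
  have ps: "real p = (\<Sum>j<k. real (d j))" by (simp add: p(1) offset_def)
  define R where "R m = - L N (real m) - (real m / N + (real m / N)\<^sup>2 / 2)" for m :: nat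
  have R: "0 \<le> R m" "R m \<le> real m * (real p)\<^sup>2 / N ^ 3" if "m \<le> p" for m
  proof -
    have m: "0 \<le> real m / N" "real m / N \<le> 1 / 2" using that N by (auto simp: field_simps)
    show "0 \<le> R m" using neg_ln_one_minus(1)[OF m] by (simp add: R_def L_def)
    have "R m \<le> (real m / N) ^ 3" using neg_ln_one_minus(2)[OF m] by (simp add: R_def L_def)
    also have "\<dots> = real m * (real m)\<^sup>2 / N ^ 3" by (simp add: power_divide power3_eq_cube power2_eq_square)
    also have "\<dots> \<le> real m * (real p)\<^sup>2 / N ^ 3"
      using that N by (intro divide_right_mono mult_left_mono power_mono) auto
    finally show "R m \<le> real m * (real p)\<^sup>2 / N ^ 3" .
  qed
  have Q: "Q - f / N\<^sup>2 = R p - (\<Sum>j<k. R (d j))"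
  proof -
    have "(\<Sum>j<k. R (d j)) = - (\<Sum>j<k. L N (real (d j))) - (real p / N + (\<Sum>j<k. (real (d j))\<^sup>2) / (2 * N\<^sup>2))"
      by (simp add: R_def sum_subtractf sum.distrib sum_negf ps sum_divide_distrib power_divide mult.commute)
    then show ?thesis
      unfolding R_def Q_def f_def lrt_df_def total_dim_offset p(1)[symmetric] N_def[symmetric]
      by (simp add: power_divide diff_divide_distrib)
  qed
  have "\<bar>Q - f / N\<^sup>2\<bar> \<le> real p * (real p)\<^sup>2 / N ^ 3"
  proof -
    have "0 \<le> (\<Sum>j<k. R (d j))" using R(1) dp by (intro sum_nonneg) auto
    moreover have "(\<Sum>j<k. R (d j)) \<le> (\<Sum>j<k. real (d j) * (real p)\<^sup>2 / N ^ 3)" using R(2) dp by (intro sum_mono) auto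
    then have "(\<Sum>j<k. R (d j)) \<le> real p * (real p)\<^sup>2 / N ^ 3"
      by (simp add: ps sum_divide_distrib sum_distrib_right)
    ultimately show ?thesis using R[of p] unfolding Q by auto
  qed
  also have "\<dots> \<le> real p * (real p)\<^sup>2 / (real n / 2) ^ 3"
    using N p by (intro divide_left_mono power_mono) auto
  also have "\<dots> = 8 * (real p)\<^sup>2 * real p / real n ^ 3" by (simp add: power_divide)
  finally have 1: "\<bar>Q - f / N\<^sup>2\<bar> \<le> 8 * (real p)\<^sup>2 * real p / real n ^ 3" .
  have f0: "0 \<le> f" unfolding f_def sum_block_start[symmetric] by (intro sum_nonneg) simp
  have 2: "\<bar>f / N\<^sup>2 - f / (real n)\<^sup>2\<bar> \<le> 8 * f / real n ^ 3"
  proof -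
    have e: "f / N\<^sup>2 - f / (real n)\<^sup>2 = f * ((real n - N) * (real n + N)) / (N\<^sup>2 * (real n)\<^sup>2)"
    proof -
      have "N \<noteq> 0" "real n \<noteq> 0" using N(1) p by auto
      then show ?thesis by (simp add: field_simps power2_eq_square)
    qed
    have "(real n - N) * (real n + N) \<le> 1 * (2 * real n)"
      using N by (intro mult_mono) auto
    then have "f * ((real n - N) * (real n + N)) / (N\<^sup>2 * (real n)\<^sup>2) \<le> f * (1 * (2 * real n)) / ((real n / 2)\<^sup>2 * (real n)\<^sup>2)"
      using f0 N p by (intro frac_le mult_left_mono mult_right_mono power_mono) auto
    also have "\<dots> = 8 * f / real n ^ 3"
      using p by (simp add: field_simps power2_eq_square power3_eq_cube)
    finally have "f / N\<^sup>2 - f / (real n)\<^sup>2 \<le> 8 * f / real n ^ 3" unfolding e .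
    moreover have "0 \<le> f / N\<^sup>2 - f / (real n)\<^sup>2"
      unfolding e using f0 N by (intro divide_nonneg_nonneg mult_nonneg_nonneg) auto
    ultimately show ?thesis by simp
  qed
  have "(16 * f + 32 * (real p)\<^sup>2 * real p) / real n ^ 3 = 2 * (8 * f / real n ^ 3) + 4 * (8 * (real p)\<^sup>2 * real p / real n ^ 3)"
    by (simp add: add_divide_distrib)
  moreover have "0 \<le> 8 * (real p)\<^sup>2 * real p / real n ^ 3" by simp
  moreover have "2 * lrt_df k d / (real n)\<^sup>2 = 2 * (f / (real n)\<^sup>2)" by (simp add: f_def)
  ultimately show "\<bar>2 * Q - 2 * lrt_df k d / (real n)\<^sup>2\<bar> \<le> (16 * lrt_df k d + 32 * (real p)\<^sup>2 * real p) / real n ^ 3"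
    using 1 2 unfolding f_def[symmetric] by linarith
qed

lemma has_bochner_integral_column:
  assumes "a < p" and h: "has_bochner_integral (gauss n) h I"
  shows "has_bochner_integral (gauss_columns n p) (\<lambda>y. h (y a)) (I :: real)"
proof -
  have d: "distr (gauss_columns n p) (gauss n) (\<lambda>y. y a) = gauss n"
    using distr_PiM_component[of "{..<p}" "\<lambda>_. gauss n" a] assms(1) prob_space_gauss by simp
  have "has_bochner_integral (distr (gauss_columns n p) (gauss n) (\<lambda>y. y a)) h I"
    unfolding d by (rule h)
  moreover have "(\<lambda>y. y a) \<in> measurable (gauss_columns n p) (gauss n)"
    using assms(1) by (intro measurable_component_singleton) simp
  moreover have "h \<in> borel_measurable (gauss n)" using h by (rule borel_measurable_has_bochner_integral)
  ultimately show ?thesis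
    by (simp add: has_bochner_integral_iff integrable_distr_eq integral_distr)
qed

text \<open>Everything is measured against \<open>\<phi> = f / n^2\<close>, to which half the true
  variance \<open>V\<close> and the formula value \<open>Q\<close> both reduce. The lower bound
  \<open>c * p^2\<close> for f keeps the standard deviation at least of order \<open>p / n\<close>,
  so that the error (p/n)^2 in the mean is negligible. The threshold \<open>x\<close> is
  arbitrary.\<close>

lemma LRT_normal_bound:
  assumes ns: "normal_sample M n (total_dim k d) m S X" and H0: "block_independence k d S"
    and c: "0 < c" "c \<le> 1" and p: "p = total_dim k d" "0 < p"
    and cf: "c * (real p)\<^sup>2 \<le> lrt_df k d" and big: "10000000 / c * real p \<le> real n"
  shows "\<bar>measure M {\<omega> \<in> space M. - 2 * ln (LRT n k d (\<lambda>i. X i \<omega>)) > x} -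
      normal_tail ((x + 2 * lrt_mu n k d) / (2 * real n * lrt_sigma n k d))\<bar>
    \<le> 7 * (5000000 / (c * real p)) powr (1 / 8) + 4000000 / c * (real p / real n)"
proof -
  define f where "f = lrt_df k d"
  define \<delta> where "\<delta> = real p / real n"
  define \<phi> where "\<phi> = f / (real n)\<^sup>2"
  have po: "p = offset d k" by (simp add: p(1) total_dim_offset)
  have np: "10000000 * real p \<le> real n"
  proof -
    have "10000000 * real p \<le> 10000000 / c * real p"
      using c by (intro mult_right_mono) (auto simp: le_divide_eq)
    then show ?thesis using big by simp
  qed
  then have n34: "2 * p + 34 \<le> n" using p(2) by linarith
  have n0: "0 < real n" using n34 by simp
  have \<delta>: "0 < \<delta>" "\<delta> \<le> c / 10000000"
    using p(2) n0 big c by (auto simp: \<delta>_def field_simps)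
  have f0: "0 < f" using cf c p(2) unfolding f_def by (intro less_le_trans[OF _ cf]) auto
  have \<phi>0: "0 < \<phi>" using f0 n0 by (simp add: \<phi>_def)
  have c\<delta>: "c * \<delta>\<^sup>2 \<le> \<phi>"
    using cf n0 by (simp add: \<delta>_def \<phi>_def f_def power_divide divide_right_mono)
  have d2: "(\<Sum>j<k. (real (d j))\<^sup>2) = (real p)\<^sup>2 - 2 * f"
    by (simp add: f_def lrt_df_def p(1) field_simps)
  have fp: "2 * f \<le> (real p)\<^sup>2"
    using sum_nonneg[of "{..<k}" "\<lambda>j. (real (d j))\<^sup>2"] d2 by simp
  define e where "e a = (\<integral>z. log_resid n d a z \<partial>gauss n)" for a
  define v where "v a = (\<integral>z. (log_resid n d a z - e a)\<^sup>2 \<partial>gauss n)" for a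
  define w where "w a = (\<integral>z. (log_resid n d a z - e a) ^ 4 \<partial>gauss n)" for a
  define s where "s a = real (block_start d a)" for a
  define V where "V = (\<Sum>a<p. v a)"
  define E where "E = (\<Sum>a<p. e a)"
  define Y where "Y a y = log_resid n d a (y a) - e a" for a and y :: "nat \<Rightarrow> nat \<Rightarrow> real"
  let ?G = "gauss_columns n p"
  interpret G: prob_space ?G by (rule prob_space_gauss_columns)
  interpret g: prob_space "gauss n" by (rule prob_space_gauss)
  note L = log_resid_moments[OF _ po n34, folded e_def s_def]
  have sf: "(\<Sum>a<p. s a) = f" unfolding s_def f_def po by (rule sum_block_start)
  have hb: "has_bochner_integral (gauss n) (\<lambda>z. log_resid n d a z - e a) 0"
    "has_bochner_integral (gauss n) (\<lambda>z. (log_resid n d a z - e a)\<^sup>2) (v a)"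
    "has_bochner_integral (gauss n) (\<lambda>z. (log_resid n d a z - e a) ^ 4) (w a)" if "a < p" for a
    using L(1-3)[OF that] g.prob_space by (simp_all add: has_bochner_integral_iff e_def v_def w_def)
  have hbY: "has_bochner_integral ?G (Y a) 0" "has_bochner_integral ?G (\<lambda>y. (Y a y)\<^sup>2) (v a)"
    "has_bochner_integral ?G (\<lambda>y. (Y a y) ^ 4) (w a)" if "a < p" for a
    unfolding Y_def by (rule has_bochner_integral_column[OF that hb(1)[OF that]]
      has_bochner_integral_column[OF that hb(2)[OF that]] has_bochner_integral_column[OF that hb(3)[OF that]])+
  have ind: "G.indep_vars (\<lambda>_. borel) Y {..<p}"
  proof -
    have "G.indep_vars (\<lambda>_. gauss n) (\<lambda>a y. y a) {..<p}"
      by (rule indep_vars_PiM_components) (rule prob_space_gauss)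
    then show ?thesis
      unfolding Y_def[abs_def] by (rule G.indep_vars_compose2) measurable
  qed
  have Vb: "\<bar>V - 2 * \<phi>\<bar> \<le> 1600016 * \<phi> * \<delta>"
  proof -
    have "2 * \<phi> = (\<Sum>a<p. 2 * s a / (real n)\<^sup>2)"
      by (simp add: \<phi>_def sf[symmetric] sum_distrib_left sum_divide_distrib)
    then have "\<bar>V - 2 * \<phi>\<bar> = \<bar>\<Sum>a<p. v a - 2 * s a / (real n)\<^sup>2\<bar>"
      by (simp add: V_def sum_subtractf)
    also have "\<dots> \<le> (\<Sum>a<p. \<bar>v a - 2 * s a / (real n)\<^sup>2\<bar>)" by (rule sum_abs)
    also have "\<dots> \<le> (\<Sum>a<p. 1600016 * s a * real p / real n ^ 3)"
      using L(5) by (intro sum_mono) (auto simp: v_def)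
    also have "\<dots> = 1600016 * (\<Sum>a<p. s a) * real p / real n ^ 3"
      by (simp add: sum_distrib_left sum_distrib_right sum_divide_distrib)
    also have "\<dots> = 1600016 * \<phi> * \<delta>"
      using n0 by (simp add: sf \<phi>_def \<delta>_def power2_eq_square power3_eq_cube)
    finally show ?thesis .
  qed
  have W: "(\<Sum>a<p. w a) \<le> 4800000 * f * real p / real n ^ 4"
  proof -
    have "(\<Sum>a<p. w a) \<le> (\<Sum>a<p. 4800000 * s a * real p / real n ^ 4)"
      using L(6) by (intro sum_mono) (auto simp: w_def)
    also have "\<dots> = 4800000 * (\<Sum>a<p. s a) * real p / real n ^ 4"
      by (simp add: sum_distrib_left sum_distrib_right sum_divide_distrib)
    finally show ?thesis by (simp add: sf)
  qed
  define \<mu> where "\<mu> = lrt_mu n k d"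
  have Eb: "\<bar>E + 2 * \<mu> / real n\<bar> \<le> 120 * \<delta>\<^sup>2"
  proof -
    define l where "l a = ln (1 + s a / (real n - 1 - real a))" for a
    have "\<bar>(\<Sum>a<p. e a) - (\<Sum>a<p. l a)\<bar> = \<bar>\<Sum>a<p. e a - l a\<bar>" by (simp add: sum_subtractf)
    also have "\<dots> \<le> (\<Sum>a<p. \<bar>e a - l a\<bar>)" by (rule sum_abs)
    also have "\<dots> \<le> (\<Sum>a<p. 160 * s a / (real n)\<^sup>2)"
      using L(4) by (intro sum_mono) (auto simp: l_def)
    also have "\<dots> = 160 * f / (real n)\<^sup>2"
      by (simp add: sf[symmetric] sum_distrib_left sum_divide_distrib)
    finally have 1: "\<bar>E - (\<Sum>a<p. l a)\<bar> \<le> 160 * f / (real n)\<^sup>2" by (simp add: E_def)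
    have 2: "\<bar>(\<Sum>a<p. l a) + 2 * \<mu> / real n\<bar> \<le> 20 * ((real p)\<^sup>2 + ((real p)\<^sup>2 - 2 * f)) / (real n)\<^sup>2"
      using sum_ln_lrt_mu[OF po n34] unfolding d2 l_def s_def \<mu>_def .
    have "\<bar>E + 2 * \<mu> / real n\<bar> \<le> 160 * f / (real n)\<^sup>2 + 20 * ((real p)\<^sup>2 + ((real p)\<^sup>2 - 2 * f)) / (real n)\<^sup>2"
      using 1 2 by linarith
    also have "\<dots> = (160 * f + 20 * ((real p)\<^sup>2 + ((real p)\<^sup>2 - 2 * f))) / (real n)\<^sup>2"
      by (rule add_divide_distrib[symmetric])
    also have "\<dots> \<le> (120 * (real p)\<^sup>2) / (real n)\<^sup>2"
    proof (intro divide_right_mono)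
      have "20 * ((real p)\<^sup>2 + ((real p)\<^sup>2 - 2 * f)) = 40 * (real p)\<^sup>2 - 40 * f" by simp
      then show "160 * f + 20 * ((real p)\<^sup>2 + ((real p)\<^sup>2 - 2 * f)) \<le> 120 * (real p)\<^sup>2"
        using fp f0 by linarith
    qed simp
    also have "\<dots> = 120 * \<delta>\<^sup>2" by (simp add: \<delta>_def power_divide)
    finally show ?thesis .
  qed
  define Q where "Q = - L (real n - 1) (real p) + (\<Sum>j<k. L (real n - 1) (real (d j)))"
  have \<sigma>: "lrt_sigma n k d = sqrt (Q / 2)"
    unfolding Q_def by (rule lrt_sigma_approx(1)[OF po n34])
  have Qb: "\<bar>2 * Q - 2 * \<phi>\<bar> \<le> 48 / c * \<phi> * \<delta>"
  proof -
    have p1: "1 \<le> real p" using p(2) by simp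
    have "c * (16 * f + 32 * (real p)\<^sup>2 * real p) \<le> 48 * f * real p"
    proof -
      have "c * f \<le> 1 * f" using c f0 by (intro mult_right_mono) auto
      also have "\<dots> \<le> f * real p" using p1 f0 by simp
      finally have "c * f \<le> f * real p" .
      moreover have "c * (real p)\<^sup>2 * real p \<le> f * real p" using cf by (intro mult_right_mono) (auto simp: f_def)
      ultimately show ?thesis by (simp add: algebra_simps)
    qed
    then have "16 * f + 32 * (real p)\<^sup>2 * real p \<le> 48 / c * f * real p"
      using c by (simp add: field_simps)
    then have "(16 * f + 32 * (real p)\<^sup>2 * real p) / real n ^ 3 \<le> (48 / c * f * real p) / real n ^ 3"
      by (intro divide_right_mono) auto
    also have "\<dots> = 48 / c * \<phi> * \<delta>"
      by (simp add: \<phi>_def \<delta>_def power2_eq_square power3_eq_cube)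
    finally show ?thesis
      using lrt_sigma_approx(2)[OF po n34] unfolding Q_def[symmetric] f_def[symmetric] by (simp add: \<phi>_def)
  qed
  have \<phi>\<delta>: "\<phi> * \<delta> \<le> \<phi> * (c / 10000000)" using \<phi>0 \<delta> by (intro mult_left_mono) auto
  have V\<phi>: "\<phi> \<le> V"
  proof -
    have "\<phi> * (c / 10000000) \<le> \<phi> * (1 / 10000000)" using \<phi>0 c by (intro mult_left_mono) auto
    then have "1600016 * \<phi> * \<delta> \<le> \<phi>" using \<phi>\<delta> \<phi>0 by simp
    then show ?thesis using Vb by linarith
  qed
  have Q\<phi>: "\<phi> \<le> 2 * Q"
  proof -
    have "48 / c * (\<phi> * \<delta>) \<le> 48 / c * (\<phi> * (c / 10000000))"
      using c by (intro mult_left_mono \<phi>\<delta>) auto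
    also have "\<dots> \<le> \<phi>" using c \<phi>0 by simp
    finally have "48 / c * \<phi> * \<delta> \<le> \<phi>" by simp
    then show ?thesis using Qb by linarith
  qed
  have V0: "0 < V" and Q0: "0 < Q" using V\<phi> Q\<phi> \<phi>0 by auto
  \<comment> \<open>Ratio of the standard deviation in the statement, \<open>2 * lrt_sigma\<close>,
    to the true one.\<close>
  define r where "r = sqrt (2 * Q / V)"
  have r1: "\<bar>r - 1\<bar> \<le> 1600064 / c * \<delta>"
  proof -
    have r2: "r\<^sup>2 = 2 * Q / V" "0 \<le> r" using V0 Q0 by (auto simp: r_def)
    have le: "1600016 * \<phi> * \<delta> \<le> 1600016 / c * \<phi> * \<delta>"
      using c \<phi>0 \<delta> by (intro mult_right_mono) (auto simp: le_divide_eq)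
    have "\<bar>2 * Q - V\<bar> \<le> \<bar>2 * Q - 2 * \<phi>\<bar> + \<bar>V - 2 * \<phi>\<bar>" by linarith
    also have "\<dots> \<le> 48 / c * \<phi> * \<delta> + 1600016 / c * \<phi> * \<delta>"
      by (intro add_mono Qb order_trans[OF Vb le])
    also have "\<dots> = 1600064 / c * \<delta> * \<phi>" by (simp add: field_simps)
    also have "\<dots> \<le> 1600064 / c * \<delta> * V" using V\<phi> c \<delta> by (intro mult_left_mono) auto
    finally have "\<bar>2 * Q - V\<bar> / V \<le> 1600064 / c * \<delta>" using V0 by (simp add: divide_le_eq)
    moreover have "\<bar>r\<^sup>2 - 1\<bar> = \<bar>2 * Q - V\<bar> / V"
    proof -
      have "r\<^sup>2 - 1 = (2 * Q - V) / V" using V0 by (simp add: r2 diff_divide_distrib)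
      then show ?thesis using V0 by (simp add: abs_divide)
    qed
    moreover have "\<bar>r - 1\<bar> \<le> \<bar>r\<^sup>2 - 1\<bar>"
    proof -
      have "r\<^sup>2 - 1 = (r - 1) * (r + 1)" by (simp add: power2_eq_square algebra_simps)
      then have "\<bar>r\<^sup>2 - 1\<bar> = \<bar>r - 1\<bar> * \<bar>r + 1\<bar>" by (simp only: abs_mult)
      then have "\<bar>r\<^sup>2 - 1\<bar> = \<bar>r - 1\<bar> * (r + 1)" using r2(2) by simp
      moreover have "\<bar>r - 1\<bar> * 1 \<le> \<bar>r - 1\<bar> * (r + 1)" using r2(2) by (intro mult_left_mono) auto
      ultimately show ?thesis by simp
    qed
    ultimately show ?thesis by linarith
  qed
  have "1600064 / c * \<delta> \<le> 1600064 / c * (c / 10000000)" using \<delta> c by (intro mult_left_mono) auto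
  then have r_half: "\<bar>r - 1\<bar> \<le> 1 / 2" using r1 c by simp
  \<comment> \<open>Error of the centring in units of the true standard deviation: at most
    \<open>120 * \<delta>\<^sup>2\<close> over \<open>c * \<delta>\<close>.\<close>
  define b where "b = (E + 2 * \<mu> / real n) / sqrt V"
  have b1: "\<bar>b\<bar> \<le> 120 / c * \<delta>"
  proof -
    have "(c * \<delta>)\<^sup>2 \<le> V"
    proof -
      have "(c * \<delta>)\<^sup>2 = c * (c * \<delta>\<^sup>2)" by (simp add: power2_eq_square)
      also have "\<dots> \<le> 1 * (c * \<delta>\<^sup>2)" using c by (intro mult_right_mono) auto
      finally show ?thesis using c\<delta> V\<phi> by simp
    qed
    then have "c * \<delta> \<le> sqrt V" by (rule real_le_rsqrt)
    then have "\<bar>b\<bar> \<le> 120 * \<delta>\<^sup>2 / (c * \<delta>)"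
      unfolding b_def using Eb c \<delta> V0 by (simp add: abs_divide) (intro frac_le, auto)
    then show ?thesis using \<delta> by (simp add: power2_eq_square)
  qed
  define y where "y = (x + 2 * \<mu>) / (2 * real n * lrt_sigma n k d)"
  define t where "t = (x / real n - E) / sqrt V"
  \<comment> \<open>The exact standardised threshold is that of the statement, rescaled by
    \<open>r\<close> and shifted by \<open>b\<close>; the shift is handled by the Lipschitz bound,
    the rescaling by \<open>normal_tail_scale\<close>.\<close>
  have t: "t = r * y - b"
  proof -
    have "2 * lrt_sigma n k d = sqrt (2 * Q)"
    proof -
      have "sqrt (2 * Q) = sqrt (2\<^sup>2 * (Q / 2))" by simp
      then show ?thesis unfolding \<sigma> real_sqrt_mult by simp
    qed
    then have "r * y = sqrt (2 * Q) / sqrt V * ((x + 2 * \<mu>) / (real n * sqrt (2 * Q)))"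
      by (simp add: r_def y_def real_sqrt_divide mult_ac)
    also have "\<dots> = (x / real n + 2 * \<mu> / real n) / sqrt V"
    proof -
      have "s / v * (a / (real n * s)) = (a / real n) / v" if "0 < s" for s v a :: real
        using that n0 by simp
      from this[of "sqrt (2 * Q)"] show ?thesis using Q0 by (simp only: add_divide_distrib[symmetric]) simp
    qed
    finally show ?thesis by (simp add: t_def b_def diff_divide_distrib add_divide_distrib)
  qed
  have "measure M {\<omega> \<in> space M. - 2 * ln (LRT n k d (\<lambda>i. X i \<omega>)) > x} =
      G.prob {y \<in> space ?G. real n * (\<Sum>a<p. log_resid n d a (y a)) > x}"
    unfolding p(1) using n34 p by (intro prob_LRT[OF ns H0]) auto
  also have "{y \<in> space ?G. real n * (\<Sum>a<p. log_resid n d a (y a)) > x} =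
      {y \<in> space ?G. (\<Sum>a<p. Y a y) > sqrt V * t}"
  proof -
    have "(\<Sum>a<p. Y a y) = (\<Sum>a<p. log_resid n d a (y a)) - E" for y
      by (simp add: Y_def E_def sum_subtractf)
    moreover have "sqrt V * t = x / real n - E" using V0 by (simp add: t_def)
    ultimately show ?thesis using n0 by (simp add: divide_less_eq mult.commute)
  qed
  finally have P: "measure M {\<omega> \<in> space M. - 2 * ln (LRT n k d (\<lambda>i. X i \<omega>)) > x} =
      G.prob {y \<in> space ?G. (\<Sum>a<p. Y a y) > sqrt V * t}" .
  have "\<bar>G.prob {y \<in> space ?G. (\<Sum>a<p. Y a y) > sqrt V * t} - normal_tail t\<bar> \<le>
      7 * (5000000 / (c * real p)) powr (1 / 8)"
  proof (rule G.normal_approximation[OF ind])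
    show "V = (\<Sum>a<p. G.expectation (\<lambda>y. (Y a y)\<^sup>2))"
      using hbY(2) by (simp add: V_def has_bochner_integral_iff)
    \<comment> \<open>The fourth-moment ratio is of order \<open>f * p / f^2 = p / f\<close>, hence
      at most of order \<open>1 / (c * p)\<close>.\<close>
    have "4800000 * f * real p \<le> 5000000 / (c * real p) * f\<^sup>2"
    proof -
      have "4800000 * f * real p * (c * real p) = 4800000 * f * (c * (real p)\<^sup>2)" by (simp add: power2_eq_square)
      also have "\<dots> \<le> 4800000 * f * f" using cf f0 by (intro mult_left_mono) (auto simp: f_def)
      also have "\<dots> \<le> 5000000 * f\<^sup>2" by (simp add: power2_eq_square)
      finally show ?thesis using c p(2) by (simp add: le_divide_eq)
    qed
    then have "4800000 * f * real p / real n ^ 4 \<le> 5000000 / (c * real p) * f\<^sup>2 / real n ^ 4"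
      by (intro divide_right_mono) auto
    also have "\<dots> = 5000000 / (c * real p) * \<phi>\<^sup>2"
      by (simp add: \<phi>_def power_divide power_mult[symmetric])
    also have "\<dots> \<le> 5000000 / (c * real p) * V\<^sup>2"
      using V\<phi> \<phi>0 c by (intro mult_left_mono power_mono) auto
    finally show "(\<Sum>a<p. G.expectation (\<lambda>y. (Y a y) ^ 4)) \<le> 5000000 / (c * real p) * V\<^sup>2"
      using W hbY(3) by (simp add: has_bochner_integral_iff)
    show "0 < 5000000 / (c * real p)" using c p(2) by simp
  qed (use hbY V0 in \<open>auto simp: has_bochner_integral_iff\<close>)
  moreover have "\<bar>normal_tail t - normal_tail (r * y)\<bar> \<le> 120 / c * \<delta>"
    using normal_tail_lipschitz[of t "r * y"] b1 by (simp add: t)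
  moreover have "\<bar>normal_tail (r * y) - normal_tail y\<bar> \<le> 2 * (1600064 / c * \<delta>)"
  proof -
    have "1 / 2 \<le> r" "r \<le> 3 / 2" using r_half by linarith+
    then have "\<bar>normal_tail (r * y) - normal_tail y\<bar> \<le> 2 * \<bar>r - 1\<bar>" by (rule normal_tail_scale)
    also have "\<dots> \<le> 2 * (1600064 / c * \<delta>)" using r1 by (intro mult_left_mono) auto
    finally show ?thesis .
  qed
  moreover have "120 / c * \<delta> + 2 * (1600064 / c * \<delta>) \<le> 4000000 / c * \<delta>"
  proof -
    have "0 \<le> \<delta> / c" using c \<delta> by simp
    then show ?thesis by simp
  qed
  ultimately show ?thesis
    unfolding P y_def[unfolded \<mu>_def, symmetric] \<delta>_def[symmetric] by linarith
qed

text \<open>Twice f is the sum of \<open>d i * (P - d i)\<close>. Comparability gives every block at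
  least the share \<delta> / k of \<open>P\<close>, and as there is a second block, the complement
  of each block has at least that share.\<close>

lemma lrt_df_lower_bound:
  assumes k: "2 \<le> k" and \<delta>: "0 < \<delta>"
    and ratio: "\<And>i j. i < k \<Longrightarrow> j < k \<Longrightarrow> \<delta> < real (d i) / real (d j)"
  shows "\<delta> / (2 * real k) * (real (total_dim k d))\<^sup>2 \<le> lrt_df k d"
proof -
  define P where "P = real (total_dim k d)"
  have PS: "P = (\<Sum>j<k. real (d j))" by (simp add: P_def total_dim_def)
  have pos: "0 < real (d j)" if "j < k" for j
  proof -
    \<comment> \<open>An empty block would have ratio 0 to itself, by the convention for division by
      zero.\<close>
    have "0 < real (d j) / real (d j)" using ratio[OF that that] \<delta> by linarith
    then show ?thesis by (cases "d j = 0") auto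
  qed
  have low: "\<delta> * P / real k \<le> real (d i)" if i: "i < k" for i
  proof -
    have "\<delta> * P = (\<Sum>j<k. \<delta> * real (d j))" by (simp add: PS sum_distrib_left)
    also have "\<dots> \<le> (\<Sum>j<k. real (d i))"
      using ratio[OF i] pos by (intro sum_mono) (simp add: less_divide_eq less_imp_le)
    finally show ?thesis using k by (simp add: divide_le_eq mult.commute)
  qed
  have other: "\<delta> * P / real k \<le> P - real (d i)" if i: "i < k" for i
  proof -
    define j where "j = (if i = 0 then 1 else 0 :: nat)"
    have j: "j < k" "j \<noteq> i" using k by (auto simp: j_def)
    have "P = real (d i) + (\<Sum>l\<in>{..<k} - {i}. real (d l))"
      unfolding PS using i by (subst sum.remove[of _ i]) auto
    moreover have "real (d j) \<le> (\<Sum>l\<in>{..<k} - {i}. real (d l))"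
      using j by (intro member_le_sum) auto
    ultimately show ?thesis using low[OF j(1)] by linarith
  qed
  have "2 * lrt_df k d = (\<Sum>i<k. real (d i) * (P - real (d i)))"
  proof -
    have "2 * lrt_df k d = P * P - (\<Sum>i<k. (real (d i))\<^sup>2)"
      by (simp add: lrt_df_def P_def power2_eq_square)
    also have "P * P = (\<Sum>i<k. real (d i) * P)" by (simp add: PS sum_distrib_right)
    finally show ?thesis by (simp add: sum_subtractf right_diff_distrib power2_eq_square)
  qed
  moreover have "(\<Sum>i<k. real (d i) * (\<delta> * P / real k)) \<le> (\<Sum>i<k. real (d i) * (P - real (d i)))"
    using other by (intro sum_mono mult_left_mono) auto
  ultimately have "P * (\<delta> * P / real k) \<le> 2 * lrt_df k d"
    by (simp only: PS sum_distrib_right)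
  then show ?thesis by (simp add: P_def[symmetric] power2_eq_square mult_ac)
qed

text \<open>Both corrections are at most 1/4: the second is below \<open>p^3 / (6 * n * f)\<close>,
  hence below \<open>p / (6 * c * n)\<close>. Positivity is what allows the threshold to be divided
  by \<rho>.\<close>

lemma bartlett_pos:
  assumes c: "0 < c" "c \<le> 1" and p: "p = total_dim k d" "0 < p"
    and cf: "c * (real p)\<^sup>2 \<le> lrt_df k d" and big: "10000000 / c * real p \<le> real n"
  shows "0 < bartlett n k d"
proof -
  define f where "f = lrt_df k d"
  have f0: "0 < f" using c p(2) unfolding f_def by (intro less_le_trans[OF _ cf]) auto
  have p1: "1 \<le> real p" using p(2) by simp
  have np: "10000000 * real p \<le> c * real n" using big c by (simp add: field_simps)
  then have "10000000 * real p \<le> real n"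
    using c by (meson mult_left_le_one_le of_nat_0_le_iff less_imp_le order_trans)
  then have n: "10000000 \<le> real n" using p1 by linarith
  have f2: "(real (total_dim k d))\<^sup>2 - (\<Sum>i<k. (real (d i))\<^sup>2) = 2 * f" by (simp add: f_def lrt_df_def)
  have "((real p) ^ 3 - (\<Sum>i<k. (real (d i)) ^ 3)) / (3 * real n * (2 * f)) \<le> (real p) ^ 3 / (3 * real n * (2 * f))"
    using f0 by (intro divide_right_mono) (auto intro!: sum_nonneg)
  also have "\<dots> \<le> (real p) ^ 3 / (3 * real n * (2 * (c * (real p)\<^sup>2)))"
    using cf f0 n c p1 by (intro divide_left_mono mult_left_mono) (auto simp: f_def)
  also have "\<dots> = real p / (6 * (c * real n))"
    using p1 by (simp add: power2_eq_square power3_eq_cube)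
  also have "\<dots> \<le> real p / (6 * (10000000 * real p))"
    using np p1 c n by (intro divide_left_mono) auto
  also have "\<dots> \<le> 1 / 4" using p1 by simp
  finally have 1: "((real p) ^ 3 - (\<Sum>i<k. (real (d i)) ^ 3)) / (3 * real n * (2 * f)) \<le> 1 / 4" .
  have "3 / (2 * real n) \<le> 1 / 4" using n by (simp add: divide_le_eq)
  moreover have "bartlett n k d =
      1 - 3 / (2 * real n) - ((real p) ^ 3 - (\<Sum>i<k. (real (d i)) ^ 3)) / (3 * real n * (2 * f))"
    unfolding bartlett_def f2 p(1) by simp
  ultimately show ?thesis using 1 by linarith
qed

theorem theorem9:
  fixes k :: nat
    and d :: "nat \<Rightarrow> nat \<Rightarrow> nat"
    and M :: "nat \<Rightarrow> 'a measure"
    and X :: "nat \<Rightarrow> nat \<Rightarrow> 'a \<Rightarrow> nat \<Rightarrow> real"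
    and m :: "nat \<Rightarrow> real Matrix.vec"
    and S :: "nat \<Rightarrow> real mat"
    and \<delta>\<^sub>0 :: real
  defines "p \<equiv> \<lambda>n. total_dim k (d n)"
    and "f \<equiv> \<lambda>n. lrt_df k (d n)"
    and "\<rho> \<equiv> \<lambda>n. bartlett n k (d n)"
    and "\<mu> \<equiv> \<lambda>n. lrt_mu n k (d n)"
    and "\<sigma> \<equiv> \<lambda>n. lrt_sigma n k (d n)"
    and "\<Lambda> \<equiv> \<lambda>n \<omega>. LRT n k (d n) (\<lambda>i. X n i \<omega>)"
    and "q \<equiv> \<lambda>n \<alpha>. chi_square_upper_quantile (lrt_df k (d n)) \<alpha>"
  assumes k: "k \<ge> 2"
    and \<delta>\<^sub>0: "0 < \<delta>\<^sub>0" "\<delta>\<^sub>0 < 1"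
    and ratio: "\<And>n i j. n \<ge> 1 \<Longrightarrow> i < k \<Longrightarrow> j < k \<Longrightarrow>
      \<delta>\<^sub>0 < real (d n i) / real (d n j) \<and> real (d n i) / real (d n j) < 1 / \<delta>\<^sub>0"
    and p_infinity: "filterlim p at_top sequentially"
    and p_over_n: "(\<lambda>n. real (p n) / real n) \<longlonglongrightarrow> 0"
    and sample: "\<And>n. n \<ge> 1 \<Longrightarrow> normal_sample (M n) n (p n) (m n) (S n) (X n)"
    and H0: "\<And>n. n \<ge> 1 \<Longrightarrow> block_independence k (d n) (S n)"
  shows "\<exists>\<delta>. 0 < \<delta> \<and> \<delta> < 1 \<and> (\<forall>\<alpha>. 0 < \<alpha> \<and> \<alpha> < 1 \<longrightarrow>
    (\<lambda>n. (measure (M n) {\<omega> \<in> space (M n). - 2 * ln (\<Lambda> n \<omega>) > q n \<alpha>} - \<alpha>)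
          - (normal_tail ((q n \<alpha> + 2 * \<mu> n) / (2 * real n * \<sigma> n)) - \<alpha>))
      \<in> O(\<lambda>n. (real (p n) / real n) powr ((1 - \<delta>) / 2) + f n powr (- (1 - \<delta>) / 6))
  \<and> (\<lambda>n. (measure (M n) {\<omega> \<in> space (M n). - 2 * \<rho> n * ln (\<Lambda> n \<omega>) > q n \<alpha>} - \<alpha>)
          - (normal_tail ((q n \<alpha> + 2 * \<rho> n * \<mu> n) / (2 * \<rho> n * real n * \<sigma> n)) - \<alpha>))
      \<in> O(\<lambda>n. (real (p n) / real n) powr ((1 - \<delta>) / 2) + f n powr (- (1 - \<delta>) / 6)))"
proof -
  define c where "c = \<delta>\<^sub>0 / (2 * real k)"
  have c: "0 < c" "c \<le> 1" using k \<delta>\<^sub>0 by (auto simp: c_def divide_le_eq)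
  define C where "C = 7 * (5000000 / c) powr (1 / 8) + 4000000 / c"
  \<comment> \<open>The claimed rate at \<delta> = 3/4: exponents 1/8 and -1/24.\<close>
  define B where "B n = (real (p n) / real n) powr ((1 - 3 / 4) / 2) + f n powr (- (1 - 3 / 4) / 6)" for n
  have cf: "c * (real (p n))\<^sup>2 \<le> f n" if "n \<ge> 1" for n
    unfolding c_def p_def f_def using k \<delta>\<^sub>0 ratio[OF that] by (intro lrt_df_lower_bound) auto
  have ev: "\<forall>\<^sub>F n in sequentially. n \<ge> 1 \<and> 0 < p n \<and> 10000000 / c * real (p n) \<le> real n"
  proof -
    have "\<forall>\<^sub>F n in sequentially. real (p n) / real n < c / 10000000"
      using c by (intro order_tendstoD(2)[OF p_over_n]) auto
    moreover have "\<forall>\<^sub>F n in sequentially. 1 \<le> p n"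
      using p_infinity by (simp add: filterlim_at_top)
    ultimately show ?thesis
      using eventually_ge_at_top[of 1]
    proof eventually_elim
      case (elim n)
      then have "real (p n) * 10000000 \<le> c * real n" by (simp add: field_simps)
      then show ?case using elim c by (simp add: field_simps)
    qed
  qed
  \<comment> \<open>Kept for every real \<open>x\<close>, because it is applied to the quantile and
    to the quantile divided by \<rho>.\<close>
  have bound: "\<bar>measure (M n) {\<omega> \<in> space (M n). - 2 * ln (\<Lambda> n \<omega>) > x} -
      normal_tail ((x + 2 * \<mu> n) / (2 * real n * \<sigma> n))\<bar> \<le> C * B n"
    if n: "n \<ge> 1" "0 < p n" "10000000 / c * real (p n) \<le> real n" for n x
  proof -
    have p1: "1 \<le> real (p n)" using n(2) by simp
    have f0: "0 < f n" using c p1 by (intro less_le_trans[OF _ cf[OF n(1)]]) auto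
    have pn: "0 \<le> real (p n) / real n" "real (p n) / real n \<le> 1"
    proof -
      have "1 * real (p n) \<le> 10000000 / c * real (p n)"
        using c by (intro mult_right_mono) (auto simp: le_divide_eq)
      then have "real (p n) \<le> real n" using n(3) by linarith
      then show "real (p n) / real n \<le> 1" using n(1) by (simp add: divide_le_eq)
    qed simp
    \<comment> \<open>Since \<open>p \<ge> 1\<close> and \<open>f \<le> p^2\<close>, p^(-1/8) is at
      most p^(-1/12) = (p^2)^(-1/24), which is at most f^(-1/24).\<close>
    have A: "real (p n) powr (- 1 / 8) \<le> f n powr (- (1 - 3 / 4) / 6)"
    proof -
      have "(a - b) / 2 \<le> a" if "0 \<le> a" "0 \<le> b" for a b :: real using that by simp
      then have "f n \<le> (real (p n))\<^sup>2" by (simp only: f_def lrt_df_def p_def sum_nonneg zero_le_power2)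
      have "real (p n) powr (- 1 / 8) \<le> real (p n) powr (2 * (- 1 / 24))"
        using p1 by (intro powr_mono) auto
      also have "\<dots> = ((real (p n))\<^sup>2) powr (- 1 / 24)"
      proof -
        have "(real (p n))\<^sup>2 = real (p n) powr 2" using p1 by simp
        then show ?thesis by (simp only: powr_powr)
      qed
      also have "\<dots> \<le> f n powr (- 1 / 24)"
        using \<open>f n \<le> (real (p n))\<^sup>2\<close> f0 by (intro powr_mono2') auto
      finally show ?thesis by simp
    qed
    have D: "real (p n) / real n \<le> (real (p n) / real n) powr ((1 - 3 / 4) / 2)"
    proof (cases "p n = 0")
      case False
      then have "0 < real (p n) / real n" using n(1) by simp
      then have "(real (p n) / real n) powr 1 \<le> (real (p n) / real n) powr ((1 - 3 / 4) / 2)"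
        using pn(2) by (intro powr_mono') auto
      then show ?thesis using pn(1) by simp
    qed simp
    have "\<bar>measure (M n) {\<omega> \<in> space (M n). - 2 * ln (\<Lambda> n \<omega>) > x} -
      normal_tail ((x + 2 * \<mu> n) / (2 * real n * \<sigma> n))\<bar>
      \<le> 7 * (5000000 / (c * real (p n))) powr (1 / 8) + 4000000 / c * (real (p n) / real n)"
      unfolding \<Lambda>_def \<mu>_def \<sigma>_def
      using n c cf[OF n(1)] sample[OF n(1)] H0[OF n(1)]
      by (intro LRT_normal_bound[where k=k and d="d n" and p="p n"]) (auto simp: p_def f_def)
    also have "(5000000 / (c * real (p n))) powr (1 / 8) = (5000000 / c) powr (1 / 8) * real (p n) powr (- 1 / 8)"
    proof -
      have "5000000 / (c * real (p n)) = 5000000 / c * (1 / real (p n))" by simp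
      then have "(5000000 / (c * real (p n))) powr (1 / 8) = (5000000 / c) powr (1 / 8) * (1 / real (p n)) powr (1 / 8)"
        using c by (simp only: powr_mult)
      also have "(1 / real (p n)) powr (1 / 8) = real (p n) powr (- 1 / 8)"
        using p1 by (simp add: powr_divide powr_minus_divide)
      finally show ?thesis .
    qed
    also have "7 * ((5000000 / c) powr (1 / 8) * real (p n) powr (- 1 / 8)) + 4000000 / c * (real (p n) / real n)
        \<le> 7 * ((5000000 / c) powr (1 / 8) * f n powr (- (1 - 3 / 4) / 6)) +
          4000000 / c * (real (p n) / real n) powr ((1 - 3 / 4) / 2)"
      using A D c by (intro add_mono mult_left_mono) auto
    also have "\<dots> \<le> C * B n"
    proof -
      have "0 \<le> 7 * (5000000 / c) powr (1 / 8) * (real (p n) / real n) powr ((1 - 3 / 4) / 2)"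
        "0 \<le> 4000000 / c * f n powr (- (1 - 3 / 4) / 6)" using c by auto
      then show ?thesis unfolding C_def B_def distrib_left distrib_right by linarith
    qed
    finally show ?thesis .
  qed
  have B0: "0 \<le> B n" for n by (simp add: B_def)
  have "(\<lambda>n. (measure (M n) {\<omega> \<in> space (M n). - 2 * ln (\<Lambda> n \<omega>) > q n \<alpha>} - \<alpha>)
          - (normal_tail ((q n \<alpha> + 2 * \<mu> n) / (2 * real n * \<sigma> n)) - \<alpha>)) \<in> O(B)" for \<alpha>
  proof (rule bigoI[of _ C])
    show "\<forall>\<^sub>F n in sequentially. norm ((measure (M n) {\<omega> \<in> space (M n). - 2 * ln (\<Lambda> n \<omega>) > q n \<alpha>} - \<alpha>)
          - (normal_tail ((q n \<alpha> + 2 * \<mu> n) / (2 * real n * \<sigma> n)) - \<alpha>)) \<le> C * norm (B n)"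
      using ev
    proof eventually_elim
      case (elim n)
      then show ?case using bound[of n "q n \<alpha>"] B0[of n] by simp
    qed
  qed
  moreover have "(\<lambda>n. (measure (M n) {\<omega> \<in> space (M n). - 2 * \<rho> n * ln (\<Lambda> n \<omega>) > q n \<alpha>} - \<alpha>)
          - (normal_tail ((q n \<alpha> + 2 * \<rho> n * \<mu> n) / (2 * \<rho> n * real n * \<sigma> n)) - \<alpha>)) \<in> O(B)" for \<alpha>
  proof (rule bigoI[of _ C])
    show "\<forall>\<^sub>F n in sequentially. norm ((measure (M n) {\<omega> \<in> space (M n). - 2 * \<rho> n * ln (\<Lambda> n \<omega>) > q n \<alpha>} - \<alpha>)
          - (normal_tail ((q n \<alpha> + 2 * \<rho> n * \<mu> n) / (2 * \<rho> n * real n * \<sigma> n)) - \<alpha>)) \<le> C * norm (B n)"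
      using ev
    proof eventually_elim
      case (elim n)
      have \<rho>: "0 < \<rho> n"
        unfolding \<rho>_def using elim c cf[of n]
        by (intro bartlett_pos[of c "p n"]) (auto simp: p_def f_def)
      define Q where "Q = q n \<alpha> / \<rho> n"
      have Q: "q n \<alpha> = \<rho> n * Q" using \<rho> by (simp add: Q_def)
      have "- 2 * \<rho> n * ln (\<Lambda> n \<omega>) > q n \<alpha> \<longleftrightarrow> - 2 * ln (\<Lambda> n \<omega>) > Q" for \<omega>
      proof -
        have "- 2 * \<rho> n * ln (\<Lambda> n \<omega>) = \<rho> n * (- 2 * ln (\<Lambda> n \<omega>))" by simp
        then show ?thesis unfolding Q using \<rho> by (simp only: mult_less_cancel_left_pos)
      qed
      moreover have "(q n \<alpha> + 2 * \<rho> n * \<mu> n) / (2 * \<rho> n * real n * \<sigma> n) = (Q + 2 * \<mu> n) / (2 * real n * \<sigma> n)"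
      proof -
        have "q n \<alpha> + 2 * \<rho> n * \<mu> n = \<rho> n * (Q + 2 * \<mu> n)"
          "2 * \<rho> n * real n * \<sigma> n = \<rho> n * (2 * real n * \<sigma> n)"
          unfolding Q by (simp_all add: distrib_left)
        then show ?thesis using \<rho> by (simp only: mult_divide_mult_cancel_left[OF less_imp_neq[THEN not_sym, OF \<rho>]])
      qed
      ultimately show ?case using bound[of n Q] elim B0[of n] by simp
    qed
  qed
  ultimately show ?thesis
    unfolding B_def by (intro exI[of _ "3 / 4"]) auto
qed

end
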